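(* There is an isomorphism of $\Bbbk$-algebras $\chi:\mathcal{A}_\lambda(R^\pm_{p|q},\tau,u)\to A^\pm_{p|q}$ with $\chi(X_i)=x_i$ and $\chi(Y_i)=\partial_i$ for all $i\in\{1,\dots,n\}$ (and $\chi(u_i)=\partial_ix_i$). In particular the TGW algebra $\mathcal{A}_\lambda(R^\pm_{p|q},\tau,u)$ is consistent, i.e. the canonical map $R^\pm_{p|q}\to\mathcal{A}_\lambda(R^\pm_{p|q},\tau,u)$ is injective.
   Context: $\Bbbk$ is an algebraically closed field of characteristic $0$. TGW algebras: a TGW datum with index set $I$ is a triple $(R,\sigma,t)$ with $R$ an associative unital $\Bbbk$-algebra, $\sigma=(\sigma_i)_{i\in I}$ pairwise commuting $\Bbbk$-algebra automorphisms of $R$, and $t=(t_i)_{i\in I}$ central elements of $R$. Given also scalars $\mu=(\mu_{ij})_{i\ne j}$, $\mu_{ij}\in\Bbbk\setminus\{0\}$, the TGW construction $\mathcal{C}_\mu(R,\sigma,t)$ is the free $R$-ring on $\{X_i,Y_i\mid i\in I\}$ modulo the relations $X_ir=\sigma_i(r)X_i$, $Y_ir=\sigma_i^{-1}(r)Y_i$ ($r\in R$), $Y_iX_i=t_i$, $X_iY_i=\sigma_i(t_i)$, and $X_iY_j=\mu_{ij}Y_jX_i$ ($i\neq j$). It is $\mathbb{Z}I$-graded with $\deg X_i=\mathbf{e}_i$, $\deg Y_i=-\mathbf{e}_i$, $\deg r=0$. The TGW algebra $\mathcal{A}_\mu(R,\sigma,t)$ is the quotient of $\mathcal{C}_\mu(R,\sigma,t)$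 by the largest graded two-sided ideal having zero intersection with the degree-zero component; it inherits the grading. It is called consistent if the canonical map $\rho:R\to\mathcal{A}_\mu(R,\sigma,t)$ is injective. Clifford/Weyl superalgebra: fix $p,q\ge0$, $n=p+q$, a sign $\pm\in\{+,-\}$, and write $\mp=-\pm$. Set $p(i)=0$ for $1\le i\le p$ and $p(i)=1$ for $p<i\le n$. $A^\pm_{p|q}$ is the associative unital superalgebra generated by $x_i,\partial_i$ ($1\le i\le n$) of parity $p(i)$ with relations $[\partial_i,x_j]_\pm=\delta_{ij}$, $[x_i,x_j]_\pm=[\partial_i,\partial_j]_\pm=0$, where $[a,b]_\pm=ab\pm(-1)^{p(a)p(b)}ba$. Put $\lambda_{ij}=\mp(-1)^{p(i)p(j)}$ for $i,j\in\{1,\dots,n\}$. Let $R^\pm_{p|q}=\Bbbk[u_1,\dots,u_n]/(u_i^2-u_i\mid \lambda_{ii}=-1)$ (equivalently, for those $i$ with $(-1)^{p(i)}=\pm1$). Let $\tau_i$ be the automorphism of $R^\pm_{p|q}$ with $\tau_i(u_i)=\lambda_{ii}(u_i-1)$ and $\tau_i(u_j)=u_j$ for $j\ne i$; $\tau=(\tau_i)_{i=1}^n$, $u=(u_i)_{i=1}^n$, and $\mathcal{A}_\lambda(R^\pm_{p|q},\tau,u)$ is the TGW algebra with index set $\{1,\dots,n\}$ and $\mu_{ij}=\lambda_{ij}$. *)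

theory Defs
  imports "HOL-Algebra.QuotRing" "HOL-Computational_Algebra.Polynomial"
begin

text \<open>Elements of the free algebra on a generator set G are finitely supported
  functions from words (lists of generators) to the field; multiplication is
  concatenation-convolution.\<close>

definition fadd :: "('g list \<Rightarrow> 'k::field) \<Rightarrow> ('g list \<Rightarrow> 'k) \<Rightarrow> 'g list \<Rightarrow> 'k" where
  "fadd f g = (\<lambda>w. f w + g w)"

definition fmul :: "('g list \<Rightarrow> 'k::field) \<Rightarrow> ('g list \<Rightarrow> 'k) \<Rightarrow> 'g list \<Rightarrow> 'k" where
  "fmul f g = (\<lambda>w. \<Sum>k\<le>length w. f (take k w) * g (drop k w))"

definition fsmul :: "'k::field \<Rightarrow> ('g list \<Rightarrow> 'k) \<Rightarrow> 'g list \<Rightarrow> 'k" where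
  "fsmul c f = (\<lambda>w. c * f w)"

definition fsub :: "('g list \<Rightarrow> 'k::field) \<Rightarrow> ('g list \<Rightarrow> 'k) \<Rightarrow> 'g list \<Rightarrow> 'k" where
  "fsub f g = (\<lambda>w. f w - g w)"

definition fa_scal :: "'k::field \<Rightarrow> 'g list \<Rightarrow> 'k" where
  "fa_scal c = (\<lambda>w. if w = [] then c else 0)"

definition fa_gen :: "'g \<Rightarrow> 'g list \<Rightarrow> 'k::field" where
  "fa_gen g = (\<lambda>w. if w = [g] then 1 else 0)"

definition free_alg :: "'g set \<Rightarrow> ('g list \<Rightarrow> 'k::field) ring" where
  "free_alg G =
     \<lparr>carrier = {f. finite {w. f w \<noteq> 0} \<and> (\<forall>w. f w \<noteq> 0 \<longrightarrow> set w \<subseteq> G)},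
      monoid.mult = fmul, one = fa_scal 1, zero = (\<lambda>w. 0), add = fadd\<rparr>"

text \<open>Sign: s = True means \<open>\<pm> = +\<close>, s = False means \<open>\<pm> = -\<close>.\<close>

definition par :: "nat \<Rightarrow> nat \<Rightarrow> nat" where
  "par p i = (if i \<le> p then 0 else 1)"

definition lam :: "bool \<Rightarrow> nat \<Rightarrow> nat \<Rightarrow> nat \<Rightarrow> 'k::field" where
  "lam s p i j = (if s then -1 else 1) * (-1) ^ (par p i * par p j)"

text \<open>the sign in \<open>[a,b]_\<pm> = ab \<pm> (-1)^{p(a)p(b)} ba\<close>\<close>
definition wsgn :: "bool \<Rightarrow> nat \<Rightarrow> nat \<Rightarrow> nat \<Rightarrow> 'k::field" where
  "wsgn s p i j = (if s then 1 else -1) * (-1) ^ (par p i * par p j)"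

datatype gen = U nat | X nat | Y nat

definition R_gens :: "nat \<Rightarrow> gen set" where
  "R_gens n = U ` {1..n}"

definition tgw_gens :: "nat \<Rightarrow> gen set" where
  "tgw_gens n = U ` {1..n} \<union> X ` {1..n} \<union> Y ` {1..n}"

text \<open>Defining relations of \<open>R^\<pm>_{p|q} = \<Bbbk>[u_1..u_n]/(u_i^2-u_i | \<lambda>_ii=-1)\<close>
  as a quotient of the free algebra on \<open>u_1..u_n\<close>.\<close>
definition R_rels :: "bool \<Rightarrow> nat \<Rightarrow> nat \<Rightarrow> (gen list \<Rightarrow> 'k::field) set" where
  "R_rels s p q =
     {fsub (fmul (fa_gen (U i)) (fa_gen (U j))) (fmul (fa_gen (U j)) (fa_gen (U i)))
        | i j. i \<in> {1..p+q} \<and> j \<in> {1..p+q}}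
   \<union> {fsub (fmul (fa_gen (U i)) (fa_gen (U i))) (fa_gen (U i))
        | i. i \<in> {1..p+q} \<and> lam s p i i = (-1::'k)}"

definition R_free :: "nat \<Rightarrow> nat \<Rightarrow> (gen list \<Rightarrow> 'k::field) ring" where
  "R_free p q = free_alg (R_gens (p+q))"

definition R_ring :: "bool \<Rightarrow> nat \<Rightarrow> nat \<Rightarrow> (gen list \<Rightarrow> 'k::field) set ring" where
  "R_ring s p q = R_free p q Quot genideal (R_free p q) (R_rels s p q)"

text \<open>\<open>\<tau>_i(u_j)\<close> and \<open>\<tau>_i^{-1}(u_j)\<close>, as representatives in the free algebra:
  \<open>\<tau>_i(u_i) = \<lambda>_ii(u_i - 1)\<close>, \<open>\<tau>_i^{-1}(u_i) = \<lambda>_ii u_i + 1\<close> (as \<open>\<lambda>_ii = \<pm>1\<close>).\<close>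
definition tau :: "bool \<Rightarrow> nat \<Rightarrow> nat \<Rightarrow> nat \<Rightarrow> gen list \<Rightarrow> 'k::field" where
  "tau s p i j = (if i = j then fsmul (lam s p i i) (fsub (fa_gen (U i)) (fa_scal 1))
                  else fa_gen (U j))"

definition tau_inv :: "bool \<Rightarrow> nat \<Rightarrow> nat \<Rightarrow> nat \<Rightarrow> gen list \<Rightarrow> 'k::field" where
  "tau_inv s p i j = (if i = j then fadd (fsmul (lam s p i i) (fa_gen (U i))) (fa_scal 1)
                      else fa_gen (U j))"

text \<open>Relations of the TGW construction \<open>\<C>_\<lambda>(R,\<tau>,u)\<close>: relations of R, plus
  \<open>X_i r = \<tau>_i(r) X_i\<close>, \<open>Y_i r = \<tau>_i^{-1}(r) Y_i\<close> (on the generators \<open>r = u_j\<close> of R),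
  \<open>Y_i X_i = u_i\<close>, \<open>X_i Y_i = \<tau>_i(u_i)\<close>, \<open>X_i Y_j = \<lambda>_ij Y_j X_i\<close> (i \<noteq> j).\<close>
definition C_rels :: "bool \<Rightarrow> nat \<Rightarrow> nat \<Rightarrow> (gen list \<Rightarrow> 'k::field) set" where
  "C_rels s p q = R_rels s p q
   \<union> {fsub (fmul (fa_gen (X i)) (fa_gen (U j))) (fmul (tau s p i j) (fa_gen (X i)))
        | i j. i \<in> {1..p+q} \<and> j \<in> {1..p+q}}
   \<union> {fsub (fmul (fa_gen (Y i)) (fa_gen (U j))) (fmul (tau_inv s p i j) (fa_gen (Y i)))
        | i j. i \<in> {1..p+q} \<and> j \<in> {1..p+q}}
   \<union> {fsub (fmul (fa_gen (Y i)) (fa_gen (X i))) (fa_gen (U i)) | i. i \<in> {1..p+q}}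
   \<union> {fsub (fmul (fa_gen (X i)) (fa_gen (Y i))) (tau s p i i) | i. i \<in> {1..p+q}}
   \<union> {fsub (fmul (fa_gen (X i)) (fa_gen (Y j)))
           (fsmul (lam s p i j) (fmul (fa_gen (Y j)) (fa_gen (X i))))
        | i j. i \<in> {1..p+q} \<and> j \<in> {1..p+q} \<and> i \<noteq> j}"

definition tgw_free :: "nat \<Rightarrow> nat \<Rightarrow> (gen list \<Rightarrow> 'k::field) ring" where
  "tgw_free p q = free_alg (tgw_gens (p+q))"

definition C_ideal :: "bool \<Rightarrow> nat \<Rightarrow> nat \<Rightarrow> (gen list \<Rightarrow> 'k::field) set" where
  "C_ideal s p q = genideal (tgw_free p q) (C_rels s p q)"

definition C_alg :: "bool \<Rightarrow> nat \<Rightarrow> nat \<Rightarrow> (gen list \<Rightarrow> 'k::field) set ring" where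
  "C_alg s p q = tgw_free p q Quot C_ideal s p q"

definition piC :: "bool \<Rightarrow> nat \<Rightarrow> nat \<Rightarrow> (gen list \<Rightarrow> 'k::field) \<Rightarrow> (gen list \<Rightarrow> 'k) set" where
  "piC s p q f = C_ideal s p q +>\<^bsub>tgw_free p q\<^esub> f"

definition wdeg :: "gen list \<Rightarrow> nat \<Rightarrow> int" where
  "wdeg w j = int (length (filter (\<lambda>g. g = X j) w)) - int (length (filter (\<lambda>g. g = Y j) w))"

definition free_hom :: "nat \<Rightarrow> nat \<Rightarrow> (nat \<Rightarrow> int) \<Rightarrow> (gen list \<Rightarrow> 'k::field) set" where
  "free_hom p q d = {f \<in> carrier (tgw_free p q). \<forall>w. f w \<noteq> 0 \<longrightarrow> wdeg w = d}"

definition C_hom :: "bool \<Rightarrow> nat \<Rightarrow> nat \<Rightarrow> (nat \<Rightarrow> int) \<Rightarrow> (gen list \<Rightarrow> 'k::field) set set" where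
  "C_hom s p q d = piC s p q ` free_hom p q d"

definition C_graded_ideal :: "bool \<Rightarrow> nat \<Rightarrow> nat \<Rightarrow> (gen list \<Rightarrow> 'k::field) set set \<Rightarrow> bool" where
  "C_graded_ideal s p q I \<longleftrightarrow> ideal I (C_alg s p q) \<and>
     (\<forall>x\<in>I. \<exists>ys. (\<forall>y\<in>set ys. \<exists>d. y \<in> I \<inter> C_hom s p q d) \<and>
                 x = foldr (\<lambda>y acc. y \<oplus>\<^bsub>C_alg s p q\<^esub> acc) ys \<zero>\<^bsub>C_alg s p q\<^esub>)"

definition tgw_ideal :: "bool \<Rightarrow> nat \<Rightarrow> nat \<Rightarrow> (gen list \<Rightarrow> 'k::field) set set" where
  "tgw_ideal s p q = (GREATEST I. C_graded_ideal s p q I \<and>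
        I \<inter> C_hom s p q (\<lambda>_. 0) = {\<zero>\<^bsub>C_alg s p q\<^esub>})"

definition TGW_alg :: "bool \<Rightarrow> nat \<Rightarrow> nat \<Rightarrow> (gen list \<Rightarrow> 'k::field) set set ring" where
  "TGW_alg s p q = C_alg s p q Quot tgw_ideal s p q"

definition piA :: "bool \<Rightarrow> nat \<Rightarrow> nat \<Rightarrow> (gen list \<Rightarrow> 'k::field) \<Rightarrow> (gen list \<Rightarrow> 'k) set set" where
  "piA s p q f = tgw_ideal s p q +>\<^bsub>C_alg s p q\<^esub> piC s p q f"

text \<open>The canonical map \<open>\<rho> : R \<rightarrow> \<A>\<close>, induced by \<open>u_i \<mapsto> u_i\<close>.\<close>
definition tgw_rho :: "bool \<Rightarrow> nat \<Rightarrow> nat \<Rightarrow> (gen list \<Rightarrow> 'k::field) set \<Rightarrow> (gen list \<Rightarrow> 'k) set set" where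
  "tgw_rho s p q r = the_elem (piA s p q ` r)"

definition tgw_consistent :: "bool \<Rightarrow> nat \<Rightarrow> nat \<Rightarrow> 'k::field itself \<Rightarrow> bool" where
  "tgw_consistent s p q (_::'k itself) \<longleftrightarrow>
     inj_on (tgw_rho s p q :: _ \<Rightarrow> (gen list \<Rightarrow> 'k) set set) (carrier (R_ring s p q))"

datatype wgen = Xw nat | Dw nat

definition W_gens :: "nat \<Rightarrow> wgen set" where
  "W_gens n = Xw ` {1..n} \<union> Dw ` {1..n}"

text \<open>\<open>[a,b]_\<pm> = ab \<pm> (-1)^{p(a)p(b)} ba\<close>, with \<open>p(x_i) = p(\<partial>_i) = p(i)\<close>\<close>
definition sbr :: "bool \<Rightarrow> nat \<Rightarrow> nat \<Rightarrow> nat \<Rightarrow> (wgen list \<Rightarrow> 'k::field) \<Rightarrow> (wgen list \<Rightarrow> 'k) \<Rightarrow> wgen list \<Rightarrow> 'k" where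
  "sbr s p i j a b = fadd (fmul a b) (fsmul (wsgn s p i j) (fmul b a))"

definition W_rels :: "bool \<Rightarrow> nat \<Rightarrow> nat \<Rightarrow> (wgen list \<Rightarrow> 'k::field) set" where
  "W_rels s p q =
     {fsub (sbr s p i j (fa_gen (Dw i)) (fa_gen (Xw j))) (fa_scal (if i = j then 1 else 0))
        | i j. i \<in> {1..p+q} \<and> j \<in> {1..p+q}}
   \<union> {sbr s p i j (fa_gen (Xw i)) (fa_gen (Xw j)) | i j. i \<in> {1..p+q} \<and> j \<in> {1..p+q}}
   \<union> {sbr s p i j (fa_gen (Dw i)) (fa_gen (Dw j)) | i j. i \<in> {1..p+q} \<and> j \<in> {1..p+q}}"

definition W_free :: "nat \<Rightarrow> nat \<Rightarrow> (wgen list \<Rightarrow> 'k::field) ring" where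
  "W_free p q = free_alg (W_gens (p+q))"

definition W_ideal :: "bool \<Rightarrow> nat \<Rightarrow> nat \<Rightarrow> (wgen list \<Rightarrow> 'k::field) set" where
  "W_ideal s p q = genideal (W_free p q) (W_rels s p q)"

definition Weyl_alg :: "bool \<Rightarrow> nat \<Rightarrow> nat \<Rightarrow> (wgen list \<Rightarrow> 'k::field) set ring" where
  "Weyl_alg s p q = W_free p q Quot W_ideal s p q"

definition piW :: "bool \<Rightarrow> nat \<Rightarrow> nat \<Rightarrow> (wgen list \<Rightarrow> 'k::field) \<Rightarrow> (wgen list \<Rightarrow> 'k) set" where
  "piW s p q f = W_ideal s p q +>\<^bsub>W_free p q\<^esub> f"

end

theory Submission
  imports Defs "HOL-Library.Multiset"
begin

text \<open>The superalgebra acts on polynomials in \<open>x\<^sub>1, \<dots>, x\<^sub>n\<close> (\<open>x\<^sub>i\<^sup>2 = 0\<close> when \<open>\<lambda>\<^sub>i\<^sub>i = -1\<close>) by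
  multiplication and differentiation, every word mapping a monomial to a multiple of a monomial.
  Applying a combination of normally ordered words \<open>x\<^sup>A \<partial>\<^sup>B\<close> to \<open>x\<^sup>B\<close> with \<open>B\<close> minimal shows that in
  characteristic 0 the action is faithful, so membership in each ideal below is decided by matrix
  coefficients. The map \<open>X\<^sub>i \<mapsto> x\<^sub>i\<close>, \<open>Y\<^sub>i \<mapsto> \<partial>\<^sub>i\<close>, \<open>u\<^sub>i \<mapsto> \<partial>\<^sub>i x\<^sub>i\<close> respects the relations. Its kernel is
  graded and meets degree zero trivially, because degree zero of the TGW construction is the image
  of \<open>R\<close> and \<open>R\<close> acts faithfully by eigenvalues. It contains every graded ideal with that property:
  any two monomials are connected by a word, so a homogeneous element acting nontrivially can be
  multiplied into degree zero without being killed. Hence the kernel is the ideal defining the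
  TGW algebra.\<close>

section \<open>Free algebras\<close>

text \<open>All algebras here are quotients of free algebras, and the argument stays in the free
  algebras as long as possible: \<open>Psi\<close> is a map between them, ideals are sets of
  functions on words, and the module of monomials is never built. It is present only through its
  matrix coefficients, which are scalar functions of words extended linearly by \<open>lin\<close>;
  that the action is multiplicative becomes a rule for the coefficient of a concatenation. Two
  presentations are tested against these coefficients, and each needs its own spanning set.
  \<open>R\<close> cannot borrow the one of the superalgebra, because it is a quotient of a smaller
  free algebra and the larger set of relations might a priori identify more of its elements. The
  ideal defining the TGW algebra is given only as a \<open>GREATEST\<close> element, so even its
  existence and the fact that it is an ideal have to be obtained by exhibiting it. Characteristic 0
  enters through integers: nonzero exponents must be nonzero scalars, and 2 must be invertible to
  get \<open>x_i x_i = 0\<close> from \<open>x_i x_i = - x_i x_i\<close>.\<close>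

abbreviation car :: "'g set \<Rightarrow> ('g list \<Rightarrow> 'k::field) set" where
  "car G \<equiv> carrier (free_alg G)"

definition mon :: "'g list \<Rightarrow> 'g list \<Rightarrow> 'k::field" where
  "mon w = (\<lambda>v. if v = w then 1 else 0)"

text \<open>Representations are handled as functionals on words, and this is their linear extension.
  Over an infinite support the sum is 0 by convention, hence the \<open>car\<close> hypotheses of
  the additivity lemmas.\<close>

definition lin :: "('g list \<Rightarrow> 'k) \<Rightarrow> ('g list \<Rightarrow> 'k::field) \<Rightarrow> 'k" where
  "lin L f = (\<Sum>w | f w \<noteq> 0. f w * L w)"

lemma mem_car: "f \<in> car G \<longleftrightarrow> finite {w. f w \<noteq> 0} \<and> (\<forall>w. f w \<noteq> 0 \<longrightarrow> set w \<subseteq> G)"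
  by (simp add: free_alg_def)

lemma fa_gen_mon: "fa_gen g = mon [g]"
  by (simp add: fa_gen_def mon_def)

lemma fa_scal_mon: "fa_scal c = fsmul c (mon [])"
  by (auto simp: fa_scal_def fsmul_def mon_def fun_eq_iff)

lemma fmul_Nil: "fmul f g [] = f [] * g []"
  by (simp add: fmul_def)

lemma fmul_Cons: "fmul f g (a # w) = f [] * g (a # w) + fmul (\<lambda>v. f (a # v)) g w"
  by (simp add: fmul_def sum.atMost_Suc_shift del: sum.atMost_Suc)

lemma fmul_fadd_left: "fmul (fadd f g) h = fadd (fmul f h) (fmul g h)"
  by (simp add: fmul_def fadd_def sum.distrib algebra_simps)

lemma fmul_fadd_right: "fmul h (fadd f g) = fadd (fmul h f) (fmul h g)"
  by (simp add: fmul_def fadd_def sum.distrib algebra_simps)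

lemma fmul_fsub_left: "fmul (fsub f g) h = fsub (fmul f h) (fmul g h)"
  by (simp add: fmul_def fsub_def sum_subtractf algebra_simps)

lemma fmul_fsub_right: "fmul h (fsub f g) = fsub (fmul h f) (fmul h g)"
  by (simp add: fmul_def fsub_def sum_subtractf algebra_simps)

lemma fmul_fsmul_left: "fmul (fsmul c f) h = fsmul c (fmul f h)"
  by (simp add: fmul_def fsmul_def sum_distrib_left algebra_simps)

lemma fmul_fsmul_right: "fmul h (fsmul c f) = fsmul c (fmul h f)"
  by (simp add: fmul_def fsmul_def sum_distrib_left algebra_simps)

lemma fmul_zero_left: "fmul (\<lambda>w. 0) g = (\<lambda>w. 0)"
  by (simp add: fmul_def)

lemma fmul_zero_right: "fmul g (\<lambda>w. 0) = (\<lambda>w. 0)"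
  by (simp add: fmul_def)

lemmas fmul_linear = fmul_fadd_left fmul_fadd_right fmul_fsub_left fmul_fsub_right
  fmul_fsmul_left fmul_fsmul_right fmul_zero_left fmul_zero_right

text \<open>Splitting off the first letter (\<open>fmul_Cons\<close>) makes the convolution a
  recursion that replaces the left factor by \<open>\<lambda>v. f (a # v)\<close>; the induction on
  the word therefore keeps all factors arbitrary.\<close>

lemma fmul_assoc: "fmul (fmul f g) h = fmul f (fmul g h)"
proof
  fix w show "fmul (fmul f g) h w = fmul f (fmul g h) w"
  proof (induction w arbitrary: f g h)
    case Nil show ?case by (simp add: fmul_Nil)
  next
    case (Cons a w)
    have "(\<lambda>v. fmul f g (a # v)) = fadd (fsmul (f []) (\<lambda>v. g (a # v))) (fmul (\<lambda>v. f (a # v)) g)"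
      by (simp add: fun_eq_iff fmul_Cons fadd_def fsmul_def)
    then show ?case
      by (simp add: fmul_Cons fmul_Nil fmul_linear Cons.IH)
        (simp add: fadd_def fsmul_def fmul_Cons Cons.IH algebra_simps)
  qed
qed

lemma fmul_mon_Nil_left: "fmul (mon []) g = g"
proof
  fix w show "fmul (mon []) g w = g w"
    by (cases w) (simp_all add: fmul_Nil fmul_Cons mon_def fmul_zero_left)
qed

lemma fmul_mon_Nil_right: "fmul g (mon []) = g"
proof
  fix w show "fmul g (mon []) w = g w"
    by (induction w arbitrary: g) (simp_all add: fmul_Nil fmul_Cons mon_def)
qed

lemma fmul_mon_mon: "fmul (mon u) (mon v) = (mon (u @ v) :: 'g list \<Rightarrow> 'k::field)"
proof (induction u)
  case Nil show ?case by (simp add: fmul_mon_Nil_left)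
next
  case (Cons a u)
  show ?case
  proof
    fix w show "fmul (mon (a # u)) (mon v) w = (mon ((a # u) @ v) w :: 'k)"
    proof (cases w)
      case Nil then show ?thesis by (simp add: fmul_Nil mon_def)
    next
      case w: (Cons b w')
      have "(\<lambda>x. mon (a # u) (b # x)) = (if a = b then mon u else (\<lambda>x. 0 :: 'k))"
        by (auto simp: mon_def)
      then have "fmul (\<lambda>x. mon (a # u) (b # x)) (mon v) w' = (if a = b then mon (u @ v) w' else 0 :: 'k)"
        by (simp add: Cons.IH fmul_zero_left)
      moreover have "mon (a # u) [] = (0 :: 'k)"
        "mon ((a # u) @ v) (b # w') = (if a = b then mon (u @ v) w' else 0 :: 'k)"
        by (auto simp: mon_def)
      ultimately show ?thesis by (simp add: w fmul_Cons)
    qed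
  qed
qed

lemma fa_scal_one: "fa_scal 1 = mon []"
  by (auto simp: fa_scal_def mon_def)

lemma fmul_fa_scal_left: "fmul (fa_scal c) f = fsmul c f"
  by (simp add: fa_scal_mon fmul_linear fmul_mon_Nil_left)

lemma fsub_conv: "fsub f g = fadd f (fsmul (-1) g)"
  by (simp add: fsub_def fadd_def fsmul_def)

lemma car_zero: "(\<lambda>w. 0) \<in> car G"
  by (simp add: mem_car)

lemma car_fadd: assumes "f \<in> car G" "g \<in> car G" shows "fadd f g \<in> car G"
proof -
  have "{w. fadd f g w \<noteq> 0} \<subseteq> {w. f w \<noteq> 0} \<union> {w. g w \<noteq> 0}" by (auto simp: fadd_def)
  then have "finite {w. fadd f g w \<noteq> 0}"
    using assms by (auto simp: mem_car intro: finite_subset)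
  moreover have "set w \<subseteq> G" if "fadd f g w \<noteq> 0" for w
  proof -
    have "f w \<noteq> 0 \<or> g w \<noteq> 0" using that by (auto simp: fadd_def)
    then show ?thesis using assms by (auto simp: mem_car)
  qed
  ultimately show ?thesis by (auto simp: mem_car)
qed

lemma car_fsmul: "f \<in> car G \<Longrightarrow> fsmul c f \<in> car G"
  by (auto simp: mem_car fsmul_def)

lemma car_fsub: "f \<in> car G \<Longrightarrow> g \<in> car G \<Longrightarrow> fsub f g \<in> car G"
  by (simp add: fsub_conv car_fadd car_fsmul)

lemma car_mon: "mon w \<in> car G \<longleftrightarrow> set w \<subseteq> G"
  by (simp add: mem_car mon_def)

lemma car_fa_scal: "fa_scal c \<in> car G"
  by (simp add: fa_scal_mon car_fsmul car_mon)

lemma fmul_support: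
  assumes "fmul f g w \<noteq> 0"
  obtains u v where "w = u @ v" "f u \<noteq> 0" "g v \<noteq> 0"
proof -
  from assms obtain k where "f (take k w) * g (drop k w) \<noteq> 0"
    unfolding fmul_def by (meson sum.neutral)
  then show ?thesis using that[of "take k w" "drop k w"] by simp
qed

lemma car_fmul: assumes "f \<in> car G" "g \<in> car G" shows "fmul f g \<in> car G"
proof -
  have *: "\<exists>u v. w = u @ v \<and> f u \<noteq> 0 \<and> g v \<noteq> 0" if "fmul f g w \<noteq> 0" for w
    using fmul_support[OF that] by blast
  have "{w. fmul f g w \<noteq> 0} \<subseteq> (\<lambda>(u, v). u @ v) ` ({w. f w \<noteq> 0} \<times> {w. g w \<noteq> 0})"
    using * by fastforce
  then have "finite {w. fmul f g w \<noteq> 0}"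
    using assms by (auto simp: mem_car elim!: finite_subset)
  moreover have "set w \<subseteq> G" if "fmul f g w \<noteq> 0" for w
    using *[OF that] assms unfolding mem_car by (metis Un_least set_append)
  ultimately show ?thesis by (auto simp: mem_car)
qed

lemma ring_free_alg: "ring (free_alg G :: ('g list \<Rightarrow> 'k::field) ring)"
proof (rule ringI)
  show "abelian_group (free_alg G :: ('g list \<Rightarrow> 'k) ring)"
  proof (rule abelian_groupI)
    fix x :: "'g list \<Rightarrow> 'k" assume "x \<in> car G"
    then show "\<exists>y\<in>car G. y \<oplus>\<^bsub>free_alg G\<^esub> x = \<zero>\<^bsub>free_alg G\<^esub>"
      using car_fsmul[of x G "-1"]
      by (intro bexI[of _ "fsmul (-1) x"]) (simp_all add: free_alg_def fadd_def fsmul_def)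
  next
    fix x y :: "'g list \<Rightarrow> 'k" assume "x \<in> car G" "y \<in> car G"
    then show "x \<oplus>\<^bsub>free_alg G\<^esub> y \<in> car G"
      using car_fadd[of x G y] by (simp add: free_alg_def)
  next
    show "\<zero>\<^bsub>free_alg G\<^esub> \<in> carrier (free_alg G :: ('g list \<Rightarrow> 'k) ring)"
      using car_zero by (simp add: free_alg_def)
  qed (simp_all add: free_alg_def fadd_def algebra_simps)
  show "Group.monoid (free_alg G :: ('g list \<Rightarrow> 'k) ring)"
  proof (rule monoidI)
    fix x y :: "'g list \<Rightarrow> 'k" assume "x \<in> car G" "y \<in> car G"
    then show "x \<otimes>\<^bsub>free_alg G\<^esub> y \<in> car G"
      using car_fmul[of x G y] by (simp add: free_alg_def)
  next
    show "\<one>\<^bsub>free_alg G\<^esub> \<in> carrier (free_alg G :: ('g list \<Rightarrow> 'k) ring)"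
      using car_mon[of "[]" G] by (simp add: free_alg_def fa_scal_one)
  qed (simp_all add: free_alg_def fa_scal_one fmul_assoc fmul_mon_Nil_left fmul_mon_Nil_right)
qed (simp_all add: free_alg_def fmul_linear)

lemma free_alg_simps:
  "f \<oplus>\<^bsub>free_alg G\<^esub> g = fadd f g" "f \<otimes>\<^bsub>free_alg G\<^esub> g = fmul f g"
  "\<zero>\<^bsub>free_alg G\<^esub> = (\<lambda>w. 0)" "\<one>\<^bsub>free_alg G\<^esub> = mon []"
  by (simp_all add: free_alg_def fa_scal_one)

lemma car_induct [consumes 1, case_names zero step]:
  assumes "f \<in> car G" and zero: "P (\<lambda>w. 0)"
    and step: "\<And>f c w. f \<in> car G \<Longrightarrow> set w \<subseteq> G \<Longrightarrow> P f \<Longrightarrow> P (fadd f (fsmul c (mon w)))"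
  shows "P f"
proof -
  have "finite {w. f w \<noteq> 0}" using assms(1) by (simp add: mem_car)
  then show ?thesis using assms(1)
  proof (induction "{w. f w \<noteq> 0}" arbitrary: f)
    case empty
    then have "f = (\<lambda>w. 0)" by auto
    then show ?case using zero by simp
  next
    case (insert w F)
    define g where "g = f(w := 0)"
    have F: "F = {v. g v \<noteq> 0}" using insert.hyps unfolding g_def by auto
    have g: "g \<in> car G" using insert.prems insert.hyps(1) F by (auto simp: mem_car g_def)
    have "f w \<noteq> 0" using insert.hyps by auto
    then have "set w \<subseteq> G" using insert.prems by (auto simp: mem_car)
    moreover have "f = fadd g (fsmul (f w) (mon w))"
      by (auto simp: g_def fadd_def fsmul_def mon_def fun_eq_iff)
    ultimately show ?case using step[OF g] insert.hyps(3)[OF F g] by metis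
  qed
qed

lemma a_inv_free_alg:
  assumes "f \<in> car G" shows "\<ominus>\<^bsub>free_alg G\<^esub> f = fsmul (-1) f"
proof -
  interpret ring "free_alg G" by (rule ring_free_alg)
  show ?thesis
    by (rule minus_equality[OF _ assms car_fsmul[OF assms]])
      (simp add: free_alg_simps fadd_def fsmul_def)
qed

lemma a_minus_free_alg:
  assumes "f \<in> car G" "g \<in> car G" shows "f \<ominus>\<^bsub>free_alg G\<^esub> g = fsub f g"
  using assms by (simp add: a_minus_def a_inv_free_alg free_alg_simps fsub_conv)

subsection \<open>Linear functionals\<close>

lemma lin_eq_sum:
  assumes "finite S" "\<And>w. f w \<noteq> 0 \<Longrightarrow> w \<in> S"
  shows "lin L f = (\<Sum>w\<in>S. f w * L w)"
  unfolding lin_def using assms by (intro sum.mono_neutral_left) auto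

lemma lin_zero: "lin L (\<lambda>w. 0) = 0"
  by (simp add: lin_def)

lemma lin_fadd:
  assumes "f \<in> car G" "g \<in> car G"
  shows "lin L (fadd f g) = lin L f + lin L g"
proof -
  let ?S = "{w. f w \<noteq> 0} \<union> {w. g w \<noteq> 0}"
  have "finite ?S" using assms by (simp add: mem_car)
  then have "lin L (fadd f g) = (\<Sum>w\<in>?S. fadd f g w * L w)" "lin L f = (\<Sum>w\<in>?S. f w * L w)"
    "lin L g = (\<Sum>w\<in>?S. g w * L w)"
    by (auto intro!: lin_eq_sum simp: fadd_def)
  then show ?thesis by (simp add: fadd_def algebra_simps sum.distrib)
qed

lemma lin_fsmul: "lin L (fsmul c f) = c * lin L f"
  by (cases "c = 0") (simp_all add: lin_def fsmul_def sum_distrib_left algebra_simps)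

lemma lin_fsub:
  assumes "f \<in> car G" "g \<in> car G"
  shows "lin L (fsub f g) = lin L f - lin L g"
  using assms by (simp add: fsub_conv lin_fadd[OF _ car_fsmul] lin_fsmul)

lemma lin_mon: "lin L (mon w) = L w"
proof -
  have "lin L (mon w) = (\<Sum>v\<in>{w}. mon w v * L v)"
    by (rule lin_eq_sum) (auto simp: mon_def split: if_splits)
  then show ?thesis by (simp add: mon_def)
qed

lemma lin_scale: "lin (\<lambda>w. c * L w) f = c * lin L f"
  by (simp add: lin_def sum_distrib_left algebra_simps)

lemma lin_add_functional: "lin (\<lambda>w. L w + L' w) f = lin L f + lin L' f"
  by (simp add: lin_def sum.distrib algebra_simps)

lemma lin_cong: "(\<And>w. f w \<noteq> 0 \<Longrightarrow> L w = L' w) \<Longrightarrow> lin L f = lin L' f"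
  by (simp add: lin_def)

text \<open>By bilinearity two words suffice. If, for one word fixed, \<open>L (u @ v)\<close> is a
  multiple of another functional of the other word, this formula passes vanishing from a factor to
  the product.\<close>

lemma lin_fmul:
  assumes f: "f \<in> car G" and g: "g \<in> car G"
  shows "lin L (fmul f g) = lin (\<lambda>v. lin (\<lambda>u. L (u @ v)) f) g"
  using f
proof (induction rule: car_induct)
  case zero show ?case by (simp add: fmul_zero_left lin_zero lin_def)
next
  case (step f c u)
  have *: "lin L (fmul (mon u) g) = lin (\<lambda>v. L (u @ v)) g"
    using g
  proof (induction rule: car_induct)
    case zero show ?case by (simp add: fmul_zero_right lin_zero)
  next
    case (step g d v)
    have "mon u \<in> car G" using \<open>set u \<subseteq> G\<close> by (simp add: car_mon)
    then show ?case using step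
      by (simp add: fmul_linear lin_fadd[of _ G] car_fmul car_mon car_fsmul lin_fsmul lin_mon
          fmul_mon_mon)
  qed
  show ?case using step g *
    by (simp add: fmul_linear lin_fadd[of _ G] car_fmul car_mon car_fsmul lin_fsmul lin_mon
        lin_add_functional lin_scale)
qed

lemma lin_sum:
  assumes "finite F" "\<And>b. b \<in> F \<Longrightarrow> N b \<in> car G"
  shows "(\<lambda>w. \<Sum>b\<in>F. c b * N b w) \<in> car G \<and>
    lin L (\<lambda>w. \<Sum>b\<in>F. c b * N b w) = (\<Sum>b\<in>F. c b * lin L (N b))"
  using assms
proof (induction F)
  case empty then show ?case by (simp add: car_zero lin_zero)
next
  case (insert b F)
  have "(\<lambda>w. \<Sum>b\<in>insert b F. c b * N b w) = fadd (fsmul (c b) (N b)) (\<lambda>w. \<Sum>b\<in>F. c b * N b w)"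
    using insert.hyps by (simp add: fadd_def fsmul_def)
  then show ?case using insert by (simp add: car_fadd car_fsmul lin_fadd[of _ G] lin_fsmul)
qed

subsection \<open>Ideals and spans modulo an ideal\<close>

lemma ideal_freeI:
  assumes "I \<subseteq> car G" "(\<lambda>w. 0) \<in> I"
    and add: "\<And>f g. f \<in> I \<Longrightarrow> g \<in> I \<Longrightarrow> fadd f g \<in> I"
    and l: "\<And>f h. f \<in> I \<Longrightarrow> h \<in> car G \<Longrightarrow> fmul h f \<in> I"
    and r: "\<And>f h. f \<in> I \<Longrightarrow> h \<in> car G \<Longrightarrow> fmul f h \<in> I"
  shows "ideal I (free_alg G)"
proof (rule idealI)
  interpret ring "free_alg G" by (rule ring_free_alg)
  show "ring (free_alg G)" by (rule ring_free_alg)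
  show "subgroup I (add_monoid (free_alg G))"
  proof (rule subgroup.intro)
    show "inv\<^bsub>add_monoid (free_alg G)\<^esub> x \<in> I" if "x \<in> I" for x
    proof -
      have "x \<in> car G" using that assms(1) by auto
      then have "\<ominus>\<^bsub>free_alg G\<^esub> x = fmul (fa_scal (-1)) x"
        by (simp add: a_inv_free_alg fmul_fa_scal_left)
      then show ?thesis using l[OF that car_fa_scal] by (simp add: a_inv_def)
    qed
  qed (use assms in \<open>auto simp: free_alg_simps\<close>)
qed (use assms in \<open>auto simp: free_alg_simps\<close>)

locale free_ideal =
  fixes G :: "'g set" and I :: "('g list \<Rightarrow> 'k::field) set"
  assumes ideal: "ideal I (free_alg G)"
begin

lemma in_car: "f \<in> I \<Longrightarrow> f \<in> car G"
  using ideal.Icarr[OF ideal] .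

lemma zero: "(\<lambda>w. 0) \<in> I"
  using additive_subgroup.zero_closed[OF ideal.axioms(1)[OF ideal]] by (simp add: free_alg_simps)

lemma add: "f \<in> I \<Longrightarrow> g \<in> I \<Longrightarrow> fadd f g \<in> I"
  using additive_subgroup.a_closed[OF ideal.axioms(1)[OF ideal], of f g]
  by (simp add: free_alg_simps)

lemma mult_left: "f \<in> I \<Longrightarrow> h \<in> car G \<Longrightarrow> fmul h f \<in> I"
  using ideal.I_l_closed[OF ideal, of f h] by (simp add: free_alg_simps)

lemma mult_right: "f \<in> I \<Longrightarrow> h \<in> car G \<Longrightarrow> fmul f h \<in> I"
  using ideal.I_r_closed[OF ideal, of f h] by (simp add: free_alg_simps)

lemma smul: "f \<in> I \<Longrightarrow> fsmul c f \<in> I"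
  using mult_left[OF _ car_fa_scal, of f c] by (simp add: fmul_fa_scal_left)

lemma sub: "f \<in> I \<Longrightarrow> g \<in> I \<Longrightarrow> fsub f g \<in> I"
  by (simp add: fsub_conv add smul)

lemma coset_eq_iff:
  assumes "f \<in> car G" "g \<in> car G"
  shows "I +>\<^bsub>free_alg G\<^esub> f = I +>\<^bsub>free_alg G\<^esub> g \<longleftrightarrow> fsub f g \<in> I"
proof -
  interpret abelian_subgroup I "free_alg G"
    using ideal by (rule abelian_subgroupI3[OF ideal.axioms(1) ring.is_abelian_group[OF ring_free_alg]])
  show ?thesis
    using a_rcos_module_minus[OF ring_free_alg assms(2,1)] a_minus_free_alg[OF assms]
      local.a_repr_independence'[of f g] a_rcos_self[of f] assms by auto
qed

lemma coset_eq_self: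
  assumes "f \<in> car G"
  shows "I +>\<^bsub>free_alg G\<^esub> f = I \<longleftrightarrow> f \<in> I"
proof -
  interpret ring "free_alg G" by (rule ring_free_alg)
  have "I +>\<^bsub>free_alg G\<^esub> (\<lambda>w. 0) = I"
    using in_car by (auto simp: a_r_coset_def' free_alg_simps fadd_def)
  then show ?thesis using coset_eq_iff[OF assms car_zero] by (simp add: fsub_def)
qed

end

text \<open>The subspace spanned by \<open>I\<close> and \<open>S\<close>. Absorbing
  \<open>I\<close> in the base case lets one induction handle both rewriting modulo the relations
  and linear combination.\<close>

inductive_set lspan :: "('g list \<Rightarrow> 'k::field) set \<Rightarrow> ('g list \<Rightarrow> 'k) set \<Rightarrow> ('g list \<Rightarrow> 'k) set"
  for I S where
  lspan_base: "f \<in> I \<Longrightarrow> f \<in> lspan I S"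
| lspan_step: "f \<in> lspan I S \<Longrightarrow> g \<in> S \<Longrightarrow> fadd f (fsmul c g) \<in> lspan I S"

context free_ideal
begin

lemma lspan_incl: "g \<in> S \<Longrightarrow> g \<in> lspan I S"
  using lspan_step[OF lspan_base[OF zero], of g S 1] by (simp add: fadd_def fsmul_def)

lemma lspan_add:
  assumes "f \<in> lspan I S" "g \<in> lspan I S"
  shows "fadd f g \<in> lspan I S"
  using assms(2)
proof (induction g rule: lspan.induct)
  case (lspan_base g)
  from assms(1) show ?case
  proof (induction f rule: lspan.induct)
    case (lspan_base f) then show ?case using \<open>g \<in> I\<close> by (simp add: add lspan.lspan_base)
  next
    case (lspan_step f h c)
    then have "fadd (fadd f g) (fsmul c h) \<in> lspan I S" by (intro lspan.lspan_step) auto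
    then show ?case by (simp add: fadd_def algebra_simps)
  qed
next
  case (lspan_step g h c)
  then have "fadd (fadd f g) (fsmul c h) \<in> lspan I S" by (intro lspan.lspan_step) auto
  then show ?case by (simp add: fadd_def algebra_simps)
qed

lemma lspan_smul: "f \<in> lspan I S \<Longrightarrow> fsmul d f \<in> lspan I S"
proof (induction f rule: lspan.induct)
  case (lspan_base f) then show ?case by (simp add: smul lspan.lspan_base)
next
  case (lspan_step f h c)
  then have "fadd (fsmul d f) (fsmul (d * c) h) \<in> lspan I S" by (intro lspan.lspan_step) auto
  then show ?case by (simp add: fadd_def fsmul_def algebra_simps)
qed

lemma lspan_cong: "fsub f g \<in> I \<Longrightarrow> g \<in> lspan I S \<Longrightarrow> f \<in> lspan I S"
proof -
  assume *: "fsub f g \<in> I" "g \<in> lspan I S"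
  have "fadd g (fsub f g) \<in> lspan I S" using * by (simp add: lspan_add lspan_base)
  then show ?thesis by (simp add: fadd_def fsub_def)
qed

lemma lspan_map:
  assumes "f \<in> lspan I S"
    and "\<And>f g. h (fadd f g) = fadd (h f) (h g)" "\<And>c f. h (fsmul c f) = fsmul c (h f)"
    and "\<And>f. f \<in> I \<Longrightarrow> h f \<in> I" "\<And>f. f \<in> S \<Longrightarrow> h f \<in> lspan I S'"
  shows "h f \<in> lspan I S'"
  using assms(1) by induction (simp_all add: assms lspan_base lspan_add lspan_smul)

lemma lspan_trans:
  assumes "f \<in> lspan I S" and "\<And>f. f \<in> S \<Longrightarrow> f \<in> lspan I S'"
  shows "f \<in> lspan I S'"
  using lspan_map[of f S "\<lambda>f. f" S'] assms by auto

lemma lspan_mult_left: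
  assumes "f \<in> lspan I S" "h \<in> car G" and "\<And>f. f \<in> S \<Longrightarrow> fmul h f \<in> lspan I S'"
  shows "fmul h f \<in> lspan I S'"
  using lspan_map[of f S "fmul h" S'] assms by (auto simp: fmul_linear mult_left)

lemma lspan_combination:
  assumes "f \<in> lspan I (N ` B)"
  obtains F c where "finite F" "F \<subseteq> B" "fsub f (\<lambda>w. \<Sum>b\<in>F. c b * N b w) \<in> I"
proof -
  from assms have "\<exists>F c. finite F \<and> F \<subseteq> B \<and> fsub f (\<lambda>w. \<Sum>b\<in>F. c b * N b w) \<in> I"
  proof (induction f rule: lspan.induct)
    case (lspan_base f)
    then show ?case by (intro exI[of _ "{}"]) (auto simp: fsub_def)
  next
    case (lspan_step f g d)
    then obtain F c where F: "finite F" "F \<subseteq> B" "fsub f (\<lambda>w. \<Sum>b\<in>F. c b * N b w) \<in> I" by auto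
    obtain b where b: "b \<in> B" "g = N b" using lspan_step by auto
    \<comment> \<open>The index \<open>b\<close> may already occur in \<open>F\<close>, so its
      coefficient is increased by \<open>d\<close> rather than set to \<open>d\<close>.\<close>
    define c' where "c' x = (if x \<in> F then c x else 0) + (if x = b then d else 0)" for x
    have "(\<Sum>x\<in>insert b F. c' x * N x w) = (\<Sum>x\<in>F. c x * N x w) + d * N b w" for w
    proof -
      have "(\<Sum>x\<in>insert b F. c' x * N x w) =
        (\<Sum>x\<in>insert b F. (if x \<in> F then c x * N x w else 0) + (if x = b then d * N x w else 0))"
        by (rule sum.cong) (auto simp: c'_def algebra_simps)
      also have "\<dots> = (\<Sum>x\<in>insert b F. if x \<in> F then c x * N x w else 0) + d * N b w"
        using F(1) by (simp only: sum.distrib) (simp add: sum.delta)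
      also have "(\<Sum>x\<in>insert b F. if x \<in> F then c x * N x w else 0) = (\<Sum>x\<in>F. c x * N x w)"
        using F(1) by (intro sum.mono_neutral_cong_right) auto
      finally show ?thesis .
    qed
    then have "fsub (fadd f (fsmul d g)) (\<lambda>w. \<Sum>x\<in>insert b F. c' x * N x w)
        = fsub f (\<lambda>w. \<Sum>b\<in>F. c b * N b w)"
      by (simp add: fsub_def fadd_def fsmul_def b)
    then show ?case using F b by (intro exI[of _ "insert b F"] exI[of _ c']) auto
  qed
  then show ?thesis using that by auto
qed

end

lemma lspan_mon_words:
  assumes "free_ideal G I" "f \<in> car G" "\<And>w. f w \<noteq> 0 \<Longrightarrow> set w \<subseteq> G \<Longrightarrow> mon w \<in> lspan I S"
  shows "f \<in> lspan I S"
proof -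
  interpret free_ideal G I by fact
  have "(\<lambda>w. \<Sum>v\<in>F. f v * mon v w) \<in> lspan I S"
    if "finite F" "F \<subseteq> {w. f w \<noteq> 0}" for F
    using that
  proof (induction F)
    case empty then show ?case by (simp add: lspan_base zero)
  next
    case (insert v F)
    then have "fadd (fsmul (f v) (mon v)) (\<lambda>w. \<Sum>v\<in>F. f v * mon v w) \<in> lspan I S"
      using assms(2,3) by (intro lspan_add lspan_smul) (auto simp: mem_car)
    then show ?case using insert by (simp add: fadd_def fsmul_def)
  qed
  moreover have "finite {w. f w \<noteq> 0}" using assms(2) by (simp add: mem_car)
  moreover have "(\<lambda>w. \<Sum>v | f v \<noteq> 0. f v * mon v w) = f"
  proof
    fix w
    have "(\<Sum>v | f v \<noteq> 0. f v * mon v w) = (\<Sum>v | f v \<noteq> 0. if v = w then f v else 0)"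
      by (rule sum.cong) (auto simp: mon_def)
    then show "(\<Sum>v | f v \<noteq> 0. f v * mon v w) = f w"
      using assms(2) by (simp add: mem_car)
  qed
  ultimately show ?thesis by fastforce
qed

text \<open>Strong induction on \<open>sz b0\<close>: every nonzero off-diagonal entry of row
  \<open>b0\<close> belongs to a smaller index, whose coefficient is already 0, so the row equation
  reduces to its diagonal term.\<close>

lemma triangular_vanish:
  fixes c :: "'b \<Rightarrow> 'k::field" and sz :: "'b \<Rightarrow> nat"
  assumes "finite F"
    and "\<And>b0. b0 \<in> F \<Longrightarrow> (\<Sum>b\<in>F. c b * e b0 b) = 0"
    and "\<And>b. b \<in> F \<Longrightarrow> e b b \<noteq> 0"
    and "\<And>b b0. b \<in> F \<Longrightarrow> b0 \<in> F \<Longrightarrow> b \<noteq> b0 \<Longrightarrow> e b0 b \<noteq> 0 \<Longrightarrow> sz b < sz b0"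
    and "b0 \<in> F"
  shows "c b0 = 0"
  using assms(5)
proof (induction "sz b0" arbitrary: b0 rule: less_induct)
  case less
  have "(\<Sum>b\<in>F. c b * e b0 b) = (\<Sum>b\<in>{b0}. c b * e b0 b)"
    using less assms(1,4) by (intro sum.mono_neutral_right) auto
  then show ?case using assms(2,3)[of b0] less by auto
qed

section \<open>The Fock representation\<close>

text \<open>The indices with \<lambda>_ii = -1, where x_i and \<partial>_i square to zero: the even
  ones for the sign plus, the odd ones for the sign minus.\<close>

definition fer :: "bool \<Rightarrow> nat \<Rightarrow> nat \<Rightarrow> bool" where
  "fer s p i \<longleftrightarrow> (s \<longleftrightarrow> i \<le> p)"

lemma lam_diag: "lam s p i i = (if fer s p i then -1 else 1 :: 'k::field)"
  by (auto simp: lam_def fer_def par_def)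

lemma lam_diag_iff: "lam s p i i = (-1 :: 'k::field_char_0) \<longleftrightarrow> fer s p i"
  by (simp add: lam_diag)

lemma lam_sym: "lam s p i j = lam s p j i"
  by (simp add: lam_def mult.commute)

lemma lam_square: "lam s p i j * lam s p i j = (1 :: 'k::field)"
  by (auto simp: lam_def par_def)

lemma lam_square': "lam s p i j * (lam s p i j * x) = (x :: 'k::field)"
  by (simp add: lam_square flip: mult.assoc)

lemma lam_nonzero: "lam s p i j \<noteq> (0 :: 'k::field)"
  by (auto simp: lam_def par_def)

lemma wsgn_lam: "wsgn s p i j = - (lam s p i j :: 'k::field)"
  by (auto simp: lam_def wsgn_def)

text \<open>A state \<open>M\<close> stands for the monomial with exponents \<open>M 1, M 2, \<dots>\<close>, and \<open>koszul\<close> is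
  the sign of moving \<open>x\<^sub>i\<close> or \<open>\<partial>\<^sub>i\<close> past its factors \<open>x\<^sub>j\<close> with \<open>j < i\<close>. Coefficients are defined
  for all integer exponents, and at an index with \<open>\<lambda>\<^sub>i\<^sub>i = -1\<close> they only depend on the parity of
  the exponent: this way the defining relations hold at every state, not only at the valid ones.\<close>

primrec idx :: "wgen \<Rightarrow> nat" where
  "idx (Xw i) = i"
| "idx (Dw i) = i"

primrec shift :: "wgen \<Rightarrow> nat \<Rightarrow> int" where
  "shift (Xw i) = (\<lambda>j. if j = i then 1 else 0)"
| "shift (Dw i) = (\<lambda>j. if j = i then -1 else 0)"

primrec deg :: "wgen list \<Rightarrow> nat \<Rightarrow> int" where
  "deg [] = (\<lambda>j. 0)"
| "deg (g # w) = (\<lambda>j. shift g j + deg w j)"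

definition koszul :: "bool \<Rightarrow> nat \<Rightarrow> nat \<Rightarrow> (nat \<Rightarrow> int) \<Rightarrow> 'k::field" where
  "koszul s p i M = (\<Prod>j\<in>{1..<i}. if even (M j) then 1 else lam s p i j)"

primrec bare :: "bool \<Rightarrow> nat \<Rightarrow> wgen \<Rightarrow> (nat \<Rightarrow> int) \<Rightarrow> 'k::field" where
  "bare s p (Xw i) M = (if fer s p i \<and> odd (M i) then 0 else 1)"
| "bare s p (Dw i) M = (if fer s p i then (if odd (M i) then 1 else 0) else of_int (M i))"

definition lcoef :: "bool \<Rightarrow> nat \<Rightarrow> wgen \<Rightarrow> (nat \<Rightarrow> int) \<Rightarrow> 'k::field" where
  "lcoef s p g M = koszul s p (idx g) M * bare s p g M"

text \<open>The last letter acts first, so the head letter is evaluated at the state its tail has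
  produced. The change of exponents does not depend on the state, which is why \<open>deg\<close> is
  kept apart from the scalar.\<close>

primrec wcoef :: "bool \<Rightarrow> nat \<Rightarrow> wgen list \<Rightarrow> (nat \<Rightarrow> int) \<Rightarrow> 'k::field" where
  "wcoef s p [] M = 1"
| "wcoef s p (g # w) M = lcoef s p g (\<lambda>j. M j + deg w j) * wcoef s p w M"

text \<open>The matrix entry of \<open>w\<close> with source \<open>M\<close> and target
  \<open>M'\<close>. Fixing both ends makes the functional separate degrees as well.\<close>

definition mcoef :: "bool \<Rightarrow> nat \<Rightarrow> (nat \<Rightarrow> int) \<Rightarrow> (nat \<Rightarrow> int) \<Rightarrow> wgen list \<Rightarrow> 'k::field" where
  "mcoef s p M M' w = (if (\<lambda>j. M j + deg w j) = M' then wcoef s p w M else 0)"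

lemma deg_append: "deg (u @ v) = (\<lambda>j. deg u j + deg v j)"
  by (induction u) (auto simp: fun_eq_iff)

lemma wcoef_append: "wcoef s p (u @ v) M = wcoef s p u (\<lambda>j. M j + deg v j) * wcoef s p v M"
  by (induction u) (simp_all add: deg_append algebra_simps)

lemma mcoef_append_left:
  "mcoef s p M M' (u @ v) = wcoef s p u (\<lambda>j. M' j - deg u j) * mcoef s p M (\<lambda>j. M' j - deg u j) v"
proof -
  have "(\<lambda>j. M j + deg (u @ v) j) = M' \<longleftrightarrow> (\<lambda>j. M j + deg v j) = (\<lambda>j. M' j - deg u j)"
    by (force simp: deg_append fun_eq_iff algebra_simps)
  then show ?thesis by (auto simp: mcoef_def wcoef_append)
qed

lemma mcoef_append_right:
  "mcoef s p M M' (u @ v) = wcoef s p v M * mcoef s p (\<lambda>j. M j + deg v j) M' u"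
  by (auto simp: mcoef_def wcoef_append deg_append algebra_simps)

lemma koszul_square: "koszul s p i M * koszul s p i M = (1 :: 'k::field)"
  unfolding koszul_def by (simp flip: prod.distrib) (auto intro!: prod.neutral simp: lam_square)

lemma koszul_square': "koszul s p i M * (koszul s p i M * x) = (x :: 'k::field)"
  by (simp add: koszul_square flip: mult.assoc)

lemma koszul_nonzero: "koszul s p i M \<noteq> (0 :: 'k::field)"
  using koszul_square[of s p i M, where ?'k = 'k] by auto

text \<open>Only the parity at \<open>idx g\<close> changes, and that factor occurs in the product
  exactly when \<open>idx g < i\<close>. The product starts at 1, hence the lower bound on the
  index.\<close>

lemma koszul_shift:
  assumes "idx g \<ge> 1"
  shows "koszul s p i (\<lambda>j. M j + shift g j) =
    (if idx g < i then lam s p i (idx g) else 1) * (koszul s p i M :: 'k::field)"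
proof (cases "idx g < i")
  case True
  have shift: "even (shift g j) \<longleftrightarrow> j \<noteq> idx g" for j by (cases g) auto
  have k: "finite {1..<i}" "idx g \<in> {1..<i}" using assms True by auto
  have "(\<Prod>j\<in>{1..<i} - {idx g}. if even (M j + shift g j) then 1 else lam s p i j) =
    (\<Prod>j\<in>{1..<i} - {idx g}. if even (M j) then 1 else lam s p i j :: 'k)"
    by (rule prod.cong) (auto simp: shift)
  then show ?thesis using True
    unfolding koszul_def prod.remove[OF k]
    by (auto simp: shift lam_square' lam_square)
next
  case False
  have "shift g j = 0" if "j < i" for j using False that by (cases g) auto
  then show ?thesis using False by (auto simp: koszul_def intro!: prod.cong)
qed

text \<open>At distinct indices the \<open>bare\<close> factors do not see each other, and only the
  Koszul sign of the larger index notices the other letter. As \<lambda> is symmetric with square 1,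
  both orders of the indices give the same rule.\<close>

lemma wcoef_swap:
  assumes "idx g \<noteq> idx h" "idx g \<ge> 1" "idx h \<ge> 1"
  shows "wcoef s p [g, h] M = lam s p (idx g) (idx h) * (wcoef s p [h, g] M :: 'k::field)"
proof -
  have b: "bare s p g (\<lambda>j. M j + shift h j) = (bare s p g M :: 'k)" if "idx g \<noteq> idx h" for g h
    using that by (cases g; cases h) auto
  show ?thesis
    using assms b[of g h] b[of h g]
    by (auto simp: lcoef_def koszul_shift lam_sym[of s p "idx h" "idx g"] lam_square' lam_square neq_iff
        algebra_simps)
qed

lemma mcoef_swap:
  assumes "idx g \<noteq> idx h" "idx g \<ge> 1" "idx h \<ge> 1"
  shows "mcoef s p M M' [g, h] = lam s p (idx g) (idx h) * (mcoef s p M M' [h, g] :: 'k::field)"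
proof -
  have "(\<lambda>j. M j + deg [g, h] j) = (\<lambda>j. M j + deg [h, g] j)" by (auto simp: algebra_simps)
  then show ?thesis using wcoef_swap[OF assms, of s p M, where ?'k = 'k] by (auto simp: mcoef_def)
qed

text \<open>Both letters carry the Koszul sign of index \<open>i\<close>, which is insensitive to
  the exponent at \<open>i\<close>; it appears squared and only \<open>bare\<close> remains.\<close>

lemma wcoef_diag:
  assumes "i \<ge> 1"
  shows "wcoef s p [Dw i, Xw i] M = (if fer s p i then (if even (M i) then 1 else 0) else of_int (M i + 1) :: 'k::field)"
    "wcoef s p [Xw i, Dw i] M = (if fer s p i then (if odd (M i) then 1 else 0) else of_int (M i) :: 'k::field)"
    "fer s p i \<Longrightarrow> wcoef s p [Xw i, Xw i] M = (0 :: 'k::field)"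
    "fer s p i \<Longrightarrow> wcoef s p [Dw i, Dw i] M = (0 :: 'k::field)"
  using koszul_shift[of "Xw i" s p i M, where ?'k = 'k] koszul_shift[of "Dw i" s p i M, where ?'k = 'k] assms
  by (auto simp: lcoef_def koszul_square' algebra_simps)

text \<open>Distinct indices are covered by \<open>mcoef_swap\<close>. For equal ones the first
  relation is \<open>(M i + 1) - M i = 1\<close>, or the complementarity of even and odd when
  \<lambda>_ii = -1; both hold at every integer exponent.\<close>

lemma mcoef_relation:
  assumes "i \<ge> 1" "j \<ge> 1"
  shows "mcoef s p M M' [Dw i, Xw j] - lam s p i j * mcoef s p M M' [Xw j, Dw i]
      - (if i = j then 1 else 0) * mcoef s p M M' [] = (0 :: 'k::field)"
    "mcoef s p M M' [Xw i, Xw j] - lam s p i j * mcoef s p M M' [Xw j, Xw i] = (0 :: 'k::field)"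
    "mcoef s p M M' [Dw i, Dw j] - lam s p i j * mcoef s p M M' [Dw j, Dw i] = (0 :: 'k::field)"
proof -
  have "(\<lambda>j. M j + deg [Dw i, Xw i] j) = M" "(\<lambda>j. M j + deg [Xw i, Dw i] j) = M" by auto
  then show "mcoef s p M M' [Dw i, Xw j] - lam s p i j * mcoef s p M M' [Xw j, Dw i]
      - (if i = j then 1 else 0) * mcoef s p M M' [] = (0 :: 'k::field)"
    using assms mcoef_swap[of "Dw i" "Xw j" s p M M', where ?'k = 'k]
      wcoef_diag(1,2)[of i s p M, where ?'k = 'k]
    by (cases "i = j") (auto simp: mcoef_def lam_diag simp del: wcoef.simps(2) deg.simps(2))
  show "mcoef s p M M' [Xw i, Xw j] - lam s p i j * mcoef s p M M' [Xw j, Xw i] = (0 :: 'k::field)"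
    using assms mcoef_swap[of "Xw i" "Xw j" s p M M', where ?'k = 'k]
      wcoef_diag(3)[of i s p M, where ?'k = 'k]
    by (cases "i = j") (auto simp: mcoef_def lam_diag simp del: wcoef.simps(2) deg.simps(2))
  show "mcoef s p M M' [Dw i, Dw j] - lam s p i j * mcoef s p M M' [Dw j, Dw i] = (0 :: 'k::field)"
    using assms mcoef_swap[of "Dw i" "Dw j" s p M M', where ?'k = 'k]
      wcoef_diag(4)[of i s p M, where ?'k = 'k]
    by (cases "i = j") (auto simp: mcoef_def lam_diag simp del: wcoef.simps(2) deg.simps(2))
qed

section \<open>The ideal of elements acting as zero\<close>

lemma lin_swap: "lin (\<lambda>v. lin (\<lambda>u. L u v) f) g = lin (\<lambda>u. lin (\<lambda>v. L u v) g) f"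
  unfolding lin_def sum_distrib_left by (subst sum.swap) (simp add: algebra_simps)

lemma lin_zero_functional: "lin (\<lambda>w. 0) f = 0"
  by (simp add: lin_def)

text \<open>Quantifying over all integer states makes this visibly a two-sided ideal: right
  multiplication moves the source by an arbitrary degree, possibly out of the valid states.\<close>

definition fock_kernel :: "bool \<Rightarrow> nat \<Rightarrow> nat \<Rightarrow> (wgen list \<Rightarrow> 'k::field) set" where
  "fock_kernel s p q = {f \<in> car (W_gens (p + q)). \<forall>M M'. lin (mcoef s p M M') f = 0}"

lemma ideal_fock_kernel: "ideal (fock_kernel s p q) (free_alg (W_gens (p + q)))"
proof (rule ideal_freeI)
  fix f h :: "wgen list \<Rightarrow> 'a" assume f: "f \<in> fock_kernel s p q" and h: "h \<in> car (W_gens (p + q))"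
  then have fc: "f \<in> car (W_gens (p + q))" and f0: "\<And>M M'. lin (mcoef s p M M') f = 0"
    by (auto simp: fock_kernel_def)
  show "fmul h f \<in> fock_kernel s p q"
    unfolding fock_kernel_def
    by (simp add: car_fmul h fc lin_fmul[OF h fc] mcoef_append_left lin_swap[of _ h f])
      (simp add: lin_scale f0 lin_zero_functional)
  show "fmul f h \<in> fock_kernel s p q"
    unfolding fock_kernel_def
    by (simp add: car_fmul h fc lin_fmul[OF fc h] mcoef_append_right lin_scale f0 lin_zero_functional)
qed (auto simp: fock_kernel_def car_zero lin_zero car_fadd lin_fadd[of _ "W_gens (p + q)"])

lemma W_gens_mem [simp]: "Xw i \<in> W_gens n \<longleftrightarrow> i \<in> {1..n}" "Dw i \<in> W_gens n \<longleftrightarrow> i \<in> {1..n}"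
  by (auto simp: W_gens_def)

lemma W_rels_cases:
  assumes "r \<in> W_rels s p q"
  obtains i j where "i \<in> {1..p + q}" "j \<in> {1..p + q}"
      "r = fsub (fadd (mon [Dw i, Xw j]) (fsmul (- lam s p i j) (mon [Xw j, Dw i])))
        (fsmul (if i = j then 1 else 0) (mon []))"
  | i j g where "i \<in> {1..p + q}" "j \<in> {1..p + q}" "g = Xw \<or> g = Dw"
      "r = fadd (mon [g i, g j]) (fsmul (- lam s p i j) (mon [g j, g i]))"
  using assms
  unfolding W_rels_def sbr_def fa_gen_mon fmul_mon_mon fa_scal_mon wsgn_lam append_Cons append_Nil
proof (elim UnE CollectE exE conjE)
qed (rule that(1), assumption+, rule that(2)[of _ _ Xw], simp+, rule that(2)[of _ _ Dw], simp+)

lemma W_rels_car: "W_rels s p q \<subseteq> car (W_gens (p + q))"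
proof
  fix r assume "r \<in> W_rels s p q"
  then show "r \<in> car (W_gens (p + q))"
    by (cases rule: W_rels_cases) (auto simp: car_fsub car_fadd car_fsmul car_mon)
qed

lemma W_rels_fock_kernel: "W_rels s p q \<subseteq> fock_kernel s p q"
proof
  fix r :: "wgen list \<Rightarrow> 'a" assume r: "r \<in> W_rels s p q"
  have "lin (mcoef s p M M') r = 0" for M M'
    using r
  proof (cases rule: W_rels_cases)
    case (1 i j)
    then show ?thesis using mcoef_relation(1)[of i j s p M M', where ?'k = 'a]
      by (simp add: lin_fsub[of _ "W_gens (p+q)"] lin_fadd[of _ "W_gens (p+q)"] car_fadd car_fsmul
          car_mon lin_fsmul lin_mon)
  next
    case (2 i j g)
    then show ?thesis using mcoef_relation(2,3)[of i j s p M M', where ?'k = 'a]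
      by (auto simp: lin_fadd[of _ "W_gens (p+q)"] car_fsmul car_mon lin_fsmul lin_mon)
  qed
  moreover have "r \<in> car (W_gens (p + q))" using r W_rels_car by blast
  ultimately show "r \<in> fock_kernel s p q" by (simp add: fock_kernel_def)
qed

lemma ideal_W_ideal: "ideal (W_ideal s p q) (free_alg (W_gens (p + q)))"
  unfolding W_ideal_def W_free_def
  by (rule ring.genideal_ideal[OF ring_free_alg W_rels_car])

lemma W_rels_W_ideal: "W_rels s p q \<subseteq> W_ideal s p q"
  unfolding W_ideal_def W_free_def
  by (rule ring.genideal_self[OF ring_free_alg W_rels_car])

lemma W_ideal_fock_kernel: "W_ideal s p q \<subseteq> fock_kernel s p q"
  unfolding W_ideal_def W_free_def
  by (rule ring.genideal_minimal[OF ring_free_alg ideal_fock_kernel W_rels_fock_kernel])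

subsection \<open>Normal ordering\<close>

text \<open>Insertion sort uses only adjacent swaps below a common prefix. The relation is abstract
  because letters of the superalgebra and factors in \<open>R\<close> are both reordered this
  way.\<close>

lemma sort_relI:
  fixes R :: "nat list \<Rightarrow> nat list \<Rightarrow> bool"
  assumes refl: "\<And>l. R l l" and trans: "\<And>a b c. R a b \<Longrightarrow> R b c \<Longrightarrow> R a c"
    and cons: "\<And>x l l'. R l l' \<Longrightarrow> R (x # l) (x # l')"
    and swap: "\<And>x y l. R (x # y # l) (y # x # l)"
  shows "R l (sort l)"
proof (induction l)
  case Nil show ?case by (simp add: refl)
next
  case (Cons x l)
  have "R (x # l) (insort x l)" for l
    by (induction l) (auto intro: refl trans[OF swap] cons)
  then show ?case using trans[OF cons[OF Cons]] by simp
qed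

lemma free_ideal_W: "free_ideal (W_gens (p + q)) (W_ideal s p q)"
  by (rule free_ideal.intro[OF ideal_W_ideal])

lemma W_ideal_context:
  assumes "r \<in> W_ideal s p q" "set a \<subseteq> W_gens (p + q)" "set b \<subseteq> W_gens (p + q)"
  shows "fmul (mon a) (fmul r (mon b)) \<in> W_ideal s p q"
  using free_ideal_W assms
  by (intro free_ideal.mult_left[of "W_gens (p + q)"] free_ideal.mult_right[of "W_gens (p + q)"])
    (auto simp: car_mon)

lemma W_exchange:
  assumes "i \<in> {1..p + q}" "j \<in> {1..p + q}" "set a \<subseteq> W_gens (p + q)" "set b \<subseteq> W_gens (p + q)"
  shows "fsub (mon (a @ Dw i # Xw j # b)) (fadd (fsmul (lam s p i j :: 'k::field) (mon (a @ Xw j # Dw i # b)))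
      (fsmul (if i = j then 1 else 0) (mon (a @ b)))) \<in> W_ideal s p q" (is "?x \<in> _")
    "g = Xw \<or> g = Dw \<Longrightarrow>
      fsub (mon (a @ g i # g j # b)) (fsmul (lam s p i j :: 'k) (mon (a @ g j # g i # b))) \<in> W_ideal s p q"
    (is "_ \<Longrightarrow> ?y \<in> _")
proof -
  let ?r = "fsub (fadd (mon [Dw i, Xw j]) (fsmul (- lam s p i j) (mon [Xw j, Dw i])))
        (fsmul (if i = j then 1 else 0) (mon []))"
  have "?r \<in> W_rels s p q"
    unfolding W_rels_def sbr_def fa_gen_mon fmul_mon_mon fa_scal_mon wsgn_lam append_Cons append_Nil
    using assms(1,2) by blast
  then have "?r \<in> W_ideal s p q" using W_rels_W_ideal by blast
  then have "fmul (mon a) (fmul ?r (mon b)) \<in> W_ideal s p q" using W_ideal_context assms by blast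
  moreover have "fmul (mon a) (fmul ?r (mon b)) = ?x"
    unfolding fmul_linear fmul_mon_mon by (auto simp: fun_eq_iff fadd_def fsub_def fsmul_def)
  ultimately show "?x \<in> W_ideal s p q" by metis
next
  assume g: "g = Xw \<or> g = Dw"
  let ?r = "fadd (mon [g i, g j]) (fsmul (- lam s p i j) (mon [g j, g i]))"
  have "?r \<in> W_rels s p q"
    unfolding W_rels_def sbr_def fa_gen_mon fmul_mon_mon fa_scal_mon wsgn_lam append_Cons append_Nil
    using assms(1,2) g by blast
  then have "?r \<in> W_ideal s p q" using W_rels_W_ideal by blast
  then have "fmul (mon a) (fmul ?r (mon b)) \<in> W_ideal s p q" using W_ideal_context assms by blast
  moreover have "fmul (mon a) (fmul ?r (mon b)) = ?y"
    unfolding fmul_linear fmul_mon_mon by (auto simp: fun_eq_iff fadd_def fsub_def fsmul_def)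
  ultimately show "?y \<in> W_ideal s p q" by metis
qed

context free_ideal
begin

lemma cong_trans: "fsub f g \<in> I \<Longrightarrow> fsub g h \<in> I \<Longrightarrow> fsub f h \<in> I"
  using add[of "fsub f g" "fsub g h"] by (simp add: fsub_def fadd_def)

lemma cong_sym: "fsub f g \<in> I \<Longrightarrow> fsub g f \<in> I"
  using smul[of "fsub f g" "-1"] by (simp add: fsub_def fsmul_def)

lemma cong_smul: "fsub f g \<in> I \<Longrightarrow> fsub (fsmul c f) (fsmul c g) \<in> I"
  using smul[of "fsub f g" c] by (simp add: fsub_def fsmul_def algebra_simps)

lemma cong_refl: "fsub f f \<in> I"
  using zero by (simp add: fsub_def)

lemma cong_mem: "fsub f g \<in> I \<Longrightarrow> g \<in> I \<Longrightarrow> f \<in> I"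
  using add[of "fsub f g" g] by (simp add: fsub_def fadd_def)

end

definition ordered_words :: "nat \<Rightarrow> (wgen list \<Rightarrow> 'k::field) set" where
  "ordered_words n = {mon (map Xw a @ map Dw b) | a b. set a \<subseteq> {1..n} \<and> set b \<subseteq> {1..n}}"

text \<open>The span of ordered words is closed under left multiplication by every generator. This
  is immediate for x_i, while \<partial>_i has to be moved through the block of x's.\<close>

lemma W_ordered_span:
  assumes "set w \<subseteq> W_gens (p + q)"
  shows "mon w \<in> lspan (W_ideal s p q) (ordered_words (p + q))" (is "_ \<in> lspan ?I ?S")
proof -
  interpret free_ideal "W_gens (p + q)" ?I by (rule free_ideal_W)
  have ordered: "mon (map Xw a @ map Dw b) \<in> lspan ?I ?S" if "set a \<subseteq> {1..p + q}" "set b \<subseteq> {1..p + q}" for a b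
    using that by (intro lspan_incl) (auto simp: ordered_words_def)
  have X: "fmul (mon [Xw i]) f \<in> lspan ?I ?S" if "f \<in> lspan ?I ?S" "i \<in> {1..p + q}" for f i
    using that(1)
  proof (rule lspan_mult_left)
    show "mon [Xw i] \<in> car (W_gens (p + q))" using that by (simp add: car_mon)
  next
    fix f :: "wgen list \<Rightarrow> 'a" assume "f \<in> ?S"
    then obtain a b where "f = mon (map Xw a @ map Dw b)" "set a \<subseteq> {1..p + q}" "set b \<subseteq> {1..p + q}"
      by (auto simp: ordered_words_def)
    then show "fmul (mon [Xw i]) f \<in> lspan ?I ?S"
      using ordered[of "i # a" b] that by (simp add: fmul_mon_mon)
  qed
  \<comment> \<open>Passing \<partial>_i across x_j leaves x_j times the induction hypothesis and,
    when \<open>i = j\<close>, the shorter ordered word obtained by contraction.\<close>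
  have D_word: "mon (Dw i # map Xw a @ map Dw b) \<in> lspan ?I ?S"
    if "set a \<subseteq> {1..p + q}" "set b \<subseteq> {1..p + q}" "i \<in> {1..p + q}" for i a b
    using that
  proof (induction a)
    case Nil then show ?case using ordered[of "[]" "i # b"] by simp
  next
    case (Cons j a)
    let ?w = "map Xw a @ map Dw b"
    have "fsub (mon ([] @ Dw i # Xw j # ?w)) (fadd (fsmul (lam s p i j) (mon ([] @ Xw j # Dw i # ?w)))
      (fsmul (if i = j then 1 else 0) (mon ([] @ ?w)))) \<in> ?I"
      using Cons.prems by (intro W_exchange) (auto simp: W_gens_def)
    moreover have "mon (Xw j # Dw i # ?w) \<in> lspan ?I ?S"
      using X[of "mon (Dw i # ?w)" j] Cons by (simp add: fmul_mon_mon)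
    moreover have "mon ?w \<in> lspan ?I ?S" using Cons.prems by (intro ordered) auto
    ultimately show ?case
      using lspan_cong[OF _ lspan_add[OF lspan_smul lspan_smul]] by fastforce
  qed
  have D: "fmul (mon [Dw i]) f \<in> lspan ?I ?S" if "f \<in> lspan ?I ?S" "i \<in> {1..p + q}" for f i
    using that(1)
  proof (rule lspan_mult_left)
    show "mon [Dw i] \<in> car (W_gens (p + q))" using that by (simp add: car_mon)
  next
    fix f :: "wgen list \<Rightarrow> 'a" assume "f \<in> ?S"
    then obtain a b where "f = mon (map Xw a @ map Dw b)" "set a \<subseteq> {1..p + q}" "set b \<subseteq> {1..p + q}"
      by (auto simp: ordered_words_def)
    then show "fmul (mon [Dw i]) f \<in> lspan ?I ?S"
      using D_word that by (simp add: fmul_mon_mon)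
  qed
  show ?thesis using assms
  proof (induction w)
    case Nil then show ?case using ordered[of "[]" "[]"] by simp
  next
    case (Cons g w)
    then have "fmul (mon [g]) (mon w) \<in> lspan ?I ?S"
      using X D by (cases g) auto
    then show ?case by (simp add: fmul_mon_mon)
  qed
qed

text \<open>The scalar is a product of values of \<lambda>; being nonzero, it allows the congruence
  to be used in both directions.\<close>

lemma W_sort:
  assumes g: "g = Xw \<or> g = Dw" and l: "set l \<subseteq> {1..p + q}"
    and ab: "set a \<subseteq> W_gens (p + q)" "set b \<subseteq> W_gens (p + q)"
  obtains c :: "'k::field" where "c \<noteq> 0"
    "fsub (mon (a @ map g l @ b)) (fsmul c (mon (a @ map g (sort l) @ b))) \<in> W_ideal s p q"
proof -
  interpret free_ideal "W_gens (p + q)" "W_ideal s p q :: (wgen list \<Rightarrow> 'k) set" by (rule free_ideal_W)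
  \<comment> \<open>The contexts are quantified inside \<open>P\<close> because the prefix rule for
    sorting moves a letter from the list into the left context.\<close>
  define P where "P c l l' \<longleftrightarrow> c \<noteq> 0 \<and>
    (\<forall>a b. set a \<subseteq> W_gens (p + q) \<longrightarrow> set b \<subseteq> W_gens (p + q) \<longrightarrow>
      fsub (mon (a @ map g l @ b)) (fsmul c (mon (a @ map g l' @ b))) \<in> W_ideal s p q)"
    for c :: 'k and l l'
  \<comment> \<open>Equality of multisets is carried along so that the bound on the indices reaches
    the middle list in the transitivity step.\<close>
  define R where "R l l' \<longleftrightarrow> mset l = mset l' \<and> (set l \<subseteq> {1..p + q} \<longrightarrow> (\<exists>c. P c l l'))" for l l'
  have "R l (sort l)"
  proof (rule sort_relI)
    fix l
    have "P 1 l l" unfolding P_def using cong_refl by (simp add: fsmul_def)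
    then show "R l l" unfolding R_def by blast
  next
    fix l1 l2 l3 assume R: "R l1 l2" "R l2 l3"
    have m: "mset l1 = mset l2" "mset l2 = mset l3" using R by (simp_all add: R_def)
    have "\<exists>c. P c l1 l3" if l: "set l1 \<subseteq> {1..p + q}"
    proof -
      have "set l2 = set l1" using mset_eq_setD[OF m(1)] by simp
      then obtain c d where c: "P c l1 l2" and d: "P d l2 l3"
        using R l unfolding R_def by auto
      have "fsub (mon (a @ map g l1 @ b)) (fsmul (c * d) (mon (a @ map g l3 @ b))) \<in> W_ideal s p q"
        if ab: "set a \<subseteq> W_gens (p + q)" "set b \<subseteq> W_gens (p + q)" for a b
      proof -
        have 1: "fsub (mon (a @ map g l1 @ b)) (fsmul c (mon (a @ map g l2 @ b))) \<in> W_ideal s p q"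
          using c ab by (simp add: P_def)
        have "fsub (mon (a @ map g l2 @ b)) (fsmul d (mon (a @ map g l3 @ b))) \<in> W_ideal s p q"
          using d ab by (simp add: P_def)
        from cong_trans[OF 1 cong_smul[OF this]] show ?thesis by (simp add: fsmul_def mult.assoc)
      qed
      then have "P (c * d) l1 l3" using c d by (simp add: P_def)
      then show ?thesis by blast
    qed
    then show "R l1 l3" using m by (simp add: R_def)
  next
    fix x l l' assume R: "R l l'"
    have "\<exists>c. P c (x # l) (x # l')" if l: "set (x # l) \<subseteq> {1..p + q}"
    proof -
      obtain c where c: "P c l l'" using R l by (auto simp: R_def)
      have gx: "g x \<in> W_gens (p + q)" using g l by auto
      have "fsub (mon (a @ map g (x # l) @ b)) (fsmul c (mon (a @ map g (x # l') @ b))) \<in> W_ideal s p q"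
        if ab: "set a \<subseteq> W_gens (p + q)" "set b \<subseteq> W_gens (p + q)" for a b
      proof -
        have "set (a @ [g x]) \<subseteq> W_gens (p + q)" using ab gx by simp
        then have "fsub (mon ((a @ [g x]) @ map g l @ b)) (fsmul c (mon ((a @ [g x]) @ map g l' @ b)))
          \<in> W_ideal s p q" using c ab unfolding P_def by blast
        then show ?thesis by simp
      qed
      then have "P c (x # l) (x # l')" using c by (simp add: P_def)
      then show ?thesis by blast
    qed
    then show "R (x # l) (x # l')" using R by (simp add: R_def)
  next
    fix x y l
    have "P (lam s p x y) (x # y # l) (y # x # l)" if l: "set (x # y # l) \<subseteq> {1..p + q}"
    proof -
      have xy: "x \<in> {1..p + q}" "y \<in> {1..p + q}" and gl: "set (map g l) \<subseteq> W_gens (p + q)"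
        using l g by auto
      have "fsub (mon (a @ map g (x # y # l) @ b)) (fsmul (lam s p x y) (mon (a @ map g (y # x # l) @ b)))
          \<in> (W_ideal s p q :: (wgen list \<Rightarrow> 'k) set)"
        if ab: "set a \<subseteq> W_gens (p + q)" "set b \<subseteq> W_gens (p + q)" for a b
      proof -
        have "set (map g l @ b) \<subseteq> W_gens (p + q)" using gl ab by simp
        from W_exchange(2)[OF xy ab(1) this g, of s, where ?'k = 'k] show ?thesis by simp
      qed
      then show ?thesis using lam_nonzero by (simp add: P_def)
    qed
    then show "R (x # y # l) (y # x # l)" unfolding R_def by auto
  qed
  then obtain c where "P c l (sort l)" using l by (auto simp: R_def)
  then show ?thesis using that ab by (auto simp: P_def)
qed

section \<open>Normally ordered words with admissible exponents\<close>

definition admissible :: "bool \<Rightarrow> nat \<Rightarrow> nat \<Rightarrow> nat multiset \<Rightarrow> bool" where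
  "admissible s p q A \<longleftrightarrow> set_mset A \<subseteq> {1..p + q} \<and> (\<forall>i. fer s p i \<longrightarrow> count A i \<le> 1)"

definition normal_word :: "nat multiset \<times> nat multiset \<Rightarrow> wgen list" where
  "normal_word = (\<lambda>(A, B). map Xw (sorted_list_of_multiset A) @ map Dw (sorted_list_of_multiset B))"

lemma repeated_split:
  assumes "\<not> count (mset l) i \<le> 1"
  obtains l' where "mset l = mset (i # i # l')"
proof -
  have "{#i, i#} \<subseteq># mset l"
    using assms by (auto simp: subseteq_mset_def)
  then obtain m where "mset l = {#i, i#} + m" by (metis subset_mset.add_diff_inverse)
  moreover obtain l' where "m = mset l'" by (metis ex_mset)
  ultimately show ?thesis using that by simp
qed

text \<open>The two copies of \<open>i\<close> are moved to the front by way of the common sorted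
  list. There the relation with \<lambda>_ii = -1 says that the square is its own negative.\<close>

lemma W_repeated:
  fixes s p q
  assumes g: "g = Xw \<or> g = Dw" and l: "set l \<subseteq> {1..p + q}" and "fer s p i" "\<not> count (mset l) i \<le> 1"
    and ab: "set a \<subseteq> W_gens (p + q)" "set b \<subseteq> W_gens (p + q)"
  shows "mon (a @ map g l @ b) \<in> (W_ideal s p q :: (wgen list \<Rightarrow> 'k::field_char_0) set)"
proof -
  interpret free_ideal "W_gens (p + q)" "W_ideal s p q :: (wgen list \<Rightarrow> 'k) set" by (rule free_ideal_W)
  obtain l' where l': "mset l = mset (i # i # l')" using repeated_split assms(4) by metis
  then have sl': "set (i # i # l') \<subseteq> {1..p + q}" using l mset_eq_setD by metis
  have gl': "set (map g l') \<subseteq> W_gens (p + q)" using sl' g by auto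
  have sort: "sort l = sort (i # i # l')"
    using l' by (metis sorted_list_of_multiset_mset)
  have "fsub (mon (a @ g i # g i # map g l' @ b)) (fsmul (lam s p i i) (mon (a @ g i # g i # map g l' @ b)))
      \<in> (W_ideal s p q :: (wgen list \<Rightarrow> 'k) set)"
    using W_exchange(2)[of i p q i a "map g l' @ b" g s, where ?'k = 'k] sl' ab g gl' by auto
  \<comment> \<open>With \<lambda>_ii = -1 the difference is twice the word.\<close>
  then have "fsmul (1 / 2) (fsub (mon (a @ g i # g i # map g l' @ b)) (fsmul (lam s p i i) (mon (a @ g i # g i # map g l' @ b))))
      \<in> (W_ideal s p q :: (wgen list \<Rightarrow> 'k) set)" by (rule smul)
  also have "fsmul (1 / 2) (fsub (mon (a @ g i # g i # map g l' @ b)) (fsmul (lam s p i i) (mon (a @ g i # g i # map g l' @ b))))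
      = (mon (a @ map g (i # i # l') @ b) :: wgen list \<Rightarrow> 'k)"
    using assms(3) by (simp add: fsmul_def fsub_def lam_diag)
  finally have *: "mon (a @ map g (i # i # l') @ b) \<in> (W_ideal s p q :: (wgen list \<Rightarrow> 'k) set)" .
  obtain c :: 'k where c: "c \<noteq> 0" "fsub (mon (a @ map g (i # i # l') @ b))
      (fsmul c (mon (a @ map g (sort (i # i # l')) @ b))) \<in> W_ideal s p q"
    by (rule W_sort[OF g sl' ab, where s = s and ?'k = 'k])
  then have "fsmul c (mon (a @ map g (sort (i # i # l')) @ b)) \<in> W_ideal s p q"
    using cong_mem[OF cong_sym *] by blast
  from smul[OF this, of "1 / c"] c(1) have "mon (a @ map g (sort l) @ b) \<in> (W_ideal s p q :: (wgen list \<Rightarrow> 'k) set)"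
    by (simp add: fsmul_def sort)
  moreover obtain d :: 'k where "fsub (mon (a @ map g l @ b)) (fsmul d (mon (a @ map g (sort l) @ b))) \<in> W_ideal s p q"
    by (rule W_sort[OF g l ab, where s = s and ?'k = 'k])
  ultimately show ?thesis using cong_mem smul by blast
qed

lemma W_normal_span:
  assumes "f \<in> car (W_gens (p + q))"
  shows "f \<in> lspan (W_ideal s p q :: (wgen list \<Rightarrow> 'k::field_char_0) set)
    ((\<lambda>b. mon (normal_word b)) ` {(A, B). admissible s p q A \<and> admissible s p q B})"
    (is "_ \<in> lspan ?I ?S")
proof -
  interpret free_ideal "W_gens (p + q)" ?I by (rule free_ideal_W)
  have ordered: "mon (map Xw a @ map Dw b) \<in> lspan ?I ?S"
    if ab: "set a \<subseteq> {1..p + q}" "set b \<subseteq> {1..p + q}" for a b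
  proof -
    have gens: "set (map Xw a) \<subseteq> W_gens (p + q)" "set (map Dw b) \<subseteq> W_gens (p + q)"
      "set (map Xw (sort a)) \<subseteq> W_gens (p + q)"
      using ab by auto
    consider "admissible s p q (mset a) \<and> admissible s p q (mset b)"
      | i where "fer s p i" "\<not> count (mset a) i \<le> 1" | i where "fer s p i" "\<not> count (mset b) i \<le> 1"
      using ab by (auto simp: admissible_def)
    then show ?thesis
    proof cases
      case 1
      obtain c :: 'k where c: "fsub (mon ([] @ map Xw a @ map Dw b)) (fsmul c (mon ([] @ map Xw (sort a) @ map Dw b))) \<in> ?I"
        by (rule W_sort[of Xw a p q "[]" "map Dw b" s, where ?'k = 'k]) (use ab gens in auto)
      obtain d :: 'k where d: "fsub (mon (map Xw (sort a) @ map Dw b @ [])) (fsmul d (mon (map Xw (sort a) @ map Dw (sort b) @ []))) \<in> ?I"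
        by (rule W_sort[of Dw b p q "map Xw (sort a)" "[]" s, where ?'k = 'k]) (use ab gens in auto)
      have "mon (normal_word (mset a, mset b)) \<in> lspan ?I ?S"
        using 1 by (intro lspan_incl) auto
      then have "mon (map Xw (sort a) @ map Dw (sort b)) \<in> lspan ?I ?S"
        by (simp add: normal_word_def)
      then have "mon (map Xw (sort a) @ map Dw b) \<in> lspan ?I ?S"
        using lspan_cong[OF _ lspan_smul] d by fastforce
      then show ?thesis using lspan_cong[OF _ lspan_smul] c by fastforce
    next
      case 2
      then show ?thesis using W_repeated[of Xw a p q s i "[]" "map Dw b"] ab gens lspan_base by auto
    next
      case 3
      then show ?thesis using W_repeated[of Dw b p q s i "map Xw a" "[]"] ab gens lspan_base by auto
    qed
  qed
  show ?thesis
  proof (rule lspan_mon_words[OF free_ideal_W assms])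
    fix w assume "set w \<subseteq> W_gens (p + q)"
    from W_ordered_span[OF this] show "mon w \<in> lspan ?I ?S"
    proof (rule lspan_trans)
      fix f :: "wgen list \<Rightarrow> 'k" assume "f \<in> ordered_words (p + q)"
      then show "f \<in> lspan ?I ?S" unfolding ordered_words_def using ordered by blast
    qed
  qed
qed

subsection \<open>Faithfulness\<close>

definition valid :: "bool \<Rightarrow> nat \<Rightarrow> nat \<Rightarrow> (nat \<Rightarrow> int) \<Rightarrow> bool" where
  "valid s p q M \<longleftrightarrow> (\<forall>i. 0 \<le> M i \<and> (fer s p i \<longrightarrow> M i \<le> 1) \<and> (i \<notin> {1..p + q} \<longrightarrow> M i = 0))"

abbreviation state :: "nat multiset \<Rightarrow> nat \<Rightarrow> int" where
  "state A \<equiv> \<lambda>i. int (count A i)"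

lemma valid_state: "valid s p q (state A) \<longleftrightarrow> admissible s p q A"
proof -
  have "set_mset A \<subseteq> {1..p + q} \<longleftrightarrow> (\<forall>i. i \<notin> {1..p + q} \<longrightarrow> count A i = 0)"
    by (auto simp: count_eq_zero_iff)
  then show ?thesis unfolding valid_def admissible_def by auto
qed

lemma valid_obtain_state:
  assumes "valid s p q M" obtains A where "M = state A"
proof -
  have "{i. 0 < nat (M i)} \<subseteq> {1..p + q}" using assms by (fastforce simp: valid_def)
  then have "count (Abs_multiset (\<lambda>i. nat (M i))) = (\<lambda>i. nat (M i))"
    by (intro Abs_multiset_inverse) (auto intro: finite_subset)
  then have "M = state (Abs_multiset (\<lambda>i. nat (M i)))" using assms by (auto simp: valid_def)
  then show ?thesis using that by blast
qed

lemma deg_map: "deg (map Xw l) = state (mset l)" "deg (map Dw l) = (\<lambda>i. - state (mset l) i)"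
  by (induction l) auto

text \<open>The coefficients vanish at every exit from the valid states: lowering exponent 0 gives
  0, and so does raising an occupied index with \<lambda>_ii = -1. The valid states thus span a
  subrepresentation of the integer one.\<close>

lemma wcoef_valid:
  assumes "valid s p q M" "set w \<subseteq> W_gens (p + q)" "wcoef s p w M \<noteq> (0 :: 'k::field)"
  shows "valid s p q (\<lambda>j. M j + deg w j)"
  using assms
proof (induction w)
  case Nil then show ?case by simp
next
  case (Cons g w)
  define N where "N = (\<lambda>j. M j + deg w j)"
  have N: "valid s p q N" and b: "bare s p g N \<noteq> (0 :: 'k)" and g: "g \<in> W_gens (p + q)"
    using Cons by (auto simp: N_def lcoef_def)
  have Ni: "0 \<le> N i" "fer s p i \<Longrightarrow> N i \<le> 1" "i \<notin> {1..p + q} \<Longrightarrow> N i = 0" for i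
    using N by (auto simp: valid_def)
  have "valid s p q (\<lambda>j. N j + shift g j)"
  proof (cases g)
    case (Xw i)
    have "N i \<le> 0" if "fer s p i"
    proof -
      have "even (N i)" using that Xw b by (auto split: if_splits)
      then show ?thesis using Ni(2)[OF that] by presburger
    qed
    then show ?thesis using Ni g Xw by (auto simp: valid_def)
  next
    case (Dw i)
    have "N i \<noteq> 0" using Dw b by (auto split: if_splits)
    then have "N i \<ge> 1" using Ni(1)[of i] by linarith
    moreover have "fer s p j \<Longrightarrow> N j + shift g j \<le> 1" for j
      using Ni(2)[of j] Dw by (cases "j = i") auto
    ultimately show ?thesis using Ni(1,3) g Dw by (auto simp: valid_def)
  qed
  then show ?case by (simp add: N_def algebra_simps)
qed

text \<open>Every intermediate exponent lies between the final one and \<open>M\<close>, so each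
  letter contributes a sign times 1 or a positive integer.\<close>

lemma wcoef_lower_nonzero:
  assumes "valid s p q M" "valid s p q (\<lambda>j. M j - state (mset l) j)"
  shows "wcoef s p (map Dw l) M \<noteq> (0 :: 'k::field_char_0)"
  using assms(2)
proof (induction l)
  case Nil show ?case by simp
next
  case (Cons i l)
  define N where "N = (\<lambda>j. M j - state (mset l) j)"
  have N: "0 \<le> N j - (if j = i then 1 else 0)" "N j \<le> M j" for j
  proof -
    have V: "0 \<le> M j - state (mset (i # l)) j" using Cons.prems unfolding valid_def by blast
    show "0 \<le> N j - (if j = i then 1 else 0)" using V by (auto simp: N_def)
    show "N j \<le> M j" by (simp add: N_def)
  qed
  have "valid s p q N" unfolding valid_def
  proof (intro allI conjI impI)
    fix j
    have M: "fer s p j \<Longrightarrow> M j \<le> 1" "j \<notin> {1..p + q} \<Longrightarrow> M j = 0"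
      using assms(1) unfolding valid_def by auto
    show "0 \<le> N j" using N(1)[of j] by (simp split: if_splits)
    show "fer s p j \<Longrightarrow> N j \<le> 1" using N(2)[of j] M by linarith
    show "j \<notin> {1..p + q} \<Longrightarrow> N j = 0" using N(2)[of j] M \<open>0 \<le> N j\<close> by linarith
  qed
  moreover have "bare s p (Dw i) N \<noteq> (0 :: 'k)"
  proof -
    have "N i \<ge> 1" using N(1)[of i] by simp
    moreover have "N i = 1" if "fer s p i"
      using that \<open>valid s p q N\<close> \<open>N i \<ge> 1\<close> by (auto simp: valid_def order.antisym)
    ultimately show ?thesis by auto
  qed
  ultimately show ?case using Cons.IH koszul_nonzero
    by (simp add: N_def[symmetric] lcoef_def deg_map)
qed

lemma wcoef_raise_nonzero:
  assumes "valid s p q M" "valid s p q (\<lambda>j. M j + state (mset l) j)"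
  shows "wcoef s p (map Xw l) M \<noteq> (0 :: 'k::field_char_0)"
  using assms(2)
proof (induction l)
  case Nil show ?case by simp
next
  case (Cons i l)
  define N where "N = (\<lambda>j. M j + state (mset l) j)"
  have N: "0 \<le> N j" "fer s p j \<Longrightarrow> N j + (if j = i then 1 else 0) \<le> 1"
      "j \<notin> {1..p + q} \<Longrightarrow> N j = 0" for j
  proof -
    have M: "0 \<le> M j" using assms(1) unfolding valid_def by auto
    have V: "fer s p j \<Longrightarrow> M j + state (mset (i # l)) j \<le> 1" "j \<notin> {1..p + q} \<Longrightarrow> M j + state (mset (i # l)) j = 0"
      using Cons.prems unfolding valid_def by blast+
    show "0 \<le> N j" using M by (simp add: N_def)
    show "fer s p j \<Longrightarrow> N j + (if j = i then 1 else 0) \<le> 1" using V(1) by (cases "j = i") (auto simp: N_def)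
    show "j \<notin> {1..p + q} \<Longrightarrow> N j = 0" using V(2) M by (cases "j = i") (auto simp: N_def)
  qed
  have "valid s p q N" unfolding valid_def
  proof (intro allI conjI impI)
    fix j show "fer s p j \<Longrightarrow> N j \<le> 1" using N(2)[of j] by (simp split: if_splits)
  qed (use N in auto)
  moreover have "bare s p (Xw i) N \<noteq> (0 :: 'k)"
    using N(1,2)[of i] by auto
  ultimately show ?case using Cons.IH koszul_nonzero
    by (simp add: N_def[symmetric] lcoef_def deg_map)
qed

text \<open>The route goes through the vacuum: lower \<open>M\<close> to the zero state, then raise
  that to \<open>M'\<close>. This is irreducibility in the form needed to return from a target to
  its source.\<close>

lemma valid_connected:
  assumes "valid s p q M" "valid s p q M'"
  obtains a b where "set a \<subseteq> {1..p + q}" "set b \<subseteq> {1..p + q}"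
    "(\<lambda>j. M j + deg (map Xw a @ map Dw b) j) = M'"
    "wcoef s p (map Xw a @ map Dw b) M \<noteq> (0 :: 'k::field_char_0)"
proof -
  obtain A B where AB: "M = state B" "M' = state A" using assms valid_obtain_state by metis
  obtain a b where ab: "A = mset a" "B = mset b" by (metis ex_mset)
  have z: "valid s p q (\<lambda>j. 0)" by (simp add: valid_def)
  have "wcoef s p (map Dw b) M \<noteq> (0 :: 'k)"
    using assms z by (intro wcoef_lower_nonzero) (simp_all add: AB ab)
  moreover have "wcoef s p (map Xw a) (\<lambda>j. 0) \<noteq> (0 :: 'k)"
    using assms z by (intro wcoef_raise_nonzero) (simp_all add: AB ab)
  moreover have "set a \<subseteq> {1..p + q}" "set b \<subseteq> {1..p + q}"
    using assms unfolding AB ab valid_state admissible_def by auto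
  ultimately show ?thesis
    by (intro that[of a b]) (auto simp: deg_append deg_map AB ab wcoef_append)
qed

lemma normal_word_simps:
  "deg (normal_word (A, B)) = (\<lambda>i. state A i - state B i)"
  "wcoef s p (normal_word (A, B)) M =
    wcoef s p (map Xw (sorted_list_of_multiset A)) (\<lambda>i. M i - state B i) *
    wcoef s p (map Dw (sorted_list_of_multiset B)) M"
  by (simp_all add: normal_word_def deg_append deg_map wcoef_append)

theorem fock_faithful:
  assumes f: "f \<in> car (W_gens (p + q))"
    and 0: "\<And>M M'. valid s p q M \<Longrightarrow> lin (mcoef s p M M') f = 0"
  shows "f \<in> (W_ideal s p q :: (wgen list \<Rightarrow> 'k::field_char_0) set)"
proof -
  interpret free_ideal "W_gens (p + q)" "W_ideal s p q :: (wgen list \<Rightarrow> 'k) set" by (rule free_ideal_W)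
  let ?B = "{(A, B). admissible s p q A \<and> admissible s p q B}"
  obtain F c where F: "finite F" "F \<subseteq> ?B" and fF: "fsub f (\<lambda>w. \<Sum>b\<in>F. c b * mon (normal_word b) w) \<in> W_ideal s p q"
    by (rule lspan_combination[OF W_normal_span[OF f, of s]])
  have words: "set (normal_word b) \<subseteq> W_gens (p + q)" if "b \<in> ?B" for b
    using that by (auto simp: normal_word_def admissible_def)
  let ?g = "\<lambda>w. \<Sum>b\<in>F. c b * mon (normal_word b) w"
  have g: "?g \<in> car (W_gens (p + q)) \<and> lin L ?g = (\<Sum>b\<in>F. c b * lin L (mon (normal_word b)))" for L
    using F words by (intro lin_sum) (auto simp: car_mon)
  have sum0: "(\<Sum>b\<in>F. c b * mcoef s p M M' (normal_word b)) = 0" if "valid s p q M" for M M'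
  proof -
    have "fsub f ?g \<in> fock_kernel s p q" using fF W_ideal_fock_kernel by blast
    then have "lin (mcoef s p M M') (fsub f ?g) = 0" by (simp add: fock_kernel_def)
    then have "lin (mcoef s p M M') ?g = 0" using 0[OF that] g f by (simp add: lin_fsub[of _ "W_gens (p+q)"])
    then show ?thesis using g[of "mcoef s p M M'"] by (simp add: lin_mon)
  qed
  have "c b0 = 0" if "b0 \<in> F" for b0
  \<comment> \<open>Row \<open>(A, B)\<close> reads off the coefficient from x^B to x^A; rows are
    ordered by the size of \<open>B\<close>.\<close>
  proof (rule triangular_vanish[where e = "\<lambda>b b'. mcoef s p (state (snd b)) (state (fst b)) (normal_word b')"
        and sz = "\<lambda>b. size (snd b)"])
    fix b0 assume "b0 \<in> F"
    then have "valid s p q (state (snd b0))" using F valid_state by auto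
    then show "(\<Sum>b\<in>F. c b * mcoef s p (state (snd b0)) (state (fst b0)) (normal_word b)) = 0"
      by (rule sum0)
  next
    fix b assume "b \<in> F"
    then obtain A B where b: "b = (A, B)" "admissible s p q A" "admissible s p q B" using F by auto
    have z: "valid s p q (\<lambda>j. 0)" by (simp add: valid_def)
    have "wcoef s p (map Dw (sorted_list_of_multiset B)) (state B) \<noteq> (0 :: 'k)"
      using b z valid_state[of s p q] by (intro wcoef_lower_nonzero) auto
    moreover have "wcoef s p (map Xw (sorted_list_of_multiset A)) (\<lambda>j. 0) \<noteq> (0 :: 'k)"
      using b z valid_state[of s p q] by (intro wcoef_raise_nonzero) auto
    ultimately show "mcoef s p (state (snd b)) (state (fst b)) (normal_word b) \<noteq> (0 :: 'k)"
      by (simp add: mcoef_def normal_word_simps b)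
  next
    fix b b0 assume bF: "b \<in> F" "b0 \<in> F" "b \<noteq> b0"
      and nz: "mcoef s p (state (snd b0)) (state (fst b0)) (normal_word b) \<noteq> (0 :: 'k)"
    obtain A B A0 B0 where b: "b = (A, B)" "b0 = (A0, B0)" by (cases b, cases b0) auto
    have adm: "admissible s p q B" "admissible s p q B0" using bF F b by auto
    have d: "(\<lambda>i. state B0 i + (state A i - state B i)) = state A0"
      and w: "wcoef s p (map Dw (sorted_list_of_multiset B)) (state B0) \<noteq> (0 :: 'k)"
      using nz unfolding b fst_conv snd_conv mcoef_def normal_word_simps by (simp_all split: if_splits)
    \<comment> \<open>After \<partial>^B the exponents are those of \<open>B0\<close> minus those of
      \<open>B\<close>; validity says that they are nonnegative.\<close>
    have "valid s p q (\<lambda>j. state B0 j + deg (map Dw (sorted_list_of_multiset B)) j)"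
      using adm w by (intro wcoef_valid) (auto simp: valid_state admissible_def)
    then have sub: "B \<subseteq># B0" by (auto simp: subseteq_mset_def valid_def deg_map)
    have "B \<noteq> B0"
    proof
      assume "B = B0"
      then have "A = A0" using d by (auto simp: fun_eq_iff multiset_eq_iff)
      then show False using \<open>B = B0\<close> bF b by simp
    qed
    then show "size (snd b) < size (snd b0)" using sub b by (simp add: mset_subset_size subset_mset.le_neq_trans)
  qed (use F that in auto)
  then have "?g w = 0" for w by simp
  then show ?thesis using fF by (simp add: fsub_def)
qed

text \<open>The relations give vanishing at all integer states, whereas faithfulness asks only for
  valid sources; so both choices of states describe the same ideal.\<close>

corollary W_ideal_iff:
  fixes f :: "wgen list \<Rightarrow> 'k::field_char_0"
  shows "f \<in> W_ideal s p q \<longleftrightarrow>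
    f \<in> car (W_gens (p + q)) \<and> (\<forall>M M'. valid s p q M \<longrightarrow> lin (mcoef s p M M') f = 0)"
  using fock_faithful[of f p q s] W_ideal_fock_kernel[of s p q] by (auto simp: fock_kernel_def)

section \<open>The comparison map to the Clifford--Weyl superalgebra\<close>

text \<open>The image of \<open>U i\<close> is forced by the relation Y_i X_i = u_i.\<close>

primrec psi :: "gen \<Rightarrow> wgen list" where
  "psi (U i) = [Dw i, Xw i]"
| "psi (X i) = [Xw i]"
| "psi (Y i) = [Dw i]"

definition psiw :: "gen list \<Rightarrow> wgen list" where
  "psiw w = concat (map psi w)"

definition Psi :: "(gen list \<Rightarrow> 'k::field) \<Rightarrow> wgen list \<Rightarrow> 'k" where
  "Psi f = (\<lambda>v. lin (\<lambda>w. mon (psiw w) v) f)"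

lemma psiw_simps [simp]: "psiw [] = []" "psiw (g # w) = psi g @ psiw w" "psiw (u @ v) = psiw u @ psiw v"
  by (simp_all add: psiw_def)

lemma deg_psiw: "deg (psiw w) = wdeg w"
proof
  fix j show "deg (psiw w) j = wdeg w j"
  proof (induction w)
    case Nil show ?case by (simp add: wdeg_def)
  next
    case (Cons g w)
    have "wdeg (g # w) j = deg (psi g) j + wdeg w j" by (cases g) (auto simp: wdeg_def)
    then show ?case using Cons by (simp add: deg_append)
  qed
qed

lemma Psi_zero: "Psi (\<lambda>w. 0) = (\<lambda>w. 0)"
  by (simp add: Psi_def lin_zero)

lemma Psi_fadd: "f \<in> car G \<Longrightarrow> g \<in> car G \<Longrightarrow> Psi (fadd f g) = fadd (Psi f) (Psi g)"
  by (simp add: Psi_def lin_fadd[of _ G]) (simp add: fadd_def)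

lemma Psi_fsmul: "Psi (fsmul c f) = fsmul c (Psi f)"
  by (simp add: Psi_def lin_fsmul) (simp add: fsmul_def)

lemma Psi_fsub: "f \<in> car G \<Longrightarrow> g \<in> car G \<Longrightarrow> Psi (fsub f g) = fsub (Psi f) (Psi g)"
  by (simp add: fsub_conv Psi_fadd[OF _ car_fsmul] Psi_fsmul)

lemma Psi_mon: "Psi (mon w) = mon (psiw w)"
  by (simp add: Psi_def lin_mon)

lemma tgw_gens_mem [simp]:
  "X i \<in> tgw_gens n \<longleftrightarrow> i \<in> {1..n}" "Y i \<in> tgw_gens n \<longleftrightarrow> i \<in> {1..n}" "U i \<in> tgw_gens n \<longleftrightarrow> i \<in> {1..n}"
  by (auto simp: tgw_gens_def)

lemma R_gens_mem [simp]: "X i \<notin> R_gens n" "Y i \<notin> R_gens n" "U i \<in> R_gens n \<longleftrightarrow> i \<in> {1..n}"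
  by (auto simp: R_gens_def)

lemma R_gens_tgw_gens: "R_gens n \<subseteq> tgw_gens n"
  by (auto simp: R_gens_def tgw_gens_def)

lemma car_R_tgw: "f \<in> car (R_gens n) \<Longrightarrow> f \<in> car (tgw_gens n)"
  using R_gens_tgw_gens by (fastforce simp: mem_car)

lemma psiw_gens: "set w \<subseteq> tgw_gens n \<Longrightarrow> set (psiw w) \<subseteq> W_gens n"
  by (induction w) (auto simp: tgw_gens_def)

lemma Psi_car: "f \<in> car (tgw_gens n) \<Longrightarrow> Psi f \<in> car (W_gens n)"
  by (induction rule: car_induct)
    (auto simp: Psi_zero car_zero Psi_fadd[of _ "tgw_gens n"] Psi_fsmul Psi_mon car_fadd car_fsmul
      car_mon psiw_gens)

text \<open>Transports the action to words in \<open>U\<close>, \<open>X\<close>, \<open>Y\<close>,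
  so that the relations of the TGW construction can be tested coefficientwise.\<close>

lemma lin_Psi:
  fixes f :: "gen list \<Rightarrow> 'k::field"
  assumes "f \<in> car (tgw_gens n)"
  shows "lin L (Psi f) = lin (\<lambda>w. L (psiw w)) f"
  using assms
proof (induction rule: car_induct)
  case zero then show ?case by (simp add: Psi_zero lin_zero)
next
  case (step f c w)
  have "mon w \<in> (car (tgw_gens n) :: (gen list \<Rightarrow> 'k) set)"
    "mon (psiw w) \<in> (car (W_gens n) :: (wgen list \<Rightarrow> 'k) set)"
    using step psiw_gens by (auto simp: car_mon)
  then show ?case using step Psi_car[OF step(1)]
    by (simp add: Psi_fadd[of _ "tgw_gens n"] Psi_fsmul Psi_mon car_fsmul lin_fadd[of _ "W_gens n"]
      lin_fadd[of _ "tgw_gens n"] lin_fsmul lin_mon)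
qed

lemma Psi_fmul:
  fixes f g :: "gen list \<Rightarrow> 'k::field"
  assumes f: "f \<in> car (tgw_gens n)" and g: "g \<in> car (tgw_gens n)"
  shows "Psi (fmul f g) = fmul (Psi f) (Psi g)"
  using f
proof (induction rule: car_induct)
  case zero show ?case by (simp add: fmul_linear Psi_zero)
next
  case (step f c u)
  have u: "mon u \<in> (car (tgw_gens n) :: (gen list \<Rightarrow> 'k) set)" using step by (simp add: car_mon)
  have "Psi (fmul (mon u) g) = fmul (mon (psiw u)) (Psi g)"
    using g
  proof (induction rule: car_induct)
    case zero show ?case by (simp add: fmul_linear Psi_zero)
  next
    case (step g d v)
    have "mon v \<in> (car (tgw_gens n) :: (gen list \<Rightarrow> 'k) set)" using step by (simp add: car_mon)
    then show ?case using step u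
      by (simp add: fmul_linear Psi_fadd[of _ "tgw_gens n"] Psi_fsmul Psi_mon car_fmul car_fsmul
          fmul_mon_mon car_mon)
  qed
  then show ?case using step u g
    by (simp add: fmul_linear Psi_fadd[of _ "tgw_gens n"] Psi_fsmul Psi_mon car_fmul car_fsmul)
qed

subsection \<open>The images of the defining relations\<close>

text \<open>With \<open>UNIV\<close> as generating set the membership side conditions hold for all
  words and are discharged by simplification.\<close>

lemmas lin_calc = fmul_linear fmul_mon_mon fa_gen_mon fa_scal_mon lin_fsub[of _ UNIV]
  lin_fadd[of _ UNIV] lin_fsmul lin_mon car_mon car_fsmul car_fsub car_fadd

abbreviation ucoef :: "bool \<Rightarrow> nat \<Rightarrow> nat \<Rightarrow> (nat \<Rightarrow> int) \<Rightarrow> 'k::field" where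
  "ucoef s p i M \<equiv> wcoef s p [Dw i, Xw i] M"

lemma tau_diag: "tau s p i i = fsmul (lam s p i i) (fsub (mon [U i]) (mon []))"
  by (simp add: tau_def fa_gen_mon fa_scal_one)

lemma tau_off: "i \<noteq> j \<Longrightarrow> tau s p i j = mon [U j]"
  by (simp add: tau_def fa_gen_mon)

lemma tau_inv_diag: "tau_inv s p i i = fadd (fsmul (lam s p i i) (mon [U i])) (mon [])"
  by (simp add: tau_inv_def fa_gen_mon fa_scal_one)

lemma tau_inv_off: "i \<noteq> j \<Longrightarrow> tau_inv s p i j = mon [U j]"
  by (simp add: tau_inv_def fa_gen_mon)

text \<open>\<open>U i\<close> has degree zero and acts diagonally: on the right its eigenvalue is
  read at the source, in the companion lemma on the left at the target.\<close>

lemma mcoef_psiw_U: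
  "mcoef s p M M' (psiw (w @ [U i])) = ucoef s p i M * (mcoef s p M M' (psiw w) :: 'k::field)"
proof -
  have "(\<lambda>j. M j + deg (psi (U i)) j) = M" by auto
  then show ?thesis unfolding psiw_simps by (subst mcoef_append_right) simp
qed

lemma mcoef_psiw_U_left:
  "mcoef s p M M' (psiw (U i # w)) = ucoef s p i M' * (mcoef s p M M' (psiw w) :: 'k::field)"
proof -
  have "(\<lambda>j. M' j - deg (psi (U i)) j) = M'" by auto
  then show ?thesis unfolding psiw_simps by (subst mcoef_append_left) simp
qed

lemma mcoef_single: "mcoef s p M M' [g] = (if M' = (\<lambda>j. M j + shift g j) then lcoef s p g M else 0)"
  by (auto simp: mcoef_def fun_eq_iff)

text \<open>x_i raises only exponent \<open>i\<close>, and there the eigenvalue of u_i at the source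
  is \<tau>_i applied to its eigenvalue at the target.\<close>

lemma mcoef_X_U:
  assumes "i \<ge> 1" "j \<ge> 1"
  shows "mcoef s p M M' (psiw [X i, U j]) =
    (if i = j then lam s p i i * (mcoef s p M M' (psiw [U i, X i]) - mcoef s p M M' (psiw [X i]))
     else (mcoef s p M M' (psiw [U j, X i]) :: 'k::field))"
proof -
  have "ucoef s p j M = (if i = j then lam s p i i * (ucoef s p i (\<lambda>k. M k + shift (Xw i) k) - 1)
      else ucoef s p j (\<lambda>k. M k + shift (Xw i) k) :: 'k)"
    unfolding wcoef_diag(1)[OF assms(1)] wcoef_diag(1)[OF assms(2)] by (auto simp: lam_diag)
  \<comment> \<open>Away from the shifted target \<open>m\<close> is 0 and both sides vanish, so the
    eigenvalue identity is used only there.\<close>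
  then have *: "ucoef s p j M * m = (if i = j then lam s p i i * (ucoef s p i M' * m - m) else ucoef s p j M' * m :: 'k)"
    if "m = mcoef s p M M' [Xw i]" for m :: 'k
    using that by (cases "M' = (\<lambda>k. M k + shift (Xw i) k)") (simp_all add: mcoef_single algebra_simps del: wcoef.simps shift.simps)
  show ?thesis
    using *[OF refl] unfolding mcoef_psiw_U[of s p M M' "[X i]" j, simplified append_Cons append_Nil]
      mcoef_psiw_U_left by simp
qed

lemma mcoef_Y_U:
  assumes "i \<ge> 1" "j \<ge> 1"
  shows "mcoef s p M M' (psiw [Y i, U j]) =
    (if i = j then lam s p i i * mcoef s p M M' (psiw [U i, Y i]) + mcoef s p M M' (psiw [Y i])
     else (mcoef s p M M' (psiw [U j, Y i]) :: 'k::field))"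
proof -
  have "ucoef s p j M = (if i = j then lam s p i i * ucoef s p i (\<lambda>k. M k + shift (Dw i) k) + 1
      else ucoef s p j (\<lambda>k. M k + shift (Dw i) k) :: 'k)"
    unfolding wcoef_diag(1)[OF assms(1)] wcoef_diag(1)[OF assms(2)] by (auto simp: lam_diag)
  then have *: "ucoef s p j M * m = (if i = j then lam s p i i * (ucoef s p i M' * m) + m else ucoef s p j M' * m :: 'k)"
    if "m = mcoef s p M M' [Dw i]" for m :: 'k
    using that by (cases "M' = (\<lambda>k. M k + shift (Dw i) k)") (simp_all add: mcoef_single algebra_simps del: wcoef.simps shift.simps)
  show ?thesis
    using *[OF refl] unfolding mcoef_psiw_U[of s p M M' "[Y i]" j, simplified append_Cons append_Nil]
      mcoef_psiw_U_left by simp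
qed

text \<open>This is \<partial>_i x_i - \<lambda>_ii x_i \<partial>_i = 1 multiplied by \<lambda>_ii,
  whose square is 1.\<close>

lemma mcoef_X_Y_diag:
  assumes "i \<ge> 1"
  shows "mcoef s p M M' (psiw [X i, Y i]) =
    lam s p i i * (mcoef s p M M' (psiw [U i]) - (mcoef s p M M' [] :: 'k::field))"
proof -
  have "mcoef s p M M' [Dw i, Xw i] - lam s p i i * mcoef s p M M' [Xw i, Dw i]
      - (if i = i then 1 else 0) * mcoef s p M M' [] = (0 :: 'k)"
    by (rule mcoef_relation(1)[OF assms assms])
  then show ?thesis by (simp add: lam_square' algebra_simps)
qed

text \<open>Diagonal operators commute, and for \<lambda>_ii = -1 the eigenvalue of u_i is 0 or 1 at
  every integer state, hence idempotent.\<close>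

lemma R_rels_Psi:
  assumes "r \<in> (R_rels s p q :: (gen list \<Rightarrow> 'k::field_char_0) set)"
  shows "lin (\<lambda>w. mcoef s p M M' (psiw w)) r = 0"
proof -
  have "lin (\<lambda>w. mcoef s p M M' (psiw w))
      (fsub (fmul (fa_gen (U i)) (fa_gen (U j))) (fmul (fa_gen (U j)) (fa_gen (U i)))) = (0 :: 'k)" for i j
    using mcoef_psiw_U_left[of s p M M' i "[U j]", where ?'k = 'k] mcoef_psiw_U_left[of s p M M' j "[U i]", where ?'k = 'k]
      mcoef_psiw_U_left[of s p M M' _ "[]", where ?'k = 'k]
    by (simp add: lin_calc del: psiw_simps(2))
  moreover have "lin (\<lambda>w. mcoef s p M M' (psiw w))
      (fsub (fmul (fa_gen (U i)) (fa_gen (U i))) (fa_gen (U i))) = (0 :: 'k)" if "fer s p i" "i \<ge> 1" for i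
  proof -
    have "ucoef s p i M' * ucoef s p i M' = (ucoef s p i M' :: 'k)"
      unfolding wcoef_diag(1)[OF that(2)] using that(1) by simp
    then have "ucoef s p i M' * (ucoef s p i M' * x) = ucoef s p i M' * (x :: 'k)" for x
      by (metis mult.assoc)
    then show ?thesis
      using mcoef_psiw_U_left[of s p M M' i "[U i]", where ?'k = 'k] mcoef_psiw_U_left[of s p M M' i "[]", where ?'k = 'k]
      by (simp add: lin_calc del: psiw_simps(2) wcoef.simps)
  qed
  ultimately show ?thesis using assms unfolding R_rels_def lam_diag_iff by auto
qed

lemma C_rels_Psi:
  assumes "r \<in> (C_rels s p q :: (gen list \<Rightarrow> 'k::field_char_0) set)"
  shows "lin (\<lambda>w. mcoef s p M M' (psiw w)) r = 0"
proof -
  have "lin (\<lambda>w. mcoef s p M M' (psiw w))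
      (fsub (fmul (fa_gen (X i)) (fa_gen (U j))) (fmul (tau s p i j) (fa_gen (X i)))) = (0 :: 'k)"
    if "i \<ge> 1" "j \<ge> 1" for i j
    using mcoef_X_U[OF that, of s p M M', where ?'k = 'k]
    by (cases "i = j") (simp_all add: lin_calc tau_diag tau_off del: psiw_simps(2))
  moreover have "lin (\<lambda>w. mcoef s p M M' (psiw w))
      (fsub (fmul (fa_gen (Y i)) (fa_gen (U j))) (fmul (tau_inv s p i j) (fa_gen (Y i)))) = (0 :: 'k)"
    if "i \<ge> 1" "j \<ge> 1" for i j
    using mcoef_Y_U[OF that, of s p M M', where ?'k = 'k]
    by (cases "i = j") (simp_all add: lin_calc tau_inv_diag tau_inv_off del: psiw_simps(2))
  moreover have "lin (\<lambda>w. mcoef s p M M' (psiw w))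
      (fsub (fmul (fa_gen (Y i)) (fa_gen (X i))) (fa_gen (U i))) = (0 :: 'k)" for i
    by (simp add: lin_calc)
  moreover have "lin (\<lambda>w. mcoef s p M M' (psiw w))
      (fsub (fmul (fa_gen (X i)) (fa_gen (Y i))) (tau s p i i)) = (0 :: 'k)" if "i \<ge> 1" for i
    using mcoef_X_Y_diag[OF that, of s p M M', where ?'k = 'k]
    by (simp add: lin_calc tau_diag del: psiw_simps(2))
  moreover have "lin (\<lambda>w. mcoef s p M M' (psiw w))
      (fsub (fmul (fa_gen (X i)) (fa_gen (Y j)))
           (fsmul (lam s p i j) (fmul (fa_gen (Y j)) (fa_gen (X i))))) = (0 :: 'k)"
    if "i \<ge> 1" "j \<ge> 1" "i \<noteq> j" for i j
    using mcoef_swap[of "Xw i" "Dw j" s p M M', where ?'k = 'k] that by (simp add: lin_calc)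
  ultimately show ?thesis using assms R_rels_Psi[of r s p q M M']
    unfolding C_rels_def by (elim UnE) auto
qed

lemma R_rels_car: "R_rels s p q \<subseteq> car (R_gens (p + q))"
  unfolding R_rels_def fa_gen_mon fmul_mon_mon by (auto intro!: car_fsub simp: car_mon)

lemma tau_car: "i \<in> {1..n} \<Longrightarrow> j \<in> {1..n} \<Longrightarrow> tau s p i j \<in> car (R_gens n)"
  "i \<in> {1..n} \<Longrightarrow> j \<in> {1..n} \<Longrightarrow> tau_inv s p i j \<in> car (R_gens n)"
  by (auto simp: tau_def tau_inv_def fa_gen_mon fa_scal_one intro!: car_fsmul car_fsub car_fadd)
    (auto simp: car_mon)

lemma C_rels_car: "C_rels s p q \<subseteq> car (tgw_gens (p + q))"
proof -
  have "R_rels s p q \<subseteq> car (tgw_gens (p + q))" using R_rels_car car_R_tgw by blast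
  then show ?thesis unfolding C_rels_def fa_gen_mon
    by (auto intro!: car_fsub car_fsmul car_fmul car_R_tgw[OF tau_car(1)] car_R_tgw[OF tau_car(2)]
        simp: car_mon)
qed

lemma ideal_C_ideal: "ideal (C_ideal s p q) (free_alg (tgw_gens (p + q)))"
  unfolding C_ideal_def tgw_free_def
  by (rule ring.genideal_ideal[OF ring_free_alg C_rels_car])

lemma free_ideal_C: "free_ideal (tgw_gens (p + q)) (C_ideal s p q)"
  by (rule free_ideal.intro[OF ideal_C_ideal])

lemma C_rels_C_ideal: "C_rels s p q \<subseteq> C_ideal s p q"
  unfolding C_ideal_def tgw_free_def
  by (rule ring.genideal_self[OF ring_free_alg C_rels_car])

definition Psi_kernel :: "bool \<Rightarrow> nat \<Rightarrow> nat \<Rightarrow> (gen list \<Rightarrow> 'k::field) set" where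
  "Psi_kernel s p q = {f \<in> car (tgw_gens (p + q)). Psi f \<in> W_ideal s p q}"

lemma Psi_kernel_iff:
  fixes f :: "gen list \<Rightarrow> 'k::field_char_0"
  shows "f \<in> Psi_kernel s p q \<longleftrightarrow> f \<in> car (tgw_gens (p + q)) \<and>
    (\<forall>M M'. valid s p q M \<longrightarrow> lin (\<lambda>w. mcoef s p M M' (psiw w)) f = 0)"
  unfolding Psi_kernel_def W_ideal_iff by (auto simp: Psi_car lin_Psi)

lemma ideal_Psi_kernel: "ideal (Psi_kernel s p q) (free_alg (tgw_gens (p + q)))"
proof -
  interpret W: free_ideal "W_gens (p + q)" "W_ideal s p q" by (rule free_ideal_W)
  show ?thesis unfolding Psi_kernel_def
    by (rule ideal_freeI) (auto simp: car_zero Psi_zero W.zero car_fadd car_fmul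
        Psi_fadd[of _ "tgw_gens (p + q)"] W.add Psi_fmul[of _ "p + q"] W.mult_left W.mult_right Psi_car)
qed

lemma C_ideal_Psi_kernel: "C_ideal s p q \<subseteq> (Psi_kernel s p q :: (gen list \<Rightarrow> 'k::field_char_0) set)"
  unfolding C_ideal_def tgw_free_def
proof (rule ring.genideal_minimal[OF ring_free_alg ideal_Psi_kernel])
  show "C_rels s p q \<subseteq> (Psi_kernel s p q :: (gen list \<Rightarrow> 'k) set)"
  proof
    fix r :: "gen list \<Rightarrow> 'k" assume r: "r \<in> C_rels s p q"
    moreover have "r \<in> car (tgw_gens (p + q))" using C_rels_car r by blast
    ultimately show "r \<in> Psi_kernel s p q" using C_rels_Psi unfolding Psi_kernel_iff by blast
  qed
qed

section \<open>Faithfulness on the base ring\<close>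

definition R_ideal :: "bool \<Rightarrow> nat \<Rightarrow> nat \<Rightarrow> (gen list \<Rightarrow> 'k::field) set" where
  "R_ideal s p q = genideal (R_free p q) (R_rels s p q)"

lemma free_ideal_R: "free_ideal (R_gens (p + q)) (R_ideal s p q)"
  unfolding R_ideal_def R_free_def
  by (rule free_ideal.intro[OF ring.genideal_ideal[OF ring_free_alg R_rels_car]])

lemma R_rels_R_ideal: "R_rels s p q \<subseteq> R_ideal s p q"
  unfolding R_ideal_def R_free_def
  by (rule ring.genideal_self[OF ring_free_alg R_rels_car])

text \<open>The two ideals live in different free algebras. The trace of \<open>C_ideal\<close> on
  the smaller one is an ideal containing the relations of \<open>R\<close>, so minimality applies
  there.\<close>

lemma R_ideal_C_ideal: "R_ideal s p q \<subseteq> C_ideal s p q"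
proof -
  interpret C: free_ideal "tgw_gens (p + q)" "C_ideal s p q" by (rule free_ideal_C)
  let ?J = "C_ideal s p q \<inter> car (R_gens (p + q))"
  have "ideal ?J (free_alg (R_gens (p + q)))"
    by (rule ideal_freeI)
      (auto simp: C.zero car_zero C.add car_fadd car_fmul intro: C.mult_left C.mult_right car_R_tgw)
  moreover have "R_rels s p q \<subseteq> ?J"
    using C_rels_C_ideal[of s p q] R_rels_car[of s p q] by (auto simp: C_rels_def)
  ultimately have "R_ideal s p q \<subseteq> ?J" unfolding R_ideal_def R_free_def
    by (rule ring.genideal_minimal[OF ring_free_alg])
  then show ?thesis by blast
qed

abbreviation uval :: "bool \<Rightarrow> nat \<Rightarrow> (nat \<Rightarrow> int) \<Rightarrow> gen list \<Rightarrow> 'k::field" where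
  "uval s p M \<equiv> (\<lambda>w. wcoef s p (psiw w) M)"

lemma deg_R_word: "set w \<subseteq> R_gens n \<Longrightarrow> deg (psiw w) = (\<lambda>j. 0)"
  by (induction w) (auto simp: R_gens_def fun_eq_iff)

text \<open>Words in the \<open>U i\<close> have degree zero, so the state stays fixed and
  evaluation at it is a character.\<close>

lemma uval_fmul:
  fixes f g :: "gen list \<Rightarrow> 'k::field"
  assumes f: "f \<in> car (R_gens n)" and g: "g \<in> car (R_gens n)"
  shows "lin (uval s p M) (fmul f g) = lin (uval s p M) f * lin (uval s p M) g"
proof -
  have "lin (uval s p M) (fmul f g) = lin (\<lambda>v. lin (\<lambda>u. uval s p M (u @ v)) f) g"
    by (rule lin_fmul[OF f g])
  also have "\<dots> = lin (\<lambda>v. lin (uval s p M) f * uval s p M v) g"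
  proof (rule lin_cong)
    fix v assume "g v \<noteq> 0"
    then have "deg (psiw v) = (\<lambda>j. 0)" using g deg_R_word by (auto simp: mem_car)
    then have "(\<lambda>u. uval s p M (u @ v)) = (\<lambda>u. uval s p M v * uval s p M u :: 'k)"
      by (simp add: wcoef_append mult.commute)
    then have "lin (\<lambda>u. uval s p M (u @ v)) f = uval s p M v * lin (uval s p M) f"
      by (simp only: lin_scale)
    then show "lin (\<lambda>u. uval s p M (u @ v)) f = lin (uval s p M) f * uval s p M v"
      by (simp only: mult.commute)
  qed
  finally show ?thesis by (simp add: lin_scale)
qed

lemma uval_R_ideal:
  fixes f :: "gen list \<Rightarrow> 'k::field_char_0"
  assumes f: "f \<in> R_ideal s p q" and M: "valid s p q M"
  shows "lin (uval s p M) f = 0"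
proof -
  have "f \<in> C_ideal s p q" using f R_ideal_C_ideal by blast
  then have "f \<in> Psi_kernel s p q" using C_ideal_Psi_kernel by blast
  then have "lin (\<lambda>w. mcoef s p M M (psiw w)) f = 0" using M unfolding Psi_kernel_iff by blast
  moreover have "lin (\<lambda>w. mcoef s p M M (psiw w)) f = lin (uval s p M) f"
  proof (rule lin_cong)
    fix w assume "f w \<noteq> 0"
    then have "set w \<subseteq> R_gens (p + q)"
      using free_ideal.in_car[OF free_ideal_R f] by (auto simp: mem_car)
    then show "mcoef s p M M (psiw w) = uval s p M w" by (simp add: mcoef_def deg_R_word)
  qed
  ultimately show ?thesis by simp
qed

text \<open>Since \<open>\<tau>\<^sub>i(u\<^sub>i) = X\<^sub>i Y\<^sub>i\<close> has eigenvalue \<open>m\<^sub>i\<close> on the state \<open>m\<close>, these products act as falling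
  factorials; they are triangular with respect to the states.\<close>

primrec falling :: "bool \<Rightarrow> nat \<Rightarrow> nat list \<Rightarrow> gen list \<Rightarrow> 'k::field" where
  "falling s p [] = mon []"
| "falling s p (i # l) =
    fmul (fsub (tau s p i i) (fsmul (of_nat (count (mset l) i)) (mon []))) (falling s p l)"

lemma falling_car: "set l \<subseteq> {1..n} \<Longrightarrow> falling s p l \<in> car (R_gens n)"
proof (induction l)
  case (Cons i l)
  then have "tau s p i i \<in> car (R_gens n)" using tau_car(1)[of i n i s p] by simp
  then show ?case using Cons by (auto intro!: car_fmul car_fsub car_fsmul simp: car_mon)
qed (simp add: car_mon)

lemma falling_eigenvalue:
  assumes "valid s p q M" "set l \<subseteq> {1..p + q}" and that: "i \<in> {1..p + q}"
  shows "lin (uval s p M) (falling s p (i # l)) =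
      (of_int (M i) - of_nat (count (mset l) i)) * (lin (uval s p M) (falling s p l) :: 'k::field)"
proof -
  have t: "tau s p i i \<in> (car (R_gens (p + q)) :: (gen list \<Rightarrow> 'k) set)" using tau_car(1) that by blast
  have "lin (uval s p M) (tau s p i i) = lam s p i i * (ucoef s p i M - 1 :: 'k)"
    by (simp add: tau_diag lin_calc del: wcoef.simps) simp
  also have "\<dots> = of_int (M i)"
  proof -
    have "i \<ge> 1" using that by simp
    \<comment> \<open>For \<lambda>_ii = -1 the eigenvalue records only the parity of
      \<open>M i\<close>; validity identifies it with \<open>M i\<close> itself.\<close>
    moreover have "M i = 0 \<or> M i = 1" if "fer s p i"
    proof -
      have "0 \<le> M i" "M i \<le> 1" using assms(1) that unfolding valid_def by auto
      then show ?thesis by linarith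
    qed
    ultimately show ?thesis unfolding wcoef_diag(1)[OF \<open>i \<ge> 1\<close>] by (auto simp: lam_diag)
  qed
  finally have v: "lin (uval s p M) (tau s p i i) = (of_int (M i) :: 'k)" .
  have "fsub (tau s p i i) (fsmul (of_nat (count (mset l) i)) (mon [])) \<in> (car (R_gens (p + q)) :: (gen list \<Rightarrow> 'k) set)"
    using t by (intro car_fsub car_fsmul) (simp_all add: car_mon)
  then have "lin (uval s p M) (falling s p (i # l)) =
      lin (uval s p M) (fsub (tau s p i i) (fsmul (of_nat (count (mset l) i)) (mon []))) *
      (lin (uval s p M) (falling s p l) :: 'k)"
    unfolding falling.simps using falling_car[OF assms(2)] by (rule uval_fmul)
  also have "lin (uval s p M) (fsub (tau s p i i) (fsmul (of_nat (count (mset l) i)) (mon []))) =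
      (of_int (M i) - of_nat (count (mset l) i) :: 'k)"
    using t v by (simp add: lin_fsub[of _ "R_gens (p + q)"] car_fsmul car_mon lin_fsmul lin_mon)
  finally show ?thesis .
qed

text \<open>A new factor for \<open>i\<close> is the multiplicity of \<open>i\<close> in
  \<open>A\<close> minus that in \<open>l\<close>. It vanishes at the moment the copies run out, and
  longer products keep this zero factor.\<close>

lemma falling_nonzero_iff:
  assumes "admissible s p q A" "set l \<subseteq> {1..p + q}"
  shows "lin (uval s p (state A)) (falling s p l) \<noteq> (0 :: 'k::field_char_0) \<longleftrightarrow> mset l \<subseteq># A"
  using assms(2)
proof (induction l)
  case Nil show ?case by (simp add: lin_mon)
next
  case (Cons i l)
  have "valid s p q (state A)" using assms(1) by (simp add: valid_state)
  then have "lin (uval s p (state A)) (falling s p (i # l)) =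
      (of_int (int (count A i)) - of_nat (count (mset l) i)) * (lin (uval s p (state A)) (falling s p l) :: 'k)"
    using Cons.prems by (intro falling_eigenvalue) auto
  then have "lin (uval s p (state A)) (falling s p (i # l)) \<noteq> (0 :: 'k) \<longleftrightarrow>
      count A i \<noteq> count (mset l) i \<and> mset l \<subseteq># A"
    using Cons.IH Cons.prems by (simp del: falling.simps)
  also have "\<dots> \<longleftrightarrow> mset (i # l) \<subseteq># A"
  proof
    assume *: "count A i \<noteq> count (mset l) i \<and> mset l \<subseteq># A"
    show "mset (i # l) \<subseteq># A" unfolding subseteq_mset_def
    proof
      fix j show "count (mset (i # l)) j \<le> count A j"
        using * mset_subset_eq_count[of "mset l" A j] by (cases "j = i") auto
    qed
  next
    assume *: "mset (i # l) \<subseteq># A"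
    have "mset l \<subseteq># mset (i # l)" by simp
    then have "mset l \<subseteq># A" using * by (rule subset_mset.order_trans)
    moreover have "count (mset (i # l)) i \<le> count A i" using * by (rule mset_subset_eq_count)
    ultimately show "count A i \<noteq> count (mset l) i \<and> mset l \<subseteq># A" by auto
  qed
  finally show ?case .
qed

lemma falling_span:
  assumes "set w \<subseteq> R_gens (p + q)"
  shows "mon w \<in> lspan (R_ideal s p q :: (gen list \<Rightarrow> 'k::field) set) (falling s p ` {l. set l \<subseteq> {1..p + q}})"
    (is "_ \<in> lspan ?I ?S")
  using assms
proof (induction w)
  interpret free_ideal "R_gens (p + q)" ?I by (rule free_ideal_R)
  {
    case Nil
    have "falling s p [] \<in> lspan ?I ?S" by (intro lspan_incl imageI) simp
    then show ?case by simp
  next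
    case (Cons g w)
    then obtain i where g: "g = U i" "i \<in> {1..p + q}" by (auto simp: R_gens_def)
    have "fmul (mon [U i]) (mon w) \<in> lspan ?I ?S"
    proof (rule lspan_mult_left)
      show "mon w \<in> lspan ?I ?S" using Cons by simp
      show "mon [U i] \<in> car (R_gens (p + q))" using g by (simp add: car_mon)
      fix f assume "f \<in> ?S"
      then obtain l where l: "f = falling s p l" "set l \<subseteq> {1..p + q}" by auto
      \<comment> \<open>Since \<lambda>_ii squares to 1, u_i = \<lambda>_ii \<tau>_i(u_i) + 1;
        subtracting and restoring the multiplicity produces the next falling factor.\<close>
      have "fmul (mon [U i]) f = fadd (fsmul (lam s p i i) (falling s p (i # l)))
        (fsmul (lam s p i i * of_nat (count (mset l) i) + 1) (falling s p l))"
        unfolding l falling.simps tau_diag fmul_linear fmul_mon_Nil_left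
        by (auto simp: fun_eq_iff fadd_def fsub_def fsmul_def algebra_simps lam_square')
      moreover have "falling s p (i # l) \<in> lspan ?I ?S" "falling s p l \<in> lspan ?I ?S"
        using l g by (auto intro!: lspan_incl simp del: falling.simps)
      ultimately show "fmul (mon [U i]) f \<in> lspan ?I ?S"
        using lspan_add lspan_smul by metis
    qed
    then show ?case by (simp add: g fmul_mon_mon)
  }
qed

text \<open>The constant in a factor counts only copies of its own index, so exchanging neighbours
  with different indices alters no constant.\<close>

lemma falling_sort:
  assumes "set l \<subseteq> {1..p + q}"
  shows "fsub (falling s p l) (falling s p (sort l)) \<in> (R_ideal s p q :: (gen list \<Rightarrow> 'k::field) set)"
proof -
  interpret free_ideal "R_gens (p + q)" "R_ideal s p q :: (gen list \<Rightarrow> 'k) set" by (rule free_ideal_R)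
  define R where "R l l' \<longleftrightarrow> mset l = mset l' \<and> (set l \<subseteq> {1..p + q} \<longrightarrow>
    fsub (falling s p l) (falling s p l') \<in> (R_ideal s p q :: (gen list \<Rightarrow> 'k) set))" for l l'
  have "R l (sort l)"
  proof (rule sort_relI)
    fix l show "R l l" by (simp add: R_def cong_refl)
  next
    fix a b c assume R: "R a b" "R b c"
    then have "set b = set a" by (metis R_def mset_eq_setD)
    then show "R a c" using R cong_trans unfolding R_def by auto
  next
    fix x l l' assume R: "R l l'"
    then have m: "mset l = mset l'" by (simp add: R_def)
    have "fsub (falling s p (x # l)) (falling s p (x # l')) \<in> (R_ideal s p q :: (gen list \<Rightarrow> 'k) set)"
      if l: "set (x # l) \<subseteq> {1..p + q}"
    proof -
      let ?t = "fsub (tau s p x x) (fsmul (of_nat (count (mset l) x)) (mon [])) :: gen list \<Rightarrow> 'k"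
      have "?t \<in> car (R_gens (p + q))"
        using l tau_car(1)[of x "p + q" x s p] by (intro car_fsub car_fsmul) (auto simp: car_mon)
      moreover have "fsub (falling s p l) (falling s p l') \<in> (R_ideal s p q :: (gen list \<Rightarrow> 'k) set)"
        using R l by (simp add: R_def)
      ultimately have "fmul ?t (fsub (falling s p l) (falling s p l')) \<in> R_ideal s p q"
        by (intro mult_left)
      then show ?thesis by (simp add: m fmul_fsub_right)
    qed
    then show "R (x # l) (x # l')" using m by (simp add: R_def del: falling.simps)
  next
    fix x y l
    have "fsub (falling s p (x # y # l)) (falling s p (y # x # l)) \<in> (R_ideal s p q :: (gen list \<Rightarrow> 'k) set)"
      if l: "set (x # y # l) \<subseteq> {1..p + q}"
    proof (cases "x = y")
      case True then show ?thesis using cong_refl by simp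
    next
      case False
      let ?r = "fsub (mon [U x, U y]) (mon [U y, U x]) :: gen list \<Rightarrow> 'k"
      have "?r \<in> R_rels s p q"
        unfolding R_rels_def fa_gen_mon fmul_mon_mon append_Cons append_Nil using l by auto
      then have r: "?r \<in> R_ideal s p q" using R_rels_R_ideal by blast
      have fl: "falling s p l \<in> (car (R_gens (p + q)) :: (gen list \<Rightarrow> 'k) set)" using l by (intro falling_car) auto
      \<comment> \<open>Both constants drop out of the commutator, leaving \<lambda>_xx \<lambda>_yy
        times u_x u_y - u_y u_x.\<close>
      have "fsub (falling s p (x # y # l)) (falling s p (y # x # l))
        = fmul (fsmul (lam s p x x * lam s p y y) ?r) (falling s p l)"
        using False
        unfolding falling.simps tau_diag fmul_assoc[symmetric] fmul_fsub_left[symmetric]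
        by (intro arg_cong[where f = "\<lambda>f. fmul f _"])
          (simp add: fmul_linear fmul_mon_mon, simp add: fun_eq_iff fadd_def fsub_def fsmul_def algebra_simps)
      then show ?thesis using mult_right[OF smul[OF r] fl] by metis
    qed
    then show "R (x # y # l) (y # x # l)" by (simp add: R_def del: falling.simps)
  qed
  then show ?thesis using assms by (simp add: R_def)
qed

lemma falling_repeated:
  assumes "set l \<subseteq> {1..p + q}" "fer s p i" "\<not> count (mset l) i \<le> 1"
  shows "falling s p l \<in> (R_ideal s p q :: (gen list \<Rightarrow> 'k::field_char_0) set)"
proof -
  interpret free_ideal "R_gens (p + q)" "R_ideal s p q :: (gen list \<Rightarrow> 'k) set" by (rule free_ideal_R)
  obtain l' where "mset l = mset (i # i # l')" using repeated_split assms(3) by metis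
  \<comment> \<open>The two copies go to the end, not to the front: the constants count letters
    further right, so there they are 1 and 0.\<close>
  then have l': "mset l = mset (l' @ [i, i])" by simp
  then have sl': "set (l' @ [i, i]) \<subseteq> {1..p + q}" using assms(1) mset_eq_setD by metis
  have sort: "sort l = sort (l' @ [i, i])" using l' by (metis sorted_list_of_multiset_mset)
  have "falling s p (l' @ [i, i]) \<in> (R_ideal s p q :: (gen list \<Rightarrow> 'k) set)"
    using sl'
  proof (induction l')
    case Nil
    let ?r = "fsub (mon [U i, U i]) (mon [U i]) :: gen list \<Rightarrow> 'k"
    have "?r \<in> R_rels s p q"
      unfolding R_rels_def fa_gen_mon fmul_mon_mon append_Cons append_Nil lam_diag_iff
      using Nil assms(2) by auto
    \<comment> \<open>With \<lambda>_ii = -1 the product is (\<tau>_i(u_i) - 1) \<tau>_i(u_i) =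
      (-u_i)(1 - u_i), which is u_i^2 - u_i.\<close>
    moreover have "falling s p ([] @ [i, i]) = ?r"
      using assms(2) by (simp add: tau_diag lam_diag fmul_linear fmul_mon_mon)
        (simp add: fun_eq_iff fadd_def fsub_def fsmul_def algebra_simps)
    ultimately show ?case using R_rels_R_ideal by auto
  next
    case (Cons x l')
    have "fsub (tau s p x x) (fsmul c (mon [])) \<in> (car (R_gens (p + q)) :: (gen list \<Rightarrow> 'k) set)" for c
      using Cons.prems tau_car(1)[of x "p + q" x s p] by (intro car_fsub car_fsmul) (auto simp: car_mon)
    then show ?case using Cons mult_left by simp
  qed
  then have "falling s p (sort l) \<in> (R_ideal s p q :: (gen list \<Rightarrow> 'k) set)"
    unfolding sort using cong_mem[OF cong_sym[OF falling_sort[OF sl']]] by blast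
  then show ?thesis using cong_mem[OF falling_sort[OF assms(1)]] by blast
qed

text \<open>The sorted falling products are a Newton basis for functions on the states: evaluation
  is triangular on them with respect to inclusion of multisets.\<close>

theorem R_faithful:
  fixes f :: "gen list \<Rightarrow> 'k::field_char_0"
  assumes f: "f \<in> car (R_gens (p + q))" and 0: "\<And>M. valid s p q M \<Longrightarrow> lin (uval s p M) f = 0"
  shows "f \<in> R_ideal s p q"
proof -
  interpret free_ideal "R_gens (p + q)" "R_ideal s p q :: (gen list \<Rightarrow> 'k) set" by (rule free_ideal_R)
  let ?B = "{A. admissible s p q A}" and ?N = "\<lambda>A. falling s p (sorted_list_of_multiset A) :: gen list \<Rightarrow> 'k"
  have "f \<in> lspan (R_ideal s p q) (?N ` ?B)"
  proof (rule lspan_mon_words[OF free_ideal_R f])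
    fix w assume "set w \<subseteq> R_gens (p + q)"
    from falling_span[OF this] show "mon w \<in> lspan (R_ideal s p q) (?N ` ?B)"
    proof (rule lspan_trans)
      fix f :: "gen list \<Rightarrow> 'k" assume "f \<in> falling s p ` {l. set l \<subseteq> {1..p + q}}"
      then obtain l where l: "f = falling s p l" "set l \<subseteq> {1..p + q}" by auto
      show "f \<in> lspan (R_ideal s p q) (?N ` ?B)"
      proof (cases "admissible s p q (mset l)")
        case True
        then have "?N (mset l) \<in> lspan (R_ideal s p q) (?N ` ?B)" by (intro lspan_incl) blast
        then have "falling s p (sort l) \<in> lspan (R_ideal s p q) (?N ` ?B)" by simp
        then show ?thesis using lspan_cong[OF falling_sort[OF l(2)]] l(1) by simp
      next
        case False
        then obtain i where "fer s p i" "\<not> count (mset l) i \<le> 1" using l by (auto simp: admissible_def)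
        then show ?thesis using falling_repeated l lspan_base by blast
      qed
    qed
  qed
  then obtain F c where F: "finite F" "F \<subseteq> ?B" and fF: "fsub f (\<lambda>w. \<Sum>b\<in>F. c b * ?N b w) \<in> R_ideal s p q"
    by (rule lspan_combination)
  let ?g = "\<lambda>w. \<Sum>b\<in>F. c b * ?N b w"
  have g: "?g \<in> car (R_gens (p + q)) \<and> lin L ?g = (\<Sum>b\<in>F. c b * lin L (?N b))" for L
    using F by (intro lin_sum falling_car) (auto simp: admissible_def)
  have "c b0 = 0" if "b0 \<in> F" for b0
  proof (rule triangular_vanish[where e = "\<lambda>A A'. lin (uval s p (state A)) (?N A')" and sz = size])
    fix A assume "A \<in> F"
    then have v: "valid s p q (state A)" using F valid_state by auto
    have "lin (uval s p (state A)) (fsub f ?g) = 0" using uval_R_ideal[OF fF v] .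
    then show "(\<Sum>b\<in>F. c b * lin (uval s p (state A)) (?N b)) = 0"
      using 0[OF v] g[of "uval s p (state A)"] f by (simp add: lin_fsub[of _ "R_gens (p+q)"])
  next
    fix A assume "A \<in> F"
    then have "admissible s p q A" using F by auto
    then show "lin (uval s p (state A)) (?N A) \<noteq> 0"
      by (subst falling_nonzero_iff) (auto simp: admissible_def)
  next
    fix A A0 assume *: "A \<in> F" "A0 \<in> F" "A \<noteq> A0" "lin (uval s p (state A0)) (?N A) \<noteq> 0"
    then have "admissible s p q A" "admissible s p q A0" using F by auto
    then have "A \<subseteq># A0"
      using *(4) falling_nonzero_iff[of s p q A0 "sorted_list_of_multiset A", where ?'k = 'k]
      by (auto simp: admissible_def)
    then show "size A < size A0" using *(3) by (simp add: mset_subset_size subset_mset.le_neq_trans)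
  qed (use F that in auto)
  then have "?g w = 0" for w by simp
  then show ?thesis using fF by (simp add: fsub_def)
qed

text \<open>For words in the \<open>U i\<close> source and target agree, so the diagonal
  coefficients are exactly the characters \<open>uval\<close>.\<close>

corollary R_inter_Psi_kernel:
  fixes f :: "gen list \<Rightarrow> 'k::field_char_0"
  assumes "f \<in> car (R_gens (p + q))" "f \<in> Psi_kernel s p q"
  shows "f \<in> R_ideal s p q"
proof (rule R_faithful[OF assms(1)])
  fix M assume M: "valid s p q M"
  have "lin (\<lambda>w. mcoef s p M M (psiw w)) f = lin (uval s p M) f"
    using assms(1) by (intro lin_cong) (auto simp: mem_car mcoef_def deg_R_word)
  then show "lin (uval s p M) f = 0" using assms(2) M unfolding Psi_kernel_iff by simp
qed

section \<open>The degree-zero component of the TGW construction\<close>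

lemma C_mult_mon:
  assumes "r \<in> C_rels s p q" "set b \<subseteq> tgw_gens (p + q)"
  shows "fmul r (mon b) \<in> C_ideal s p q"
proof -
  interpret free_ideal "tgw_gens (p + q)" "C_ideal s p q" by (rule free_ideal_C)
  have "r \<in> C_ideal s p q" using assms(1) C_rels_C_ideal by blast
  then show ?thesis using assms(2) by (intro mult_right) (simp_all add: car_mon)
qed

text \<open>Right contexts suffice: rewriting happens at the head of a word, and letters further
  left are restored by left multiplication.\<close>

lemma C_exchange:
  fixes s p q
  assumes i: "i \<in> {1..p + q}" and j: "j \<in> {1..p + q}" and b: "set b \<subseteq> tgw_gens (p + q)"
  defines "l \<equiv> lam s p i i :: 'k::field" and "I \<equiv> C_ideal s p q :: (gen list \<Rightarrow> 'k) set"
  shows X_U_diag: "fsub (mon (X i # U i # b)) (fadd (fsmul l (mon (U i # X i # b))) (fsmul (- l) (mon (X i # b)))) \<in> I"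
    and X_U_off: "i \<noteq> j \<Longrightarrow> fsub (mon (X i # U j # b)) (mon (U j # X i # b)) \<in> I"
    and Y_U_diag: "fsub (mon (Y i # U i # b)) (fadd (fsmul l (mon (U i # Y i # b))) (mon (Y i # b))) \<in> I"
    and Y_U_off: "i \<noteq> j \<Longrightarrow> fsub (mon (Y i # U j # b)) (mon (U j # Y i # b)) \<in> I"
    and Y_X_diag: "fsub (mon (Y i # X i # b)) (mon (U i # b)) \<in> I"
    and X_Y_diag: "fsub (mon (X i # Y i # b)) (fadd (fsmul l (mon (U i # b))) (fsmul (- l) (mon b))) \<in> I"
    and X_Y_off: "i \<noteq> j \<Longrightarrow> fsub (mon (X i # Y j # b)) (fsmul (lam s p i j) (mon (Y j # X i # b))) \<in> I"
proof -
  have "fsub (fmul (fa_gen (X i)) (fa_gen (U i))) (fmul (tau s p i i) (fa_gen (X i))) \<in> (C_rels s p q :: (gen list \<Rightarrow> 'k) set)"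
    using i unfolding C_rels_def by blast
  from C_mult_mon[OF this b]
  show "fsub (mon (X i # U i # b)) (fadd (fsmul l (mon (U i # X i # b))) (fsmul (- l) (mon (X i # b)))) \<in> I"
    unfolding I_def l_def tau_diag fa_gen_mon fmul_linear fmul_mon_mon append_Cons append_Nil
    by (auto simp: fadd_def fsub_def fsmul_def algebra_simps)
  have "fsub (fmul (fa_gen (X i)) (fa_gen (U j))) (fmul (tau s p i j) (fa_gen (X i))) \<in> (C_rels s p q :: (gen list \<Rightarrow> 'k) set)"
    using i j unfolding C_rels_def by blast
  from C_mult_mon[OF this b]
  show "fsub (mon (X i # U j # b)) (mon (U j # X i # b)) \<in> I" if "i \<noteq> j"
    using that unfolding I_def tau_off[OF that] fa_gen_mon fmul_linear fmul_mon_mon append_Cons append_Nil by simp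
  have "fsub (fmul (fa_gen (Y i)) (fa_gen (U i))) (fmul (tau_inv s p i i) (fa_gen (Y i))) \<in> (C_rels s p q :: (gen list \<Rightarrow> 'k) set)"
    using i unfolding C_rels_def by blast
  from C_mult_mon[OF this b]
  show "fsub (mon (Y i # U i # b)) (fadd (fsmul l (mon (U i # Y i # b))) (mon (Y i # b))) \<in> I"
    unfolding I_def l_def tau_inv_diag fa_gen_mon fmul_linear fmul_mon_mon append_Cons append_Nil by simp
  have "fsub (fmul (fa_gen (Y i)) (fa_gen (U j))) (fmul (tau_inv s p i j) (fa_gen (Y i))) \<in> (C_rels s p q :: (gen list \<Rightarrow> 'k) set)"
    using i j unfolding C_rels_def by blast
  from C_mult_mon[OF this b]
  show "fsub (mon (Y i # U j # b)) (mon (U j # Y i # b)) \<in> I" if "i \<noteq> j"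
    using that unfolding I_def tau_inv_off[OF that] fa_gen_mon fmul_linear fmul_mon_mon append_Cons append_Nil by simp
  have "fsub (fmul (fa_gen (Y i)) (fa_gen (X i))) (fa_gen (U i)) \<in> (C_rels s p q :: (gen list \<Rightarrow> 'k) set)"
    using i unfolding C_rels_def by blast
  from C_mult_mon[OF this b] show "fsub (mon (Y i # X i # b)) (mon (U i # b)) \<in> I"
    unfolding I_def fa_gen_mon fmul_linear fmul_mon_mon append_Cons append_Nil by simp
  have "fsub (fmul (fa_gen (X i)) (fa_gen (Y i))) (tau s p i i) \<in> (C_rels s p q :: (gen list \<Rightarrow> 'k) set)"
    using i unfolding C_rels_def by blast
  from C_mult_mon[OF this b]
  show "fsub (mon (X i # Y i # b)) (fadd (fsmul l (mon (U i # b))) (fsmul (- l) (mon b))) \<in> I"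
    unfolding I_def l_def tau_diag fa_gen_mon fmul_linear fmul_mon_mon append_Cons append_Nil
    by (auto simp: fadd_def fsub_def fsmul_def algebra_simps)
  show "fsub (mon (X i # Y j # b)) (fsmul (lam s p i j) (mon (Y j # X i # b))) \<in> I" if "i \<noteq> j"
  proof -
    have "fsub (fmul (fa_gen (X i)) (fa_gen (Y j)))
           (fsmul (lam s p i j) (fmul (fa_gen (Y j)) (fa_gen (X i)))) \<in> (C_rels s p q :: (gen list \<Rightarrow> 'k) set)"
      using i j that unfolding C_rels_def by blast
    from C_mult_mon[OF this b] show ?thesis
      unfolding I_def fa_gen_mon fmul_linear fmul_mon_mon append_Cons append_Nil by simp
  qed
qed

section \<open>Left multiples of words by the base ring\<close>

definition U_module :: "nat \<Rightarrow> gen list set \<Rightarrow> (gen list \<Rightarrow> 'k::field) set" where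
  "U_module n Z = {mon (u @ z) | u z. set u \<subseteq> R_gens n \<and> z \<in> Z}"

lemma U_moduleI: "set u \<subseteq> R_gens n \<Longrightarrow> z \<in> Z \<Longrightarrow> mon (u @ z) \<in> U_module n Z"
  by (auto simp: U_module_def)

lemma U_moduleI': "z \<in> Z \<Longrightarrow> mon z \<in> U_module n Z"
  using U_moduleI[of "[]" n z Z] by simp

lemma U_module_left:
  assumes "f \<in> lspan (C_ideal s p q) (U_module (p + q) Z)" "set u \<subseteq> R_gens (p + q)"
  shows "fmul (mon u) f \<in> lspan (C_ideal s p q) (U_module (p + q) Z)"
proof -
  interpret free_ideal "tgw_gens (p + q)" "C_ideal s p q" by (rule free_ideal_C)
  show ?thesis using assms(1)
  proof (rule lspan_mult_left)
    show "mon u \<in> car (tgw_gens (p + q))" using assms(2) R_gens_tgw_gens by (auto simp: car_mon)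
    fix f :: "gen list \<Rightarrow> 'a" assume "f \<in> U_module (p + q) Z"
    then obtain v z where "f = mon (v @ z)" "set v \<subseteq> R_gens (p + q)" "z \<in> Z" by (auto simp: U_module_def)
    then show "fmul (mon u) f \<in> lspan (C_ideal s p q) (U_module (p + q) Z)"
      using lspan_incl[OF U_moduleI[of "u @ v" "p + q" z Z]] assms(2) by (simp add: fmul_mon_mon)
  qed
qed

text \<open>Moving \<open>X i\<close> or \<open>Y i\<close> through \<open>R\<close> twists
  coefficients by \<tau>_i or its inverse. Each generator it passes becomes an affine expression in
  that generator, so the coefficients stay in \<open>R\<close>.\<close>

lemma push_letter:
  assumes "g \<in> tgw_gens (p + q) - R_gens (p + q)" "set u \<subseteq> R_gens (p + q)" "set w \<subseteq> tgw_gens (p + q)"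
  shows "mon (g # u @ w) \<in> lspan (C_ideal s p q :: (gen list \<Rightarrow> 'k::field) set) (U_module (p + q) {g # w})"
    (is "_ \<in> lspan ?I ?S")
  using assms(2)
proof (induction u)
  interpret free_ideal "tgw_gens (p + q)" ?I by (rule free_ideal_C)
  {
    case Nil show ?case by (simp add: lspan_incl U_moduleI')
  next
    case (Cons h u)
    then obtain j where j: "h = U j" "j \<in> {1..p + q}" by (auto simp: R_gens_def)
    have IH: "mon (g # u @ w) \<in> lspan ?I ?S" using Cons by simp
    have uw: "set (u @ w) \<subseteq> tgw_gens (p + q)" using Cons.prems assms(3) R_gens_tgw_gens by auto
    have UIH: "mon (U j # g # u @ w) \<in> lspan ?I ?S"
      using U_module_left[OF IH, of "[U j]"] j by (simp add: fmul_mon_mon)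
    show ?case
    proof (cases g)
      case (U i) then show ?thesis using assms(1) by (auto simp: R_gens_def)
    next
      case (X i)
      then have i: "i \<in> {1..p + q}" using assms(1) by simp
      show ?thesis
      proof (cases "i = j")
        case True
        have "fadd (fsmul (lam s p i i) (mon (U j # g # u @ w))) (fsmul (- lam s p i i) (mon (g # u @ w)))
          \<in> lspan ?I ?S" by (intro lspan_add lspan_smul IH UIH)
        then show ?thesis using lspan_cong[OF X_U_diag[OF i i uw, of s]] True X j by simp
      next
        case False
        then show ?thesis using lspan_cong[OF X_U_off[OF i j(2) uw, of s]] UIH X j by simp
      qed
    next
      case (Y i)
      then have i: "i \<in> {1..p + q}" using assms(1) by simp
      show ?thesis
      proof (cases "i = j")
        case True
        have "fadd (fsmul (lam s p i i) (mon (U j # g # u @ w))) (mon (g # u @ w))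
          \<in> lspan ?I ?S" by (intro lspan_add lspan_smul IH UIH)
        then show ?thesis using lspan_cong[OF Y_U_diag[OF i i uw, of s]] True Y j by simp
      next
        case False
        then show ?thesis using lspan_cong[OF Y_U_off[OF i j(2) uw, of s]] UIH Y j by simp
      qed
    qed
  }
qed

text \<open>By \<open>push_letter\<close> a letter gets past the coefficients, so its effect need
  only be known on the generators \<open>Z\<close>.\<close>

lemma U_module_letter:
  assumes f: "f \<in> lspan (C_ideal s p q) (U_module (p + q) Z)"
    and g: "g \<in> tgw_gens (p + q) - R_gens (p + q)"
    and Z: "\<And>z. z \<in> Z \<Longrightarrow> set z \<subseteq> tgw_gens (p + q)"
    and gZ: "\<And>z. z \<in> Z \<Longrightarrow>
      mon (g # z) \<in> lspan (C_ideal s p q :: (gen list \<Rightarrow> 'k::field) set) (U_module (p + q) Z')"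
  shows "fmul (mon [g]) f \<in> lspan (C_ideal s p q :: (gen list \<Rightarrow> 'k) set) (U_module (p + q) Z')"
proof -
  interpret free_ideal "tgw_gens (p + q)" "C_ideal s p q :: (gen list \<Rightarrow> 'k) set" by (rule free_ideal_C)
  show ?thesis using f
  proof (rule lspan_mult_left)
    show "mon [g] \<in> car (tgw_gens (p + q))" using g by (simp add: car_mon)
    fix f :: "gen list \<Rightarrow> 'k" assume "f \<in> U_module (p + q) Z"
    then obtain u z where f: "f = mon (u @ z)" "set u \<subseteq> R_gens (p + q)" "z \<in> Z" by (auto simp: U_module_def)
    have "(mon (g # u @ z) :: gen list \<Rightarrow> 'k) \<in> lspan (C_ideal s p q) (U_module (p + q) {g # z})"
      using g f Z by (intro push_letter) auto
    then have "(mon (g # u @ z) :: gen list \<Rightarrow> 'k) \<in> lspan (C_ideal s p q) (U_module (p + q) Z')"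
    proof (rule lspan_trans)
      fix h :: "gen list \<Rightarrow> 'k" assume "h \<in> U_module (p + q) {g # z}"
      then obtain v where "h = mon (v @ g # z)" "set v \<subseteq> R_gens (p + q)" by (auto simp: U_module_def)
      then show "h \<in> lspan (C_ideal s p q) (U_module (p + q) Z')"
        using U_module_left[OF gZ[OF f(3)], of v] by (simp add: fmul_mon_mon)
    qed
    then show "fmul (mon [g]) f \<in> lspan (C_ideal s p q) (U_module (p + q) Z')"
      by (simp add: f fmul_mon_mon)
  qed
qed

lemma push_word:
  assumes "set z \<subseteq> tgw_gens (p + q) - R_gens (p + q)" "set u \<subseteq> R_gens (p + q)" "set w \<subseteq> tgw_gens (p + q)"
  shows "mon (z @ u @ w) \<in> lspan (C_ideal s p q :: (gen list \<Rightarrow> 'k::field) set) (U_module (p + q) {z @ w})"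
  using assms(1)
proof (induction z)
  interpret free_ideal "tgw_gens (p + q)" "C_ideal s p q :: (gen list \<Rightarrow> 'k) set" by (rule free_ideal_C)
  {
    case Nil show ?case using assms(2) by (simp add: lspan_incl U_moduleI)
  next
    case (Cons g z)
    have "fmul (mon [g]) (mon (z @ u @ w)) \<in> lspan (C_ideal s p q :: (gen list \<Rightarrow> 'k) set) (U_module (p + q) {(g # z) @ w})"
    proof (rule U_module_letter[where Z = "{z @ w}"])
      show "mon (z @ u @ w) \<in> lspan (C_ideal s p q :: (gen list \<Rightarrow> 'k) set) (U_module (p + q) {z @ w})"
        using Cons by simp
    qed (use Cons.prems assms(3) in \<open>auto simp: lspan_incl U_moduleI'\<close>)
    then show ?case by (simp add: fmul_mon_mon)
  }
qed

text \<open>The degree is recorded because it forces the two blocks to use the same letters in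
  degree zero.\<close>

definition YX_words :: "nat \<Rightarrow> (nat \<Rightarrow> int) \<Rightarrow> gen list set" where
  "YX_words n d = {map Y b @ map X a | a b. set a \<subseteq> {1..n} \<and> set b \<subseteq> {1..n} \<and>
    wdeg (map Y b @ map X a) = d}"

lemma wdeg_simps:
  "wdeg [] = (\<lambda>j. 0)"
  "wdeg (X i # w) = (\<lambda>j. wdeg w j + (if j = i then 1 else 0))"
  "wdeg (Y i # w) = (\<lambda>j. wdeg w j - (if j = i then 1 else 0))"
  "wdeg (U i # w) = wdeg w"
  by (auto simp: wdeg_def fun_eq_iff)

lemma YX_words_gens: "z \<in> YX_words n d \<Longrightarrow> set z \<subseteq> tgw_gens n"
  by (auto simp: YX_words_def subset_iff)

lemma YX_wordsI:
  "set a \<subseteq> {1..n} \<Longrightarrow> set b \<subseteq> {1..n} \<Longrightarrow> wdeg (map Y b @ map X a) = d \<Longrightarrow>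
    map Y b @ map X a \<in> YX_words n d"
  unfolding YX_words_def by blast

lemma YX_words_Y:
  assumes "z \<in> YX_words n d" "i \<in> {1..n}"
  shows "Y i # z \<in> YX_words n (\<lambda>j. d j - (if j = i then 1 else 0))"
proof -
  obtain a b where z: "z = map Y b @ map X a" "set a \<subseteq> {1..n}" "set b \<subseteq> {1..n}" "wdeg z = d"
    using assms(1) by (auto simp: YX_words_def)
  have "Y i # z = map Y (i # b) @ map X a" using z(1) by simp
  moreover have "wdeg (Y i # z) = (\<lambda>j. d j - (if j = i then 1 else 0))" using z(4) by (simp add: wdeg_simps)
  moreover have "set (i # b) \<subseteq> {1..n}" using z assms(2) by simp
  ultimately show ?thesis using YX_wordsI[OF z(2), of "i # b"] by simp
qed

text \<open>\<open>X i\<close> travels right through the block of \<open>Y\<close>s: it passes other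
  indices up to a scalar, and at the first \<open>Y i\<close> the pair collapses to \<tau>_i(u_i) in
  \<open>R\<close>.\<close>

lemma X_YX_span:
  assumes "i \<in> {1..p + q}" "set a \<subseteq> {1..p + q}" "set b \<subseteq> {1..p + q}"
  shows "mon (X i # map Y b @ map X a) \<in> lspan (C_ideal s p q :: (gen list \<Rightarrow> 'k::field) set)
    (U_module (p + q) (YX_words (p + q) (wdeg (X i # map Y b @ map X a))))"
  using assms(3)
proof (induction b)
  interpret free_ideal "tgw_gens (p + q)" "C_ideal s p q :: (gen list \<Rightarrow> 'k) set" by (rule free_ideal_C)
  {
    case Nil
    have "set (i # a) \<subseteq> {1..p + q}" using assms by simp
    then have "map Y [] @ map X (i # a) \<in> YX_words (p + q) (wdeg (map Y [] @ map X (i # a)))"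
      by (intro YX_wordsI) auto
    then show ?case by (simp add: lspan_incl U_moduleI')
  next
    case (Cons j b)
    let ?w = "map Y b @ map X a" and ?d = "wdeg (X i # map Y (j # b) @ map X a)"
    have w: "set ?w \<subseteq> tgw_gens (p + q)" and j: "j \<in> {1..p + q}" using Cons.prems assms by auto
    show ?case
    proof (cases "i = j")
      case True
      then have d: "?d = wdeg ?w" by (auto simp: wdeg_simps)
      have "set b \<subseteq> {1..p + q}" using Cons.prems by simp
      then have "?w \<in> YX_words (p + q) ?d"
        unfolding d using assms(2) by (intro YX_wordsI) auto
      then have "mon ?w \<in> lspan (C_ideal s p q :: (gen list \<Rightarrow> 'k) set) (U_module (p + q) (YX_words (p + q) ?d))"
        by (simp add: lspan_incl U_moduleI')
      moreover from U_module_left[OF this, of "[U i]"]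
      have "mon (U i # ?w) \<in> lspan (C_ideal s p q :: (gen list \<Rightarrow> 'k) set) (U_module (p + q) (YX_words (p + q) ?d))"
        using assms(1) by (simp add: fmul_mon_mon)
      ultimately have "fadd (fsmul (lam s p i i) (mon (U i # ?w))) (fsmul (- lam s p i i) (mon ?w))
        \<in> lspan (C_ideal s p q :: (gen list \<Rightarrow> 'k) set) (U_module (p + q) (YX_words (p + q) ?d))"
        by (intro lspan_add lspan_smul)
      from lspan_cong[OF X_Y_diag[OF assms(1) assms(1) w] this] True show ?thesis by simp
    next
      case False
      have d: "?d = (\<lambda>k. wdeg (X i # ?w) k - (if k = j then 1 else 0))" by (auto simp: wdeg_simps)
      have "fmul (mon [Y j]) (mon (X i # ?w)) \<in> lspan (C_ideal s p q :: (gen list \<Rightarrow> 'k) set) (U_module (p + q) (YX_words (p + q) ?d))"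
      proof (rule U_module_letter)
        show "mon (X i # ?w) \<in> lspan (C_ideal s p q :: (gen list \<Rightarrow> 'k) set) (U_module (p + q) (YX_words (p + q) (wdeg (X i # ?w))))"
          using Cons by simp
        show "Y j \<in> tgw_gens (p + q) - R_gens (p + q)" using j by simp
        fix z assume z: "z \<in> YX_words (p + q) (wdeg (X i # ?w))"
        then show "set z \<subseteq> tgw_gens (p + q)" by (rule YX_words_gens)
        show "mon (Y j # z) \<in> lspan (C_ideal s p q :: (gen list \<Rightarrow> 'k) set) (U_module (p + q) (YX_words (p + q) ?d))"
          unfolding d using YX_words_Y[OF z j] by (intro lspan_incl U_moduleI')
      qed
      then have "fsmul (lam s p i j) (mon (Y j # X i # ?w)) \<in> lspan (C_ideal s p q :: (gen list \<Rightarrow> 'k) set) (U_module (p + q) (YX_words (p + q) ?d))"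
        by (intro lspan_smul) (simp add: fmul_mon_mon)
      from lspan_cong[OF X_Y_off[OF assms(1) j w False] this] show ?thesis by simp
    qed
  }
qed

lemma YX_span:
  assumes "set w \<subseteq> tgw_gens (p + q)"
  shows "mon w \<in> lspan (C_ideal s p q :: (gen list \<Rightarrow> 'k::field) set) (U_module (p + q) (YX_words (p + q) (wdeg w)))"
  using assms
proof (induction w)
  interpret free_ideal "tgw_gens (p + q)" "C_ideal s p q :: (gen list \<Rightarrow> 'k) set" by (rule free_ideal_C)
  {
    case Nil
    have "map Y [] @ map X [] \<in> YX_words (p + q) (wdeg [])"
      by (intro YX_wordsI) auto
    then show ?case by (simp add: lspan_incl U_moduleI')
  next
    case (Cons g w)
    then have IH: "mon w \<in> lspan (C_ideal s p q :: (gen list \<Rightarrow> 'k) set) (U_module (p + q) (YX_words (p + q) (wdeg w)))" by simp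
    have "fmul (mon [g]) (mon w) \<in> lspan (C_ideal s p q :: (gen list \<Rightarrow> 'k) set) (U_module (p + q) (YX_words (p + q) (wdeg (g # w))))"
    proof (cases g)
      case (U i)
      then show ?thesis using U_module_left[OF IH, of "[U i]"] Cons.prems by (simp add: wdeg_simps)
    next
      case (X i)
      show ?thesis
      proof (rule U_module_letter[OF IH])
        show "g \<in> tgw_gens (p + q) - R_gens (p + q)" using X Cons.prems by simp
        fix z assume z: "z \<in> YX_words (p + q) (wdeg w)"
        then show "set z \<subseteq> tgw_gens (p + q)" by (rule YX_words_gens)
        obtain a b where ab: "z = map Y b @ map X a" "set a \<subseteq> {1..p + q}" "set b \<subseteq> {1..p + q}" "wdeg z = wdeg w"
          using z by (auto simp: YX_words_def)
        have "i \<in> {1..p + q}" using X Cons.prems by simp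
        from X_YX_span[OF this ab(2,3), of s, where ?'k = 'k]
        show "mon (g # z) \<in> lspan (C_ideal s p q :: (gen list \<Rightarrow> 'k) set) (U_module (p + q) (YX_words (p + q) (wdeg (g # w))))"
          using ab(4) by (simp add: X wdeg_simps flip: ab(1))
      qed
    next
      case (Y i)
      show ?thesis
      proof (rule U_module_letter[OF IH])
        show "g \<in> tgw_gens (p + q) - R_gens (p + q)" using Y Cons.prems by simp
        fix z assume z: "z \<in> YX_words (p + q) (wdeg w)"
        then show "set z \<subseteq> tgw_gens (p + q)" by (rule YX_words_gens)
        show "mon (g # z) \<in> lspan (C_ideal s p q :: (gen list \<Rightarrow> 'k) set) (U_module (p + q) (YX_words (p + q) (wdeg (g # w))))"
          using YX_words_Y[OF z, of i] Cons.prems Y by (auto simp: wdeg_simps intro!: lspan_incl U_moduleI')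
      qed
    qed
    then show ?case by (simp add: fmul_mon_mon)
  }
qed

text \<open>The mixed relation is read backwards, which is possible as \<lambda>_ij squares to 1.
  The span of a single word expresses equality up to a scalar that need not be tracked.\<close>

lemma Y_past_X:
  assumes "set a \<subseteq> {1..p + q}" "j \<in> {1..p + q}" "j \<notin> set a" "set w \<subseteq> tgw_gens (p + q)"
  shows "mon (Y j # map X a @ w) \<in> lspan (C_ideal s p q :: (gen list \<Rightarrow> 'k::field) set) {mon (map X a @ Y j # w)}"
  using assms(1,3)
proof (induction a)
  interpret free_ideal "tgw_gens (p + q)" "C_ideal s p q :: (gen list \<Rightarrow> 'k) set" by (rule free_ideal_C)
  {
    case Nil show ?case by (simp add: lspan_incl)
  next
    case (Cons i a)
    let ?w = "map X a @ w"
    have i: "i \<in> {1..p + q}" "i \<noteq> j" and w: "set ?w \<subseteq> tgw_gens (p + q)" using Cons.prems assms(4) by auto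
    have "fmul (mon [X i]) (mon (Y j # ?w)) \<in> lspan (C_ideal s p q :: (gen list \<Rightarrow> 'k) set) {mon (map X (i # a) @ Y j # w)}"
    proof (rule lspan_mult_left)
      show "mon (Y j # ?w) \<in> lspan (C_ideal s p q :: (gen list \<Rightarrow> 'k) set) {mon (map X a @ Y j # w)}"
        using Cons by simp
    qed (use i in \<open>auto simp: car_mon fmul_mon_mon lspan_incl\<close>)
    then have *: "mon (X i # Y j # ?w) \<in> lspan (C_ideal s p q :: (gen list \<Rightarrow> 'k) set) {mon (map X (i # a) @ Y j # w)}"
      by (simp add: fmul_mon_mon)
    have "fsub (mon (Y j # X i # ?w)) (fsmul (lam s p i j) (mon (X i # Y j # ?w))) \<in> (C_ideal s p q :: (gen list \<Rightarrow> 'k) set)"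
      using smul[OF cong_sym[OF X_Y_off[OF i(1) assms(2) w i(2), of s]], of "lam s p i j"]
      by (simp add: fsub_def fsmul_def right_diff_distrib lam_square')
    from lspan_cong[OF this lspan_smul[OF *]] show ?case by simp
  }
qed

text \<open>The last \<open>Y j\<close> is carried to its first partner \<open>X j\<close>; the pair
  becomes u_j, which moves left into the coefficients and leaves shorter balanced blocks.\<close>

lemma balanced_YX_span:
  assumes "mset a = mset b" "set b \<subseteq> {1..p + q}"
  shows "mon (map Y b @ map X a) \<in> lspan (C_ideal s p q :: (gen list \<Rightarrow> 'k::field) set) (U_module (p + q) {[]})"
  using assms
proof (induction b arbitrary: a rule: rev_induct)
  interpret free_ideal "tgw_gens (p + q)" "C_ideal s p q :: (gen list \<Rightarrow> 'k) set" by (rule free_ideal_C)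
  {
    case Nil then show ?case by (simp add: lspan_incl U_moduleI')
  next
    case (snoc j b)
    let ?I = "C_ideal s p q :: (gen list \<Rightarrow> 'k) set"
    have "set a = set (b @ [j])" using snoc.prems(1) mset_eq_setD by blast
    then have "j \<in> set a" and sa: "set a \<subseteq> {1..p + q}" using snoc.prems(2) by auto
    \<comment> \<open>Choosing the first \<open>j\<close> ensures that \<open>Y j\<close> meets only
      letters it passes up to a scalar before its partner.\<close>
    then obtain a1 a2 where a: "a = a1 @ j # a2" "j \<notin> set a1" by (meson split_list_first)
    have j: "j \<in> {1..p + q}" and sb: "set b \<subseteq> {1..p + q}" using snoc.prems(2) by auto
    have sa1: "set a1 \<subseteq> {1..p + q}" and sa2: "set a2 \<subseteq> {1..p + q}" using sa a by auto
    have gens: "set (map Y b) \<subseteq> tgw_gens (p + q)" "set (map X a1) \<subseteq> tgw_gens (p + q)"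
      "set (map X a2) \<subseteq> tgw_gens (p + q)" using sa1 sa2 sb by auto
    have "mon (map Y b @ map X (a1 @ a2)) \<in> lspan ?I (U_module (p + q) {[]})"
      using snoc.prems(1) a sb by (intro snoc.IH) auto
    then have IH: "mon (u @ map Y b @ map X a1 @ map X a2) \<in> lspan ?I (U_module (p + q) {[]})"
      if "set u \<subseteq> R_gens (p + q)" for u
      using U_module_left[of _ s p q "{[]}" u] that by (fastforce simp: fmul_mon_mon)
    have "mon ((map Y b @ map X a1) @ [U j] @ map X a2) \<in> lspan ?I (U_module (p + q) {(map Y b @ map X a1) @ map X a2})"
      using gens j sa1 sa2 sb by (intro push_word) auto
    then have "mon ((map Y b @ map X a1) @ [U j] @ map X a2) \<in> lspan ?I (U_module (p + q) {[]})"
    proof (rule lspan_trans)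
      fix h :: "gen list \<Rightarrow> 'k" assume "h \<in> U_module (p + q) {(map Y b @ map X a1) @ map X a2}"
      then obtain u where "h = mon (u @ map Y b @ map X a1 @ map X a2)" "set u \<subseteq> R_gens (p + q)"
        by (auto simp: U_module_def)
      then show "h \<in> lspan ?I (U_module (p + q) {[]})" using IH by simp
    qed
    then have 1: "mon (map Y b @ map X a1 @ U j # map X a2) \<in> lspan ?I (U_module (p + q) {[]})"
      by simp
    have "fsub (mon (Y j # X j # map X a2)) (mon (U j # map X a2)) \<in> ?I"
      using gens j by (intro Y_X_diag) auto
    then have "fmul (mon (map Y b @ map X a1)) (fsub (mon (Y j # X j # map X a2)) (mon (U j # map X a2))) \<in> ?I"
      by (rule mult_left) (use gens in \<open>simp add: car_mon\<close>)
    then have "fsub (mon (map Y b @ map X a1 @ Y j # X j # map X a2)) (mon (map Y b @ map X a1 @ U j # map X a2)) \<in> ?I"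
      by (simp add: fmul_linear fmul_mon_mon)
    then have 2: "mon (map Y b @ map X a1 @ Y j # X j # map X a2) \<in> lspan ?I (U_module (p + q) {[]})"
      using lspan_cong 1 by blast
    have "mon (Y j # map X a1 @ X j # map X a2) \<in> lspan ?I {mon (map X a1 @ Y j # X j # map X a2)}"
      using sa1 j a(2) gens by (intro Y_past_X) auto
    then have "fmul (mon (map Y b)) (mon (Y j # map X a1 @ X j # map X a2)) \<in> lspan ?I (U_module (p + q) {[]})"
      by (rule lspan_mult_left) (use gens 2 in \<open>auto simp: car_mon fmul_mon_mon\<close>)
    then show ?case by (simp add: a fmul_mon_mon)
  }
qed

lemma degree_zero_span:
  assumes "set w \<subseteq> tgw_gens (p + q)" "wdeg w = (\<lambda>j. 0)"
  shows "mon w \<in> lspan (C_ideal s p q :: (gen list \<Rightarrow> 'k::field) set) (U_module (p + q) {[]})"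
proof -
  interpret free_ideal "tgw_gens (p + q)" "C_ideal s p q :: (gen list \<Rightarrow> 'k) set" by (rule free_ideal_C)
  from YX_span[OF assms(1)] show ?thesis
  proof (rule lspan_trans)
    fix f :: "gen list \<Rightarrow> 'k" assume "f \<in> U_module (p + q) (YX_words (p + q) (wdeg w))"
    then obtain u a b where f: "f = mon (u @ map Y b @ map X a)" "set u \<subseteq> R_gens (p + q)"
      "set b \<subseteq> {1..p + q}" "wdeg (map Y b @ map X a) = (\<lambda>j. 0)"
      unfolding U_module_def YX_words_def assms(2) by blast
    have "wdeg (map Y b @ map X a) = (\<lambda>j. state (mset a) j - state (mset b) j)"
    proof -
      have "wdeg (map X a) = state (mset a)" by (induction a) (auto simp: wdeg_simps fun_eq_iff)
      then show ?thesis by (induction b) (auto simp: wdeg_simps fun_eq_iff)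
    qed
    then have "mset a = mset b" using f(4) by (auto simp: fun_eq_iff multiset_eq_iff)
    then show "f \<in> lspan (C_ideal s p q) (U_module (p + q) {[]})"
      using U_module_left[OF balanced_YX_span[OF _ f(3)] f(2), of a s, where ?'a = 'k] by (simp add: f(1) fmul_mon_mon)
  qed
qed

section \<open>The isomorphism\<close>

text \<open>Serves both quotients, by the relations and by the graded ideal: the map is constant on
  cosets, so \<open>the_elem\<close> picks the common value.\<close>

lemma quotient_hom:
  assumes I: "ideal I R" and h: "h \<in> ring_hom R S" and S: "ring S" and z: "\<And>i. i \<in> I \<Longrightarrow> h i = \<zero>\<^bsub>S\<^esub>"
  shows quotient_hom_value: "x \<in> carrier R \<Longrightarrow> the_elem (h ` (I +>\<^bsub>R\<^esub> x)) = h x"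
    and quotient_hom_ring_hom: "(\<lambda>A. the_elem (h ` A)) \<in> ring_hom (R Quot I) S"
proof -
  interpret ideal I R by fact
  interpret S: ring S by fact
  have val: "the_elem (h ` (I +>\<^bsub>R\<^esub> x)) = h x" if x: "x \<in> carrier R" for x
  proof -
    have "h y = h x" if y: "y \<in> I +>\<^bsub>R\<^esub> x" for y
    proof -
      obtain i where "i \<in> I" "y = i \<oplus>\<^bsub>R\<^esub> x" using y by (auto simp: a_r_coset_def')
      moreover from this have "h (i \<oplus>\<^bsub>R\<^esub> x) = h i \<oplus>\<^bsub>S\<^esub> h x"
        using ring_hom_add[OF h a_Hcarr x] by blast
      ultimately show ?thesis using z S.l_zero[OF ring_hom_closed[OF h x]] by simp
    qed
    moreover have "x \<in> I +>\<^bsub>R\<^esub> x" by (rule a_rcos_self[OF x])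
    ultimately have "h ` (I +>\<^bsub>R\<^esub> x) = {h x}" by blast
    then show ?thesis by simp
  qed
  then show "x \<in> carrier R \<Longrightarrow> the_elem (h ` (I +>\<^bsub>R\<^esub> x)) = h x" .
  have coset: "\<exists>x\<in>carrier R. A = I +>\<^bsub>R\<^esub> x" if "A \<in> carrier (R Quot I)" for A
    using that unfolding FactRing_def A_RCOSETS_def' by simp
  show "(\<lambda>A. the_elem (h ` A)) \<in> ring_hom (R Quot I) S"
  proof (rule ring_hom_memI)
    fix A assume "A \<in> carrier (R Quot I)"
    then obtain x where "x \<in> carrier R" "A = I +>\<^bsub>R\<^esub> x" using coset by blast
    then show "the_elem (h ` A) \<in> carrier S" using val ring_hom_closed[OF h] by simp
  next
    fix A B assume AB: "A \<in> carrier (R Quot I)" "B \<in> carrier (R Quot I)"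
    obtain x y where xy: "x \<in> carrier R" "y \<in> carrier R" "A = I +>\<^bsub>R\<^esub> x" "B = I +>\<^bsub>R\<^esub> y"
      using coset[OF AB(1)] coset[OF AB(2)] by blast
    have "A \<otimes>\<^bsub>R Quot I\<^esub> B = I +>\<^bsub>R\<^esub> (x \<otimes>\<^bsub>R\<^esub> y)"
      using xy by (simp add: FactRing_def rcoset_mult_add)
    then show "the_elem (h ` (A \<otimes>\<^bsub>R Quot I\<^esub> B)) = the_elem (h ` A) \<otimes>\<^bsub>S\<^esub> the_elem (h ` B)"
      using xy val ring_hom_mult[OF h] by simp
    have "A \<oplus>\<^bsub>R Quot I\<^esub> B = I +>\<^bsub>R\<^esub> (x \<oplus>\<^bsub>R\<^esub> y)"
      using xy by (simp add: FactRing_def a_rcos_sum)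
    then show "the_elem (h ` (A \<oplus>\<^bsub>R Quot I\<^esub> B)) = the_elem (h ` A) \<oplus>\<^bsub>S\<^esub> the_elem (h ` B)"
      using xy val ring_hom_add[OF h] by simp
  next
    show "the_elem (h ` \<one>\<^bsub>R Quot I\<^esub>) = \<one>\<^bsub>S\<^esub>"
      using val ring_hom_one[OF h] by (simp add: FactRing_def)
  qed
qed

section \<open>The homomorphism from the TGW construction to the superalgebra\<close>

lemma ring_C_alg: "ring (C_alg s p q)"
  unfolding C_alg_def tgw_free_def by (rule ideal.quotient_is_ring[OF ideal_C_ideal])

lemma ring_Weyl_alg: "ring (Weyl_alg s p q)"
  unfolding Weyl_alg_def W_free_def by (rule ideal.quotient_is_ring[OF ideal_W_ideal])

lemma piC_hom:
  "piC s p q \<in> ring_hom (free_alg (tgw_gens (p + q))) (C_alg s p q :: (gen list \<Rightarrow> 'k::field) set ring)"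
  unfolding piC_def[abs_def] C_alg_def tgw_free_def by (rule ideal.rcos_ring_hom[OF ideal_C_ideal])

lemma piW_hom:
  "piW s p q \<in> ring_hom (free_alg (W_gens (p + q))) (Weyl_alg s p q :: (wgen list \<Rightarrow> 'k::field) set ring)"
  unfolding piW_def[abs_def] Weyl_alg_def W_free_def by (rule ideal.rcos_ring_hom[OF ideal_W_ideal])

lemma carrier_C_alg: "carrier (C_alg s p q) = piC s p q ` car (tgw_gens (p + q))"
  unfolding C_alg_def piC_def tgw_free_def by (auto simp: FactRing_def A_RCOSETS_def')

lemma carrier_Weyl_alg: "carrier (Weyl_alg s p q) = piW s p q ` car (W_gens (p + q))"
  unfolding Weyl_alg_def piW_def W_free_def by (auto simp: FactRing_def A_RCOSETS_def')

lemma zero_C_alg: "\<zero>\<^bsub>C_alg s p q\<^esub> = C_ideal s p q"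
  by (simp add: C_alg_def FactRing_def)

lemma zero_Weyl_alg: "\<zero>\<^bsub>Weyl_alg s p q\<^esub> = W_ideal s p q"
  by (simp add: Weyl_alg_def FactRing_def)

lemma piC_eq_iff:
  "f \<in> car (tgw_gens (p + q)) \<Longrightarrow> g \<in> car (tgw_gens (p + q)) \<Longrightarrow>
    piC s p q f = piC s p q g \<longleftrightarrow> fsub f g \<in> C_ideal s p q"
  unfolding piC_def tgw_free_def by (rule free_ideal.coset_eq_iff[OF free_ideal_C])

lemma piW_eq_iff:
  "f \<in> car (W_gens (p + q)) \<Longrightarrow> g \<in> car (W_gens (p + q)) \<Longrightarrow>
    piW s p q f = piW s p q g \<longleftrightarrow> fsub f g \<in> W_ideal s p q"
  unfolding piW_def W_free_def by (rule free_ideal.coset_eq_iff[OF free_ideal_W])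

lemma piC_eq_zero:
  "f \<in> car (tgw_gens (p + q)) \<Longrightarrow> piC s p q f = \<zero>\<^bsub>C_alg s p q\<^esub> \<longleftrightarrow> f \<in> C_ideal s p q"
  unfolding zero_C_alg piC_def tgw_free_def by (rule free_ideal.coset_eq_self[OF free_ideal_C])

lemma piW_eq_zero:
  "f \<in> car (W_gens (p + q)) \<Longrightarrow> piW s p q f = \<zero>\<^bsub>Weyl_alg s p q\<^esub> \<longleftrightarrow> f \<in> W_ideal s p q"
  unfolding zero_Weyl_alg piW_def W_free_def by (rule free_ideal.coset_eq_self[OF free_ideal_W])

lemma piC_fadd:
  "f \<in> car (tgw_gens (p + q)) \<Longrightarrow> g \<in> car (tgw_gens (p + q)) \<Longrightarrow>
    piC s p q (fadd f g) = piC s p q f \<oplus>\<^bsub>C_alg s p q\<^esub> piC s p q g"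
  using ring_hom_add[OF piC_hom, of f p q g s] by (simp add: free_alg_simps)

lemma piC_fmul:
  "f \<in> car (tgw_gens (p + q)) \<Longrightarrow> g \<in> car (tgw_gens (p + q)) \<Longrightarrow>
    piC s p q (fmul f g) = piC s p q f \<otimes>\<^bsub>C_alg s p q\<^esub> piC s p q g"
  using ring_hom_mult[OF piC_hom, of f p q g s] by (simp add: free_alg_simps)

lemma piC_zero:
  "piC s p q (\<lambda>w. 0) = \<zero>\<^bsub>(C_alg s p q :: (gen list \<Rightarrow> 'k::field) set ring)\<^esub>"
  using piC_eq_zero[OF car_zero] free_ideal.zero[OF free_ideal_C] by blast

lemma piW_Psi_hom:
  "(\<lambda>f. piW s p q (Psi f)) \<in>
    ring_hom (free_alg (tgw_gens (p + q))) (Weyl_alg s p q :: (wgen list \<Rightarrow> 'k::field) set ring)"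
proof (rule ring_hom_memI)
  fix f :: "gen list \<Rightarrow> 'k" assume "f \<in> car (tgw_gens (p + q))"
  then show "piW s p q (Psi f) \<in> carrier (Weyl_alg s p q)"
    using Psi_car by (auto simp: carrier_Weyl_alg)
next
  fix f g :: "gen list \<Rightarrow> 'k" assume "f \<in> car (tgw_gens (p + q))" "g \<in> car (tgw_gens (p + q))"
  then show
    "piW s p q (Psi (f \<otimes>\<^bsub>free_alg (tgw_gens (p + q))\<^esub> g)) = piW s p q (Psi f) \<otimes>\<^bsub>Weyl_alg s p q\<^esub> piW s p q (Psi g)"
    "piW s p q (Psi (f \<oplus>\<^bsub>free_alg (tgw_gens (p + q))\<^esub> g)) = piW s p q (Psi f) \<oplus>\<^bsub>Weyl_alg s p q\<^esub> piW s p q (Psi g)"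
    using ring_hom_mult[OF piW_hom, of "Psi f" p q "Psi g" s] ring_hom_add[OF piW_hom, of "Psi f" p q "Psi g" s]
    by (simp_all add: free_alg_simps Psi_car Psi_fmul[of _ "p + q"] Psi_fadd[of _ "tgw_gens (p + q)"])
next
  show "piW s p q (Psi \<one>\<^bsub>free_alg (tgw_gens (p + q))\<^esub>) = \<one>\<^bsub>(Weyl_alg s p q :: (wgen list \<Rightarrow> 'k) set ring)\<^esub>"
    using ring_hom_one[OF piW_hom[of s p q, where ?'k = 'k]] by (simp add: free_alg_simps Psi_mon)
qed

definition phi :: "bool \<Rightarrow> nat \<Rightarrow> nat \<Rightarrow> (gen list \<Rightarrow> 'k::field) set \<Rightarrow> (wgen list \<Rightarrow> 'k) set" where
  "phi s p q A = the_elem ((\<lambda>f. piW s p q (Psi f)) ` A)"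

lemma piW_Psi_C_ideal:
  fixes f :: "gen list \<Rightarrow> 'k::field_char_0"
  assumes "f \<in> C_ideal s p q" shows "piW s p q (Psi f) = \<zero>\<^bsub>Weyl_alg s p q\<^esub>"
proof -
  have "f \<in> Psi_kernel s p q" using assms C_ideal_Psi_kernel by blast
  then show ?thesis by (simp add: Psi_kernel_def piW_eq_zero Psi_car)
qed

lemma phi_piC:
  fixes f :: "gen list \<Rightarrow> 'k::field_char_0"
  assumes "f \<in> car (tgw_gens (p + q))"
  shows "phi s p q (piC s p q f) = piW s p q (Psi f)"
  using quotient_hom_value[OF ideal_C_ideal piW_Psi_hom ring_Weyl_alg piW_Psi_C_ideal assms]
  by (simp add: phi_def piC_def tgw_free_def)

lemma phi_hom: "phi s p q \<in> ring_hom (C_alg s p q) (Weyl_alg s p q :: (wgen list \<Rightarrow> 'k::field_char_0) set ring)"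
  using quotient_hom_ring_hom[OF ideal_C_ideal piW_Psi_hom ring_Weyl_alg piW_Psi_C_ideal]
  unfolding phi_def[abs_def] C_alg_def tgw_free_def by blast

lemma phi_ring_hom_ring:
  "ring_hom_ring (C_alg s p q) (Weyl_alg s p q :: (wgen list \<Rightarrow> 'k::field_char_0) set ring) (phi s p q)"
  by (rule ring_hom_ringI2[OF ring_C_alg ring_Weyl_alg phi_hom])

lemma a_kernel_phi:
  "a_kernel (C_alg s p q) (Weyl_alg s p q) (phi s p q) =
    piC s p q ` (Psi_kernel s p q :: (gen list \<Rightarrow> 'k::field_char_0) set)"
proof -
  have "phi s p q (piC s p q f) = \<zero>\<^bsub>Weyl_alg s p q\<^esub> \<longleftrightarrow> f \<in> Psi_kernel s p q"
    if "f \<in> car (tgw_gens (p + q))" for f :: "gen list \<Rightarrow> 'k"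
    using that unfolding phi_piC[OF that] Psi_kernel_def by (simp add: piW_eq_zero Psi_car)
  moreover have "Psi_kernel s p q \<subseteq> (car (tgw_gens (p + q)) :: (gen list \<Rightarrow> 'k) set)"
    by (auto simp: Psi_kernel_def)
  ultimately show ?thesis unfolding a_kernel_def' carrier_C_alg by blast
qed

text \<open>Replacing x_i by \<open>X i\<close> and \<partial>_i by \<open>Y i\<close> letter by
  letter is a section of the substitution.\<close>

lemma Psi_surj:
  assumes "g \<in> car (W_gens n)"
  obtains f where "f \<in> car (tgw_gens n)" "Psi f = (g :: wgen list \<Rightarrow> 'k::field)"
proof -
  have "\<exists>f \<in> car (tgw_gens n). Psi f = g"
    using assms
  proof (induction rule: car_induct)
    case zero then show ?case using Psi_zero car_zero by blast
  next
    case (step g c w)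
    then obtain f where f: "f \<in> car (tgw_gens n)" "Psi f = g" by blast
    define v where "v = map (\<lambda>g. case g of Xw i \<Rightarrow> X i | Dw i \<Rightarrow> Y i) w"
    have "psiw v = w" unfolding v_def by (induction w) (auto split: wgen.splits)
    moreover have v: "set v \<subseteq> tgw_gens n"
      using step(2) unfolding v_def by (induction w) (auto split: wgen.splits)
    ultimately have "Psi (fadd f (fsmul c (mon v))) = fadd g (fsmul c (mon w))"
      using f by (simp add: Psi_fadd[of _ "tgw_gens n"] car_fsmul car_mon Psi_fsmul Psi_mon)
    moreover have "fadd f (fsmul c (mon v)) \<in> car (tgw_gens n)"
      using f v by (simp add: car_fadd car_fsmul car_mon)
    ultimately show ?case by blast
  qed
  then show ?thesis using that by blast
qed

lemma phi_surj:
  "phi s p q ` carrier (C_alg s p q) = carrier (Weyl_alg s p q :: (wgen list \<Rightarrow> 'k::field_char_0) set ring)"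
proof
  show "phi s p q ` carrier (C_alg s p q) \<subseteq> carrier (Weyl_alg s p q :: (wgen list \<Rightarrow> 'k) set ring)"
    using ring_hom_closed[OF phi_hom] by blast
  show "carrier (Weyl_alg s p q :: (wgen list \<Rightarrow> 'k) set ring) \<subseteq> phi s p q ` carrier (C_alg s p q)"
  proof
    fix A :: "(wgen list \<Rightarrow> 'k) set" assume "A \<in> carrier (Weyl_alg s p q)"
    then obtain g where g: "g \<in> car (W_gens (p + q))" "A = piW s p q g" by (auto simp: carrier_Weyl_alg)
    obtain f where "f \<in> car (tgw_gens (p + q))" "Psi f = g" by (rule Psi_surj[OF g(1)])
    then have "A = phi s p q (piC s p q f)" "piC s p q f \<in> carrier (C_alg s p q)"
      using g(2) phi_piC[of f p q s] by (simp_all add: carrier_C_alg)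
    then show "A \<in> phi s p q ` carrier (C_alg s p q)" by blast
  qed
qed

subsection \<open>The kernel is the largest graded ideal avoiding degree zero\<close>

lemma Psi_kernel_car: "f \<in> Psi_kernel s p q \<Longrightarrow> f \<in> car (tgw_gens (p + q))"
  by (simp add: Psi_kernel_def)

definition component :: "(gen list \<Rightarrow> 'k::field) \<Rightarrow> (nat \<Rightarrow> int) \<Rightarrow> gen list \<Rightarrow> 'k" where
  "component f d = (\<lambda>w. if wdeg w = d then f w else 0)"

lemma component_car: "f \<in> car G \<Longrightarrow> component f d \<in> car G"
  by (auto simp: mem_car component_def elim: rev_finite_subset)

text \<open>A word of degree \<open>d\<close> contributes only to entries whose target is the source
  plus \<open>d\<close>. Each coefficient of the component is therefore a coefficient of
  \<open>f\<close> or 0.\<close>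

lemma component_Psi_kernel:
  fixes f :: "gen list \<Rightarrow> 'k::field_char_0"
  assumes "f \<in> Psi_kernel s p q"
  shows "component f d \<in> Psi_kernel s p q"
  unfolding Psi_kernel_iff
proof (intro conjI allI impI)
  have f: "f \<in> car (tgw_gens (p + q))" using assms by (simp add: Psi_kernel_iff)
  then show "component f d \<in> car (tgw_gens (p + q))" by (rule component_car)
  fix M M' assume M: "valid s p q M"
  have "lin (\<lambda>w. mcoef s p M M' (psiw w)) (component f d) = (\<Sum>w | f w \<noteq> 0. component f d w * mcoef s p M M' (psiw w))"
    using f by (intro lin_eq_sum) (auto simp: mem_car component_def split: if_splits)
  also have "\<dots> = (if M' = (\<lambda>j. M j + d j) then lin (\<lambda>w. mcoef s p M M' (psiw w)) f else 0)"
  proof (cases "M' = (\<lambda>j. M j + d j)")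
    case True
    have "component f d w * mcoef s p M M' (psiw w) = f w * mcoef s p M M' (psiw w)" for w
      using True by (auto simp: component_def mcoef_def deg_psiw fun_eq_iff)
    then show ?thesis using True by (simp only: lin_def if_True refl)
  next
    case False
    have "component f d w * mcoef s p M M' (psiw w) = 0" for w
      using False by (auto simp: component_def mcoef_def deg_psiw)
    then show ?thesis using False by (simp only: if_False sum.neutral_const)
  qed
  also have "\<dots> = 0" using assms M by (auto simp: Psi_kernel_iff)
  finally show "lin (\<lambda>w. mcoef s p M M' (psiw w)) (component f d) = 0" .
qed

lemma foldr_component:
  assumes "f \<in> car (tgw_gens (p + q))" "distinct ds"
  shows "foldr (\<lambda>y acc. y \<oplus>\<^bsub>C_alg s p q\<^esub> acc) (map (\<lambda>d. piC s p q (component f d)) ds) \<zero>\<^bsub>C_alg s p q\<^esub>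
    = piC s p q (\<lambda>w. if wdeg w \<in> set ds then f w else 0)"
  using assms(2)
proof (induction ds)
  case Nil show ?case by (simp add: piC_zero)
next
  case (Cons d ds)
  have "(\<lambda>w. if wdeg w \<in> set ds then f w else 0) \<in> car (tgw_gens (p + q))"
    using assms(1) by (auto simp: mem_car elim: rev_finite_subset)
  moreover have "(\<lambda>w. if wdeg w \<in> set (d # ds) then f w else 0) =
      fadd (component f d) (\<lambda>w. if wdeg w \<in> set ds then f w else 0)"
    using Cons.prems by (intro ext) (auto simp: component_def fadd_def)
  ultimately show ?case
    using Cons component_car[OF assms(1), of d] by (simp only: list.map foldr.simps o_apply distinct.simps piC_fadd)
qed

lemma C_hom_inter_kernel:
  fixes f :: "gen list \<Rightarrow> 'k::field_char_0"
  assumes "f \<in> free_hom p q (\<lambda>_. 0)" "f \<in> Psi_kernel s p q"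
  shows "f \<in> C_ideal s p q"
proof -
  interpret free_ideal "tgw_gens (p + q)" "C_ideal s p q :: (gen list \<Rightarrow> 'k) set" by (rule free_ideal_C)
  interpret K: free_ideal "tgw_gens (p + q)" "Psi_kernel s p q :: (gen list \<Rightarrow> 'k) set"
    by (rule free_ideal.intro[OF ideal_Psi_kernel])
  have f: "f \<in> car (tgw_gens (p + q))" "\<And>w. f w \<noteq> 0 \<Longrightarrow> wdeg w = (\<lambda>_. 0)"
    using assms(1) by (auto simp: free_hom_def tgw_free_def)
  have "f \<in> lspan (C_ideal s p q) (U_module (p + q) {[]})"
    using f by (intro lspan_mon_words[OF free_ideal_C f(1)] degree_zero_span) auto
  then have "\<exists>r \<in> car (R_gens (p + q)). fsub f r \<in> C_ideal s p q"
  proof induction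
    case (lspan_base f)
    then show ?case using car_zero by (intro bexI[of _ "\<lambda>w. 0"]) (auto simp: fsub_def)
  next
    case (lspan_step f g c)
    then obtain r where r: "r \<in> car (R_gens (p + q))" "fsub f r \<in> C_ideal s p q" by blast
    have "g \<in> car (R_gens (p + q))" using lspan_step by (auto simp: U_module_def car_mon)
    then have "fadd r (fsmul c g) \<in> car (R_gens (p + q))" using r by (simp add: car_fadd car_fsmul)
    moreover have "fsub (fadd f (fsmul c g)) (fadd r (fsmul c g)) = fsub f r"
      by (simp add: fsub_def fadd_def)
    ultimately show ?case using r(2) by metis
  qed
  then obtain r where r: "r \<in> car (R_gens (p + q))" "fsub f r \<in> C_ideal s p q" by blast
  have "fsub f r \<in> Psi_kernel s p q" using r(2) C_ideal_Psi_kernel by blast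
  then have "r \<in> Psi_kernel s p q" using K.cong_mem[OF K.cong_sym assms(2)] by blast
  then have "r \<in> R_ideal s p q" by (rule R_inter_Psi_kernel[OF r(1)])
  then have "r \<in> C_ideal s p q" using R_ideal_C_ideal by blast
  then show ?thesis using cong_mem[OF r(2)] by blast
qed

lemma kernel_graded: "C_graded_ideal s p q (piC s p q ` (Psi_kernel s p q :: (gen list \<Rightarrow> 'k::field_char_0) set))"
  unfolding C_graded_ideal_def
proof (intro conjI ballI)
  show "ideal (piC s p q ` (Psi_kernel s p q :: (gen list \<Rightarrow> 'k) set)) (C_alg s p q)"
    using ring_hom_ring.kernel_is_ideal[OF phi_ring_hom_ring] unfolding a_kernel_phi .
  fix x :: "(gen list \<Rightarrow> 'k) set" assume "x \<in> piC s p q ` Psi_kernel s p q"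
  then obtain f where f: "x = piC s p q f" "f \<in> Psi_kernel s p q" by (rule imageE)
  from f(2) have fc: "f \<in> car (tgw_gens (p + q))" by (rule Psi_kernel_car)
  then have fin: "finite (wdeg ` {w. f w \<noteq> 0})" unfolding mem_car by blast
  obtain ds where ds: "set ds = wdeg ` {w. f w \<noteq> 0}" "distinct ds"
    using finite_distinct_list[OF fin] by (elim exE conjE)
  let ?ys = "map (\<lambda>d. piC s p q (component f d)) ds"
  have "f = (\<lambda>w. if wdeg w \<in> set ds then f w else 0)" using ds by (intro ext) auto
  then have x: "x = foldr (\<lambda>y acc. y \<oplus>\<^bsub>C_alg s p q\<^esub> acc) ?ys \<zero>\<^bsub>C_alg s p q\<^esub>"
    unfolding foldr_component[OF fc ds(2), of s] f(1) by (rule arg_cong)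
  have comp: "piC s p q (component f d) \<in> piC s p q ` Psi_kernel s p q \<inter> C_hom s p q d" for d
  proof
    show "piC s p q (component f d) \<in> piC s p q ` Psi_kernel s p q"
      using component_Psi_kernel[OF f(2)] by (rule imageI)
    have "component f d \<in> free_hom p q d"
      using component_car[OF fc] by (simp add: free_hom_def tgw_free_def) (simp add: component_def)
    then show "piC s p q (component f d) \<in> C_hom s p q d" unfolding C_hom_def by (rule imageI)
  qed
  have "\<forall>y\<in>set ?ys. \<exists>d. y \<in> piC s p q ` Psi_kernel s p q \<inter> C_hom s p q d"
  proof
    fix y assume "y \<in> set ?ys"
    then obtain d where y: "y = piC s p q (component f d)" unfolding set_map by (rule imageE)
    show "\<exists>d. y \<in> piC s p q ` Psi_kernel s p q \<inter> C_hom s p q d"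
      unfolding y by (rule exI, rule comp)
  qed
  then show "\<exists>ys. (\<forall>y\<in>set ys. \<exists>d. y \<in> piC s p q ` Psi_kernel s p q \<inter> C_hom s p q d) \<and>
      x = foldr (\<lambda>y acc. y \<oplus>\<^bsub>C_alg s p q\<^esub> acc) ys \<zero>\<^bsub>C_alg s p q\<^esub>"
    using x by (intro exI[of _ ?ys] conjI)
qed

lemma kernel_degree_zero:
  "piC s p q ` (Psi_kernel s p q :: (gen list \<Rightarrow> 'k::field_char_0) set) \<inter> C_hom s p q (\<lambda>_. 0) = {\<zero>\<^bsub>C_alg s p q\<^esub>}"
proof
  interpret K: free_ideal "tgw_gens (p + q)" "Psi_kernel s p q :: (gen list \<Rightarrow> 'k) set"
    by (rule free_ideal.intro[OF ideal_Psi_kernel])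
  show "piC s p q ` (Psi_kernel s p q :: (gen list \<Rightarrow> 'k) set) \<inter> C_hom s p q (\<lambda>_. 0) \<subseteq> {\<zero>\<^bsub>C_alg s p q\<^esub>}"
  proof
    fix x assume "x \<in> piC s p q ` (Psi_kernel s p q :: (gen list \<Rightarrow> 'k) set) \<inter> C_hom s p q (\<lambda>_. 0)"
    then obtain f g :: "gen list \<Rightarrow> 'k" where fg: "f \<in> Psi_kernel s p q" "x = piC s p q f"
      "g \<in> free_hom p q (\<lambda>_. 0)" "x = piC s p q g" by (auto simp: C_hom_def)
    have c: "f \<in> car (tgw_gens (p + q))" "g \<in> car (tgw_gens (p + q))"
      using Psi_kernel_car[OF fg(1)] fg(3) by (simp_all add: free_hom_def tgw_free_def)
    \<comment> \<open>The representative \<open>f\<close> from the kernel need not be homogeneous;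
      it can be traded for \<open>g\<close>, since the two differ by relations.\<close>
    have "fsub g f \<in> C_ideal s p q" using fg(2,4) piC_eq_iff[OF c(2,1), of s] by simp
    then have "fsub g f \<in> Psi_kernel s p q" using C_ideal_Psi_kernel by blast
    then have "g \<in> Psi_kernel s p q" using K.cong_mem fg(1) by blast
    then have "g \<in> C_ideal s p q" using C_hom_inter_kernel fg(3) by blast
    then show "x \<in> {\<zero>\<^bsub>C_alg s p q\<^esub>}" using piC_eq_zero[OF c(2)] fg(4) by blast
  qed
  have "(\<lambda>w. 0) \<in> free_hom p q (\<lambda>_. 0)" by (simp add: free_hom_def tgw_free_def car_zero)
  then show "{\<zero>\<^bsub>C_alg s p q\<^esub>} \<subseteq> piC s p q ` (Psi_kernel s p q :: (gen list \<Rightarrow> 'k) set) \<inter> C_hom s p q (\<lambda>_. 0)"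
    using imageI[OF K.zero, of "piC s p q"] imageI[of _ "free_hom p q (\<lambda>_. 0)" "piC s p q"]
    unfolding piC_zero[of s p q, where ?'k = 'k, symmetric] C_hom_def by blast
qed

text \<open>An element of degree \<open>d\<close> outside the kernel maps some basis state to a nonzero multiple of another
  one; a monomial leading back from there makes the product a degree-zero element outside the kernel.\<close>

lemma homogeneous_in_kernel:
  fixes f :: "gen list \<Rightarrow> 'k::field_char_0"
  assumes I: "ideal I (C_alg s p q)" and I0: "I \<inter> C_hom s p q (\<lambda>_. 0) = {\<zero>\<^bsub>C_alg s p q\<^esub>}"
    and fI: "piC s p q f \<in> I" and f: "f \<in> free_hom p q d"
  shows "f \<in> Psi_kernel s p q"
proof (rule ccontr)
  assume nk: "f \<notin> Psi_kernel s p q"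
  have fc: "f \<in> car (tgw_gens (p + q))" and fd: "\<And>w. f w \<noteq> 0 \<Longrightarrow> wdeg w = d"
    using f by (auto simp: free_hom_def tgw_free_def)
  obtain M M' where M: "valid s p q M" and nz: "lin (\<lambda>w. mcoef s p M M' (psiw w)) f \<noteq> 0"
    using nk fc unfolding Psi_kernel_iff by auto
  \<comment> \<open>One contributing word shows that \<open>M'\<close> is \<open>M\<close> shifted
    by \<open>d\<close> and is itself valid, so that a way back exists.\<close>
  have "\<exists>w. f w * mcoef s p M M' (psiw w) \<noteq> 0"
  proof (rule ccontr)
    assume "\<not> ?thesis"
    then have "\<And>w. f w * mcoef s p M M' (psiw w) = 0" by blast
    then have "lin (\<lambda>w. mcoef s p M M' (psiw w)) f = 0" by (simp only: lin_def sum.neutral_const)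
    with nz show False by contradiction
  qed
  then obtain w where w: "f w \<noteq> 0" "mcoef s p M M' (psiw w) \<noteq> (0 :: 'k)" by auto
  have M': "(\<lambda>j. M j + deg (psiw w) j) = M'" "wcoef s p (psiw w) M \<noteq> (0 :: 'k)"
    using w(2) by (auto simp: mcoef_def split: if_splits)
  have "set w \<subseteq> tgw_gens (p + q)" using fc w(1) unfolding mem_car by blast
  then have vM': "valid s p q M'" using wcoef_valid[OF M psiw_gens M'(2)] unfolding M'(1) by blast
  obtain a b where ab: "set a \<subseteq> {1..p + q}" "set b \<subseteq> {1..p + q}"
    "(\<lambda>j. M' j + deg (map Xw a @ map Dw b) j) = M"
    "wcoef s p (map Xw a @ map Dw b) M' \<noteq> (0 :: 'k)"
    by (rule valid_connected[OF vM' M])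
  define v where "v = map X a @ map Y b"
  have pv: "psiw v = map Xw a @ map Dw b"
  proof -
    have "psiw (map X a) = map Xw a" by (induction a) auto
    moreover have "psiw (map Y b) = map Dw b" by (induction b) auto
    ultimately show ?thesis by (simp add: v_def)
  qed
  have vc: "mon v \<in> (car (tgw_gens (p + q)) :: (gen list \<Rightarrow> 'k) set)" using ab by (auto simp: car_mon v_def)
  have vd: "wdeg v = (\<lambda>j. - d j)"
  proof
    fix j
    have "M' j + wdeg v j = M j" using fun_cong[OF ab(3), of j] by (simp add: pv flip: deg_psiw)
    moreover have "M j + d j = M' j" using fun_cong[OF M'(1), of j] fd[OF w(1)] by (simp add: deg_psiw)
    ultimately show "wdeg v j = - d j" by simp
  qed
  let ?g = "fmul (mon v) f"
  have gc: "?g \<in> car (tgw_gens (p + q))" using vc fc by (rule car_fmul)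
  have "wdeg u = (\<lambda>_. 0)" if gu: "?g u \<noteq> 0" for u
  proof -
    obtain u1 u2 where u: "u = u1 @ u2" "mon v u1 \<noteq> (0 :: 'k)" "f u2 \<noteq> 0" by (rule fmul_support[OF gu])
    then have "u1 = v" by (auto simp: mon_def split: if_splits)
    moreover have "wdeg (v @ u2) = (\<lambda>j. wdeg v j + wdeg u2 j)" by (auto simp: wdeg_def fun_eq_iff)
    ultimately show ?thesis using vd fd[OF u(3)] u(1) by simp
  qed
  then have "?g \<in> free_hom p q (\<lambda>_. 0)" using gc by (simp add: free_hom_def tgw_free_def)
  moreover have "piC s p q ?g \<in> I"
    using ideal.I_l_closed[OF I fI, of "piC s p q (mon v)"] vc fc by (simp add: piC_fmul carrier_C_alg)
  ultimately have "piC s p q ?g = \<zero>\<^bsub>C_alg s p q\<^esub>" using I0 by (auto simp: C_hom_def)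
  then have "?g \<in> C_ideal s p q" using piC_eq_zero[OF gc] by blast
  then have "?g \<in> Psi_kernel s p q" using C_ideal_Psi_kernel by blast
  then have "lin (\<lambda>w. mcoef s p M M (psiw w)) ?g = 0" using M unfolding Psi_kernel_iff by blast
  \<comment> \<open>To end at \<open>M\<close> after \<open>v\<close>, a word of \<open>f\<close>
    must first reach \<open>M'\<close>; hence the diagonal coefficient of the product
    factors.\<close>
  moreover have "lin (\<lambda>w. mcoef s p M M (psiw w)) ?g =
      wcoef s p (psiw v) M' * lin (\<lambda>w. mcoef s p M M' (psiw w)) f"
  proof -
    have "(\<lambda>j. M j - deg (psiw v) j) = M'" using ab(3) pv by (auto simp: fun_eq_iff algebra_simps)
    then show ?thesis
      unfolding lin_fmul[OF vc fc] lin_mon psiw_simps(3) mcoef_append_left by (simp only: lin_scale)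
  qed
  ultimately show False using nz ab(4) pv by simp
qed

text \<open>The kernel is itself a competitor, so it only has to bound the others. Homogeneous
  elements decide this, because every element of a graded ideal is a sum of homogeneous ones in
  it.\<close>

lemma tgw_ideal_eq:
  "tgw_ideal s p q = piC s p q ` (Psi_kernel s p q :: (gen list \<Rightarrow> 'k::field_char_0) set)"
  unfolding tgw_ideal_def
proof (rule Greatest_equality)
  show "C_graded_ideal s p q (piC s p q ` (Psi_kernel s p q :: (gen list \<Rightarrow> 'k) set)) \<and>
    piC s p q ` (Psi_kernel s p q :: (gen list \<Rightarrow> 'k) set) \<inter> C_hom s p q (\<lambda>_. 0) = {\<zero>\<^bsub>C_alg s p q\<^esub>}"
    by (intro conjI kernel_graded kernel_degree_zero)
next
  fix I :: "(gen list \<Rightarrow> 'k) set set"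
  assume "C_graded_ideal s p q I \<and> I \<inter> C_hom s p q (\<lambda>_. 0) = {\<zero>\<^bsub>C_alg s p q\<^esub>}"
  note I_graded = this[unfolded C_graded_ideal_def]
  note I = I_graded[THEN conjunct1, THEN conjunct1] and graded = I_graded[THEN conjunct1, THEN conjunct2]
    and I0 = I_graded[THEN conjunct2]
  let ?J = "piC s p q ` (Psi_kernel s p q :: (gen list \<Rightarrow> 'k) set)"
  have "ideal ?J (C_alg s p q)" using kernel_graded unfolding C_graded_ideal_def by (rule conjunct1)
  then have J: "additive_subgroup ?J (C_alg s p q)" by (rule ideal.axioms(1))
  have homogeneous: "y \<in> ?J" if y: "y \<in> I \<inter> C_hom s p q d" for y d
  proof -
    have "y \<in> piC s p q ` free_hom p q d" using y unfolding C_hom_def by (rule IntD2)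
    then obtain f where f: "y = piC s p q f" "f \<in> free_hom p q d" by (rule imageE)
    have "piC s p q f \<in> I" using y f(1) by simp
    then have "f \<in> Psi_kernel s p q" using homogeneous_in_kernel[OF I I0 _ f(2)] by simp
    then show ?thesis unfolding f(1) by (rule imageI)
  qed
  show "I \<subseteq> ?J"
  proof
    fix x assume xI: "x \<in> I"
    obtain ys where *: "(\<forall>y\<in>set ys. \<exists>d. y \<in> I \<inter> C_hom s p q d) \<and>
      x = foldr (\<lambda>y acc. y \<oplus>\<^bsub>C_alg s p q\<^esub> acc) ys \<zero>\<^bsub>C_alg s p q\<^esub>"
      using bspec[OF graded xI] by (rule exE)
    note ys = *[THEN conjunct1] *[THEN conjunct2]
    have "\<forall>y\<in>set ys. y \<in> ?J"
    proof
      fix y assume "y \<in> set ys"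
      from bspec[OF ys(1) this] obtain d where "y \<in> I \<inter> C_hom s p q d" by (rule exE)
      then show "y \<in> ?J" by (rule homogeneous)
    qed
    then show "x \<in> ?J" unfolding ys(2)
    proof (induction ys)
      case Nil show ?case using additive_subgroup.zero_closed[OF J] by simp
    next
      case (Cons y ys)
      then show ?case using additive_subgroup.a_closed[OF J, of y] by simp
    qed
  qed
qed

section \<open>The isomorphism and consistency\<close>

lemma ideal_tgw_ideal: "ideal (tgw_ideal s p q :: (gen list \<Rightarrow> 'k::field_char_0) set set) (C_alg s p q)"
  unfolding tgw_ideal_eq a_kernel_phi[symmetric]
  by (rule ring_hom_ring.kernel_is_ideal[OF phi_ring_hom_ring])

definition chi :: "bool \<Rightarrow> nat \<Rightarrow> nat \<Rightarrow> (gen list \<Rightarrow> 'k::field) set set \<Rightarrow> (wgen list \<Rightarrow> 'k) set" where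
  "chi s p q A = the_elem (phi s p q ` A)"

lemma chi_iso:
  "chi s p q \<in> ring_iso (TGW_alg s p q) (Weyl_alg s p q :: (wgen list \<Rightarrow> 'k::field_char_0) set ring)"
  unfolding chi_def[abs_def] TGW_alg_def tgw_ideal_eq a_kernel_phi[symmetric]
  by (rule ring_hom_ring.FactRing_iso_set[OF phi_ring_hom_ring phi_surj])

lemma chi_piA:
  fixes f :: "gen list \<Rightarrow> 'k::field_char_0"
  assumes "f \<in> car (tgw_gens (p + q))"
  shows "chi s p q (piA s p q f) = piW s p q (Psi f)"
proof -
  have "piC s p q f \<in> carrier (C_alg s p q)" using assms by (simp add: carrier_C_alg)
  moreover have "phi s p q A = \<zero>\<^bsub>Weyl_alg s p q\<^esub>" if "A \<in> tgw_ideal s p q" for A :: "(gen list \<Rightarrow> 'k) set"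
    using that unfolding tgw_ideal_eq a_kernel_phi[symmetric] a_kernel_def' by simp
  ultimately have "chi s p q (piA s p q f) = phi s p q (piC s p q f)"
    unfolding chi_def piA_def by (intro quotient_hom_value[OF ideal_tgw_ideal phi_hom ring_Weyl_alg])
  then show ?thesis using phi_piC[OF assms] by simp
qed

text \<open>The canonical map is defined through \<open>the_elem\<close>, so it must be constant on
  cosets; this comes from the inclusion of \<open>R_ideal\<close> in \<open>C_ideal\<close>.\<close>

lemma tgw_rho_coset:
  fixes f :: "gen list \<Rightarrow> 'k::field_char_0"
  assumes f: "f \<in> car (R_gens (p + q))"
  shows "tgw_rho s p q (R_ideal s p q +>\<^bsub>R_free p q\<^esub> f) = piA s p q f"
proof -
  let ?A = "R_ideal s p q +>\<^bsub>R_free p q\<^esub> f"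
  have "piA s p q g = piA s p q f" if gA: "g \<in> ?A" for g
  proof -
    obtain r where r: "r \<in> R_ideal s p q" "g = fadd r f"
      using gA unfolding R_free_def by (auto simp: a_r_coset_def' free_alg_simps)
    have rC: "r \<in> C_ideal s p q" using r(1) R_ideal_C_ideal by blast
    have "g \<in> car (tgw_gens (p + q))" "f \<in> car (tgw_gens (p + q))"
      using r f free_ideal.in_car[OF free_ideal_R r(1)] by (simp_all add: car_fadd car_R_tgw)
    moreover have "fsub g f \<in> C_ideal s p q" using rC r(2) by (simp add: fsub_def fadd_def)
    ultimately have "piC s p q g = piC s p q f" by (simp add: piC_eq_iff)
    then show ?thesis by (simp add: piA_def)
  qed
  moreover have "f \<in> ?A"
  proof -
    have "(\<lambda>w. 0) \<in> (R_ideal s p q :: (gen list \<Rightarrow> 'k) set)" by (rule free_ideal.zero[OF free_ideal_R])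
    then show ?thesis unfolding R_free_def by (force simp: a_r_coset_def' free_alg_simps fadd_def)
  qed
  ultimately have "piA s p q ` ?A = {piA s p q f}" by blast
  then show ?thesis by (simp add: tgw_rho_def)
qed

text \<open>Applying \<open>chi\<close> to equal images in the TGW algebra puts the difference of
  representatives into \<open>Psi_kernel\<close>, which meets the free algebra on the
  \<open>U i\<close> inside \<open>R_ideal\<close>.\<close>

lemma tgw_consistent: "tgw_consistent s p q TYPE('k::field_char_0)"
  unfolding tgw_consistent_def
proof (rule inj_onI)
  fix A B :: "(gen list \<Rightarrow> 'k) set"
  assume AB: "A \<in> carrier (R_ring s p q)" "B \<in> carrier (R_ring s p q)"
    and eq: "tgw_rho s p q A = tgw_rho s p q B"
  have coset: "\<exists>f\<in>car (R_gens (p + q)). A = R_ideal s p q +>\<^bsub>R_free p q\<^esub> f"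
    if "A \<in> carrier (R_ring s p q)" for A :: "(gen list \<Rightarrow> 'k) set"
    using that unfolding R_ring_def R_ideal_def[symmetric] FactRing_def A_RCOSETS_def' by (simp add: R_free_def)
  obtain f where f: "f \<in> car (R_gens (p + q))" "A = R_ideal s p q +>\<^bsub>R_free p q\<^esub> f"
    using coset[OF AB(1)] by (elim bexE)
  obtain g where g: "g \<in> car (R_gens (p + q))" "B = R_ideal s p q +>\<^bsub>R_free p q\<^esub> g"
    using coset[OF AB(2)] by (elim bexE)
  have fg: "f \<in> car (tgw_gens (p + q))" "g \<in> car (tgw_gens (p + q))" using f g car_R_tgw by blast+
  have "piA s p q f = piA s p q g"
    using eq unfolding f(2) g(2) tgw_rho_coset[OF f(1)] tgw_rho_coset[OF g(1)] .
  then have "piW s p q (Psi f) = piW s p q (Psi g)"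
    using chi_piA[OF fg(1), of s] chi_piA[OF fg(2), of s] by simp
  then have "fsub (Psi f) (Psi g) \<in> W_ideal s p q"
    using piW_eq_iff[OF Psi_car[OF fg(1)] Psi_car[OF fg(2)]] by blast
  then have "fsub f g \<in> Psi_kernel s p q"
    using fg by (simp add: Psi_kernel_def car_fsub Psi_fsub[OF fg])
  then have "fsub f g \<in> R_ideal s p q"
    using f g by (intro R_inter_Psi_kernel) (simp_all add: car_fsub)
  then show "A = B"
    unfolding f(2) g(2) R_free_def free_ideal.coset_eq_iff[OF free_ideal_R f(1) g(1)] .
qed

theorem mainTheorem3:
  fixes s :: bool and p q :: nat
  assumes alg_closed: "\<forall>f :: 'k::field_char_0 poly. degree f \<ge> 1 \<longrightarrow> (\<exists>x. poly f x = 0)"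
  shows "(\<exists>\<chi>. \<chi> \<in> ring_iso (TGW_alg s p q) (Weyl_alg s p q)
            \<and> (\<forall>c::'k. \<chi> (piA s p q (fa_scal c)) = piW s p q (fa_scal c))
            \<and> (\<forall>i\<in>{1..p+q}.
                  \<chi> (piA s p q (fa_gen (X i))) = piW s p q (fa_gen (Xw i))
                \<and> \<chi> (piA s p q (fa_gen (Y i))) = piW s p q (fa_gen (Dw i))
                \<and> \<chi> (piA s p q (fa_gen (U i)))
                    = piW s p q (fmul (fa_gen (Dw i)) (fa_gen (Xw i)))))
         \<and> tgw_consistent s p q TYPE('k)"
proof (intro conjI exI[of _ "chi s p q"] allI ballI)
  show "chi s p q \<in> ring_iso (TGW_alg s p q) (Weyl_alg s p q :: (wgen list \<Rightarrow> 'k) set ring)"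
    by (rule chi_iso)
  show "chi s p q (piA s p q (fa_scal c)) = piW s p q (fa_scal c)" for c :: 'k
    by (simp add: chi_piA car_fa_scal) (simp add: fa_scal_mon Psi_fsmul Psi_mon)
  fix i assume i: "i \<in> {1..p + q}"
  show "chi s p q (piA s p q (fa_gen (X i))) = (piW s p q (fa_gen (Xw i)) :: (wgen list \<Rightarrow> 'k) set)"
    "chi s p q (piA s p q (fa_gen (Y i))) = (piW s p q (fa_gen (Dw i)) :: (wgen list \<Rightarrow> 'k) set)"
    "chi s p q (piA s p q (fa_gen (U i))) =
      (piW s p q (fmul (fa_gen (Dw i)) (fa_gen (Xw i))) :: (wgen list \<Rightarrow> 'k) set)"
    using i by (simp_all add: chi_piA fa_gen_mon car_mon Psi_mon fmul_mon_mon)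
qed (rule tgw_consistent)

end
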